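(* Suppose assumptions (A1)–(A4) listed in the context hold and let $q\in(1,+\infty)$. Denote by $(\overline{x},\overline{y})$ the unique solution $(x,y)=(\overline x,\overline y)$ of the system $$ \begin{aligned} &\dot{y}(t) = g(x(t),y(t),t) && \text{for a.e. } t\in J_T,\\ & y(0) = y_0,\\ &\dot{x}(t)\,(x(t)-\xi) \leq 0 && \text{for all } \xi\in [F_-(y(t)), F_+(y(t))],\ \text{for a.e. } t\in J_T,\\ &x(0) = \min \{\max \{F_-(y_0) , x_0\} ,F_+(y_0)\},\\ &x(t)\in [F_-(y(t)), F_+(y(t))] && \text{for all } t\in\overline{J_T}. \end{aligned} $$ Then $\overline{x}\in \mathrm{W}^{1,\infty}(J_T)$ and $\overline{y}\in \mathrm{C}^1(J_T)\cap \mathrm{C}(\overline{J_T})$. Moreover, $$ x_\varepsilon \rightarrow \overline{x} \ \text{ in } \mathrm{L}^{q}(J_T)\quad\text{ and }\quad y_{\varepsilon} \rightarrow \overline{y}\ \text{ in } \mathrm{W}^{1,q}(J_T) $$ as $\varepsilon\rightarrow 0$; i.e., the singular limit $\overline{x}$ is the output of the generalized play operator for the curves $F_+$ and $F_-$ with input $\overline{y}$.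
   Context: Let $T>0$, $J_T:=(0,T)$, $(x_0,y_0)\in\mathbb{R}^2$. Let $f:\mathbb{R}^2\to\mathbb{R}$ and $g:\mathbb{R}^3\to\mathbb{R}$. For $\varepsilon>0$, $(x_\varepsilon,y_\varepsilon)$ denotes the solution on $\overline{J_T}$ of the planar fast-slow system $$\varepsilon \dot{x} = f(x,y),\qquad \dot{y} = g(x,y,t),\qquad (x(0),y(0))=(x_0,y_0).$$ Assumptions: (A1) $f,g$ are Lipschitz continuous with Lipschitz constants $L_f$ and $L_g$, respectively. (A2) There are functions $F_+>F_-$ from $\mathbb{R}$ to $\mathbb{R}$ such that $f(x,y)<0$ if $x>F_+(y)$, $f(x,y)=0$ if $x\in[F_-(y),F_+(y)]$, and $f(x,y)>0$ otherwise (i.e. if $x<F_-(y)$). (A3) $F_+,F_-$ are Lipschitz continuous with Lipschitz constants $L_+$ and $L_-$, and are monotone increasing functions. (A4) $|g(x,y,t)|\le M(t)\,(1+\mathcal{G}(x)+|y|)$, with $M>0$ continuous and $\mathcal{G}$ bounded. Generalized play operator: for Lipschitz continuous increasing $F_-\le F_+$, the output $x=x(y,x_0)$ of the generalized play operator with input $y\in \mathrm{W}^{1,p}(0,T)$ and $x_0\in\mathbb{R}$ is the solution of: $\dot{x}(t)(x(t)-\xi)\le 0$ for all $\xi\in[F_-(y(t)),F_+(y(t))]$, a.e. in $(0,T)$; $x(t)\in[F_-(y(t)),F_+(y(t))]$ in $[0,T]$; $x(0)=\min\{\max\{F_-(y(0)),x_0\},F_+(y(0))\}$. *)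

theory Defs
  imports "HOL-Analysis.Analysis"
begin

definition Lp_fun :: "real \<Rightarrow> 'a measure \<Rightarrow> ('a \<Rightarrow> real) \<Rightarrow> bool" where
  "Lp_fun p M u \<longleftrightarrow> u \<in> borel_measurable M \<and> integrable M (\<lambda>t. \<bar>u t\<bar> powr p)"

definition Linf_fun :: "'a measure \<Rightarrow> ('a \<Rightarrow> real) \<Rightarrow> bool" where
  "Linf_fun M u \<longleftrightarrow> u \<in> borel_measurable M \<and> (\<exists>C. AE t in M. \<bar>u t\<bar> \<le> C)"

definition Lp_norm :: "real \<Rightarrow> 'a measure \<Rightarrow> ('a \<Rightarrow> real) \<Rightarrow> real" where
  "Lp_norm p M u = (LINT t|M. \<bar>u t\<bar> powr p) powr (1 / p)"

text \<open>The membership conditions are needed because the Bochner integral of a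
  non-integrable function is 0, so that \<open>Lp_norm\<close> alone would not detect it.\<close>

definition tendsto_Lp ::
    "real \<Rightarrow> 'a measure \<Rightarrow> ('i \<Rightarrow> 'a \<Rightarrow> real) \<Rightarrow> ('a \<Rightarrow> real) \<Rightarrow> 'i filter \<Rightarrow> bool" where
  "tendsto_Lp p M u v F \<longleftrightarrow>
     (\<forall>\<^sub>F i in F. Lp_fun p M (u i)) \<and> Lp_fun p M v \<and>
     ((\<lambda>i. Lp_norm p M (\<lambda>t. u i t - v t)) \<longlongrightarrow> 0) F"

text \<open>Weak derivatives on an open interval \<open>I\<close>, tested against continuously differentiable
  functions with compact support in \<open>I\<close> (as in Brezis' textbook; testing against smooth
  functions only gives the same notion). Test functions are given on the whole line,
  vanishing outside a compact subset of \<open>I\<close>.\<close>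

definition test_fun :: "real set \<Rightarrow> (real \<Rightarrow> real) \<Rightarrow> (real \<Rightarrow> real) \<Rightarrow> bool" where
  "test_fun I \<phi> \<phi>' \<longleftrightarrow>
     (\<forall>t. (\<phi> has_real_derivative \<phi>' t) (at t)) \<and> continuous_on UNIV \<phi>' \<and>
     (\<exists>K. compact K \<and> K \<subseteq> I \<and> (\<forall>t. t \<notin> K \<longrightarrow> \<phi> t = 0))"

definition weak_deriv :: "real set \<Rightarrow> (real \<Rightarrow> real) \<Rightarrow> (real \<Rightarrow> real) \<Rightarrow> bool" where
  "weak_deriv I u v \<longleftrightarrow>
     (\<forall>\<phi> \<phi>'. test_fun I \<phi> \<phi>' \<longrightarrow>
        (LINT t|lebesgue_on I. u t * \<phi>' t) = - (LINT t|lebesgue_on I. v t * \<phi> t))"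

text \<open>\<open>u\<close> lies in \<open>W\<^sup>1\<^sup>,\<^sup>p(I)\<close> and \<open>v\<close> is (a version of) its weak derivative.\<close>

definition W1p_deriv :: "real \<Rightarrow> real set \<Rightarrow> (real \<Rightarrow> real) \<Rightarrow> (real \<Rightarrow> real) \<Rightarrow> bool" where
  "W1p_deriv p I u v \<longleftrightarrow>
     Lp_fun p (lebesgue_on I) u \<and> Lp_fun p (lebesgue_on I) v \<and> weak_deriv I u v"

definition W1inf_fun :: "real set \<Rightarrow> (real \<Rightarrow> real) \<Rightarrow> bool" where
  "W1inf_fun I u \<longleftrightarrow>
     Linf_fun (lebesgue_on I) u \<and> (\<exists>v. Linf_fun (lebesgue_on I) v \<and> weak_deriv I u v)"

definition tendsto_W1p ::
    "real \<Rightarrow> real set \<Rightarrow> ('i \<Rightarrow> real \<Rightarrow> real) \<Rightarrow> (real \<Rightarrow> real) \<Rightarrow> 'i filter \<Rightarrow> bool" where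
  "tendsto_W1p p I u v F \<longleftrightarrow>
     (\<exists>du dv. (\<forall>\<^sub>F i in F. W1p_deriv p I (u i) (du i)) \<and> W1p_deriv p I v dv \<and>
        tendsto_Lp p (lebesgue_on I) u v F \<and> tendsto_Lp p (lebesgue_on I) du dv F)"

text \<open>Classical solutions on the closed interval (one-sided derivatives at the end points).\<close>

definition fast_slow_solution ::
    "(real \<times> real \<Rightarrow> real) \<Rightarrow> (real \<times> real \<times> real \<Rightarrow> real) \<Rightarrow> real \<Rightarrow> real \<Rightarrow> real \<Rightarrow> real
      \<Rightarrow> (real \<Rightarrow> real) \<Rightarrow> (real \<Rightarrow> real) \<Rightarrow> bool" where
  "fast_slow_solution f g T x0 y0 \<epsilon> x y \<longleftrightarrow>
     (\<forall>t\<in>{0..T}. (x has_real_derivative f (x t, y t) / \<epsilon>) (at t within {0..T})) \<and>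
     (\<forall>t\<in>{0..T}. (y has_real_derivative g (x t, y t, t)) (at t within {0..T})) \<and>
     x 0 = x0 \<and> y 0 = y0"

text \<open>Elements of \<open>W\<^sup>1\<^sup>,\<^sup>p(0,T)\<close> are represented by their continuous representatives on the
  closed interval; without continuity the pointwise conditions would not be linked to the
  weak derivatives.\<close>

definition gen_play_output ::
    "real \<Rightarrow> real \<Rightarrow> (real \<Rightarrow> real) \<Rightarrow> (real \<Rightarrow> real) \<Rightarrow> real
      \<Rightarrow> (real \<Rightarrow> real) \<Rightarrow> (real \<Rightarrow> real) \<Rightarrow> bool" where
  "gen_play_output p T Fm Fp x0 y x \<longleftrightarrow>
     continuous_on {0..T} y \<and> (\<exists>dy. W1p_deriv p {0<..<T} y dy) \<and>
     continuous_on {0..T} x \<and>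
     (\<exists>dx. W1p_deriv p {0<..<T} x dx \<and>
        (AE t in lebesgue_on {0<..<T}. \<forall>\<xi>\<in>{Fm (y t)..Fp (y t)}. dx t * (x t - \<xi>) \<le> 0)) \<and>
     (\<forall>t\<in>{0..T}. x t \<in> {Fm (y t)..Fp (y t)}) \<and>
     x 0 = min (max (Fm (y 0)) x0) (Fp (y 0))"

text \<open>Solutions of the limit system are sought in \<open>W\<^sup>1\<^sup>,\<^sup>1(0,T)\<close>, the largest of the spaces
  \<open>W\<^sup>1\<^sup>,\<^sup>p(0,T)\<close>.\<close>

definition limit_solution ::
    "(real \<times> real \<times> real \<Rightarrow> real) \<Rightarrow> real \<Rightarrow> (real \<Rightarrow> real) \<Rightarrow> (real \<Rightarrow> real) \<Rightarrow> real \<Rightarrow> real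
      \<Rightarrow> (real \<Rightarrow> real) \<Rightarrow> (real \<Rightarrow> real) \<Rightarrow> bool" where
  "limit_solution g T Fm Fp x0 y0 x y \<longleftrightarrow>
     continuous_on {0..T} x \<and> continuous_on {0..T} y \<and>
     (\<exists>dy. W1p_deriv 1 {0<..<T} y dy \<and>
        (AE t in lebesgue_on {0<..<T}. dy t = g (x t, y t, t))) \<and>
     y 0 = y0 \<and>
     (\<exists>dx. W1p_deriv 1 {0<..<T} x dx \<and>
        (AE t in lebesgue_on {0<..<T}. \<forall>\<xi>\<in>{Fm (y t)..Fp (y t)}. dx t * (x t - \<xi>) \<le> 0)) \<and>
     x 0 = min (max (Fm y0) x0) (Fp y0) \<and>
     (\<forall>t\<in>{0..T}. x t \<in> {Fm (y t)..Fp (y t)})"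

end

theory Submission
  imports Defs
begin

text \<open>
  The play inclusion says, without derivatives, that \<open>x\<close> stays between the barriers
  \<open>F\<^sub>-(y)\<close> and \<open>F\<^sub>+(y)\<close>, is nonincreasing as long as it is above \<open>F\<^sub>-(y)\<close> and nondecreasing
  as long as it is below \<open>F\<^sub>+(y)\<close> (\<open>falls_above\<close>). The two monotonicity properties hold exactly
  for the fast variable of the fast-slow system as well, for every \<open>\<epsilon>\<close>, because \<open>f\<close> has the
  sign of a restoring force. Only membership in the band fails, and it fails by at most \<open>\<eta>\<close>
  after an initial layer of length \<open>\<eta>\<close> once \<open>\<epsilon>\<close> is small: outside an \<open>\<eta>/2\<close>-neighbourhood of
  the band \<open>f\<close> is bounded away from 0 on compact sets, so \<open>x\<close> moves there with speed of order
  \<open>1/\<epsilon>\<close> while the barriers move with bounded speed (\<open>attracted_below\<close>). Hence the exact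
  solutions of the limit system and the fast-slow solutions are all \<open>\<eta>\<close>-approximate solutions
  of one system (\<open>approx_play\<close>).

  The heart of the proof is that two \<open>\<eta>\<close>-approximate solutions differ by at most a constant
  times \<open>\<eta>\<close>, the fast variables from the end of the layer on (\<open>approx_play_stability\<close>). For given slow variables the play is Lipschitz in the
  supremum norm: if \<open>x\<^sub>1 - x\<^sub>2\<close> exceeds the distance of the barriers, then \<open>x\<^sub>1\<close> is above its lower
  barrier and \<open>x\<^sub>2\<close> below its upper one, so that \<open>x\<^sub>1 - x\<^sub>2\<close> cannot grow
  (\<open>falls_above_comparison\<close>). Inserted into the slow equation, this closes by a supremum norm
  with exponential weight. One estimate thus yields uniqueness for the limit system, the Cauchy
  property of the fast-slow solutions as \<open>\<epsilon> \<rightarrow> 0\<close>, and the rate at which they converge away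
  from \<open>t = 0\<close>. The defining properties of \<open>approx_play\<close> pass to the limit, so the limit is an
  exact solution, with \<open>x\<close> Lipschitz continuous (\<open>approx_play_limit\<close>).

  What remains is the translation between these pointwise properties and weak derivatives.
  A Lipschitz function has a bounded density, by the Radon-Nikodym theorem applied to its
  Stieltjes measure, and the sign of the density is inherited from monotonicity on intervals
  (\<open>lipschitz_density\<close>); conversely a weak derivative without positive part on an interval forces
  monotonicity there (\<open>weak_deriv_nonpos_imp_decreasing\<close>). Convergence in \<open>L\<^sup>q\<close> follows from
  pointwise convergence on \<open>(0, T)\<close> and uniform bounds; the initial layer, where convergence
  is not uniform, is invisible there.
\<close>

section \<open>Functions that fall above a barrier\<close>

lemma last_nonpositive_point:
  fixes d :: "real \<Rightarrow> real"
  assumes "continuous_on {s..t} d" "s \<le> t" "d s \<le> 0" "0 < d t"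
  obtains u where "s \<le> u" "u < t" "d u \<le> 0" "\<And>r. u < r \<Longrightarrow> r \<le> t \<Longrightarrow> 0 < d r"
proof -
  define A where "A = {r \<in> {s..t}. d r \<le> 0}"
  have "closed A" unfolding A_def
    using assms(1) by (intro continuous_on_closed_Collect_le) auto
  moreover have "A = {s..t} \<inter> A" by (auto simp: A_def)
  ultimately have "compact A" by (metis compact_Int_closed compact_Icc)
  moreover have "A \<noteq> {}" using assms by (auto simp: A_def)
  ultimately obtain u where u: "u \<in> A" "\<And>r. r \<in> A \<Longrightarrow> r \<le> u"
    using compact_attains_sup by metis
  have "u \<noteq> t" using u(1) assms(4) by (auto simp: A_def)
  show ?thesis
  proof
    show "s \<le> u" "u < t" "d u \<le> 0" using u(1) \<open>u \<noteq> t\<close> by (auto simp: A_def)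
    show "0 < d r" if "u < r" "r \<le> t" for r
      using u(2)[of r] that \<open>s \<le> u\<close> by (force simp: A_def)
  qed
qed

lemma le_left_end_by_continuity:
  fixes x :: "real \<Rightarrow> real"
  assumes "continuous_on {u..t} x" "u < t" "\<And>r. u < r \<Longrightarrow> r \<le> t \<Longrightarrow> c \<le> x r"
  shows "c \<le> x u"
proof -
  have "(x \<longlongrightarrow> x u) (at_right u)"
    using assms(1,2) continuous_on_Icc_at_rightD by blast
  moreover have "eventually (\<lambda>r. c \<le> x r) (at_right u)"
    using assms(2,3) by (auto simp: eventually_at_right)
  ultimately show ?thesis
    by (rule tendsto_lowerbound) simp
qed

text \<open>One half of the play inclusion in a form that survives uniform limits: the other half is the
same property of \<open>- x\<close> with respect to \<open>- h\<close>. Strictness of \<open>h r < x r\<close> is what makes the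
property stable, since on a compact interval a strict inequality persists under small
perturbations.\<close>

definition falls_above :: "real set \<Rightarrow> (real \<Rightarrow> real) \<Rightarrow> (real \<Rightarrow> real) \<Rightarrow> bool" where
  "falls_above I h x \<longleftrightarrow>
     (\<forall>s t. s \<le> t \<and> {s..t} \<subseteq> I \<and> (\<forall>r\<in>{s..t}. h r < x r) \<longrightarrow> x t \<le> x s)"

lemma falls_aboveD:
  "falls_above I h x \<Longrightarrow> s \<le> t \<Longrightarrow> {s..t} \<subseteq> I \<Longrightarrow> (\<And>r. r \<in> {s..t} \<Longrightarrow> h r < x r) \<Longrightarrow> x t \<le> x s"
  unfolding falls_above_def by blast

text \<open>A function that falls above \<open>h\<close> cannot cross a level that \<open>h\<close> does not exceed: after its last
visit below the level it would be above \<open>h\<close>, hence nonincreasing.\<close>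

lemma falls_above_le:
  assumes fall: "falls_above {a..b} h x" and cont: "continuous_on {a..b} x"
    and st: "a \<le> s" "s \<le> t" "t \<le> b"
    and c: "x s \<le> c" "\<And>r. r \<in> {s..t} \<Longrightarrow> h r \<le> c"
  shows "x t \<le> c"
proof (rule ccontr)
  assume "\<not> x t \<le> c"
  have cont': "continuous_on {s..t} x" using cont st by (auto intro: continuous_on_subset)
  then have "continuous_on {s..t} (\<lambda>r. x r - c)" by (intro continuous_intros)
  then obtain u where u: "s \<le> u" "u < t" "x u \<le> c" "\<And>r. u < r \<Longrightarrow> r \<le> t \<Longrightarrow> c < x r"
    using last_nonpositive_point[of s t "\<lambda>r. x r - c"] st c \<open>\<not> x t \<le> c\<close> by auto
  have "x t \<le> x u"
  proof (rule le_left_end_by_continuity[OF _ u(2)])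
    show "continuous_on {u..t} x" using cont' u by (auto intro: continuous_on_subset)
    show "x t \<le> x r" if "u < r" "r \<le> t" for r
    proof (rule falls_aboveD[OF fall])
      show "h r' < x r'" if "r' \<in> {r..t}" for r'
        using c(2)[of r'] u(1) u(4)[of r'] that \<open>u < r\<close> by force
    qed (use that u st in auto)
  qed
  then show False using u(3) \<open>\<not> x t \<le> c\<close> by simp
qed

text \<open>The Lipschitz estimate for the play. At times where \<open>x - z > \<delta>\<close>, the function \<open>x\<close> is above
its lower barrier \<open>lo\<close> and \<open>z\<close> is below its upper barrier \<open>up\<close>; so after the last time
with \<open>x - z \<le> \<delta>\<close> both move towards each other.\<close>

lemma falls_above_comparison:
  assumes fall1: "falls_above {a..b} lo x"
    and fall2: "falls_above {a..b} (\<lambda>r. - up r) (\<lambda>r. - z r)"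
    and cont: "continuous_on {a..b} x" "continuous_on {a..b} z"
    and ab: "a \<le> b"
    and init: "x a - z a \<le> \<delta>"
    and lo: "\<And>r. r \<in> {a..b} \<Longrightarrow> lo r \<le> z r + \<delta>"
    and up: "\<And>r. r \<in> {a..b} \<Longrightarrow> x r \<le> up r + \<delta>"
  shows "x b - z b \<le> \<delta>"
proof (rule ccontr)
  assume neg: "\<not> ?thesis"
  have "continuous_on {a..b} (\<lambda>r. x r - z r - \<delta>)" using cont by (intro continuous_intros)
  then obtain u where u: "a \<le> u" "u < b" "x u - z u \<le> \<delta>"
      "\<And>r. u < r \<Longrightarrow> r \<le> b \<Longrightarrow> \<delta> < x r - z r"
    using last_nonpositive_point[of a b "\<lambda>r. x r - z r - \<delta>"] ab init neg by auto
  have "x b - z b \<le> x u - z u"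
  proof (rule le_left_end_by_continuity[OF _ u(2)])
    have "continuous_on {u..b} x" "continuous_on {u..b} z"
      using cont u by (auto intro: continuous_on_subset)
    then show "continuous_on {u..b} (\<lambda>r. x r - z r)" by (intro continuous_intros)
    fix r assume r: "u < r" "r \<le> b"
    have gap: "\<delta> < x r' - z r'" "r' \<in> {a..b}" if "r' \<in> {r..b}" for r'
      using u(1) u(4)[of r'] that r by auto
    have "lo r' < x r'" "- up r' < - z r'" if "r' \<in> {r..b}" for r'
      using gap[OF that] lo[of r'] up[of r'] by auto
    then have "x b \<le> x r" "- z b \<le> - z r"
      using r u(1) by (intro falls_aboveD[OF fall1] falls_aboveD[OF fall2]; force)+
    then show "x b - z b \<le> x r - z r" by linarith
  qed
  then show False using u(3) neg by simp
qed

lemma increment_mono_deriv: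
  fixes u w :: "real \<Rightarrow> real"
  assumes u: "\<And>t. t \<in> {0..T} \<Longrightarrow> (u has_real_derivative u' t) (at t within {0..T})"
    and w: "\<And>t. t \<in> {0..T} \<Longrightarrow> (w has_real_derivative w' t) (at t within {0..T})"
    and ab: "0 \<le> a" "a \<le> b" "b \<le> T"
    and le: "\<And>t. a < t \<Longrightarrow> t < b \<Longrightarrow> u' t \<le> w' t"
  shows "u b - u a \<le> w b - w a"
proof -
  have "w a - u a \<le> w b - u b"
  proof (rule DERIV_nonneg_imp_increasing_open[OF ab(2)])
    show "\<exists>y. ((\<lambda>t. w t - u t) has_real_derivative y) (at t) \<and> 0 \<le> y" if t: "a < t" "t < b" for t
    proof -
      have "at t within {0..T} = at t" using t ab by (intro at_within_Icc_at) auto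
      then show ?thesis using DERIV_diff[OF w u, of t] le[OF t] t ab by auto
    qed
    have "continuous_on {0..T} (\<lambda>t. w t - u t)"
      using u w by (intro continuous_intros DERIV_continuous_on) blast+
    then show "continuous_on {a..b} (\<lambda>t. w t - u t)"
      by (rule continuous_on_subset) (use ab in auto)
  qed
  then show ?thesis by linarith
qed

lemma increment_bound_deriv:
  fixes u w :: "real \<Rightarrow> real"
  assumes u: "\<And>t. t \<in> {0..T} \<Longrightarrow> (u has_real_derivative u' t) (at t within {0..T})"
    and w: "\<And>t. t \<in> {0..T} \<Longrightarrow> (w has_real_derivative w' t) (at t within {0..T})"
    and ab: "0 \<le> a" "a \<le> b" "b \<le> T"
    and le: "\<And>t. a < t \<Longrightarrow> t < b \<Longrightarrow> \<bar>u' t\<bar> \<le> w' t"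
  shows "\<bar>u b - u a\<bar> \<le> w b - w a"
proof -
  have "u b - u a \<le> w b - w a"
    using le by (intro increment_mono_deriv[OF u w ab]) (auto simp: abs_le_iff)
  moreover have "- u b - - u a \<le> w b - w a"
  proof (rule increment_mono_deriv[where u' = "\<lambda>t. - u' t", OF _ w ab])
    show "((\<lambda>t. - u t) has_real_derivative - u' t) (at t within {0..T})" if "t \<in> {0..T}" for t
      using DERIV_minus[OF u[OF that]] .
  qed (use le in \<open>auto simp: abs_le_iff\<close>)
  ultimately show ?thesis by linarith
qed

lemma falls_above_if_deriv_nonpos:
  assumes "\<And>t. t \<in> {0..T} \<Longrightarrow> (x has_real_derivative x' t) (at t within {0..T})"
    and "\<And>t. t \<in> {0..T} \<Longrightarrow> h t < x t \<Longrightarrow> x' t \<le> 0"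
  shows "falls_above {0..T} h x"
  unfolding falls_above_def
proof safe
  fix s t :: real
  assume st: "s \<le> t" "{s..t} \<subseteq> {0..T}" "\<forall>r\<in>{s..t}. h r < x r"
  have "x t - x s \<le> 0 - 0"
    by (rule increment_mono_deriv[where w = "\<lambda>_. 0" and w' = "\<lambda>_. 0", OF assms(1)])
       (use st assms(2) in auto)
  then show "x t \<le> x s" by simp
qed

section \<open>Stability of approximate solutions of the play system\<close>

lemma le_if_le_add_small:
  fixes a b c T :: real
  assumes "0 < T" "\<And>\<eta>. 0 < \<eta> \<Longrightarrow> \<eta> \<le> T \<Longrightarrow> a \<le> b + c * \<eta>"
  shows "a \<le> b"
proof (rule tendsto_lowerbound)
  have "((\<lambda>\<eta>. b + c * \<eta>) \<longlongrightarrow> b + c * 0) (at_right 0)" by (intro tendsto_intros)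
  then show "((\<lambda>\<eta>. b + c * \<eta>) \<longlongrightarrow> b) (at_right 0)" by simp
  show "\<forall>\<^sub>F \<eta> in at_right 0. a \<le> b + c * \<eta>"
    using assms by (auto simp: eventually_at_right intro!: exI[of _ T])
qed simp

lemma lipschitz_on_abs:
  fixes h :: "real \<Rightarrow> real"
  shows "L-lipschitz_on A h \<Longrightarrow> s \<in> A \<Longrightarrow> t \<in> A \<Longrightarrow> \<bar>h s - h t\<bar> \<le> L * \<bar>s - t\<bar>"
  using lipschitz_onD[of L A h s t] by (simp add: dist_real_def)

lemma falls_above_subset: "falls_above I h x \<Longrightarrow> J \<subseteq> I \<Longrightarrow> falls_above J h x"
  unfolding falls_above_def by (meson subset_trans)

text \<open>The data of the limit system, with one Lipschitz constant \<open>L\<close> for both barriers, a bound \<open>K\<close>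
for the speed of the slow variable and the start \<open>xs\<close> of the play.\<close>

locale play_system =
  fixes T y0 xs Lg L K :: real and g :: "real \<times> real \<times> real \<Rightarrow> real" and Fm Fp :: "real \<Rightarrow> real"
  assumes T: "0 < T"
    and g_lip: "Lg-lipschitz_on UNIV g"
    and Fm_lip: "L-lipschitz_on UNIV Fm" and Fp_lip: "L-lipschitz_on UNIV Fp"
    and band: "Fm y < Fp y"
    and K: "0 \<le> K"
    and xs: "Fm y0 \<le> xs" "xs \<le> Fp y0"
begin

lemma Lg: "0 \<le> Lg" and L: "0 \<le> L"
  using g_lip Fm_lip by (auto dest: lipschitz_on_nonneg)

lemma g_diff_le: "\<bar>g (a, b, t) - g (a', b', t)\<bar> \<le> Lg * (\<bar>a - a'\<bar> + \<bar>b - b'\<bar>)"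
proof -
  have "dist (g (a, b, t)) (g (a', b', t)) \<le> Lg * dist (a, b, t) (a', b', t)"
    by (rule lipschitz_onD[OF g_lip]) auto
  also have "dist (a, b, t) (a', b', t) \<le> \<bar>a - a'\<bar> + \<bar>b - b'\<bar>"
    by (simp add: dist_Pair_Pair dist_real_def sqrt_sum_squares_le_sum_abs)
  finally show ?thesis using Lg by (simp add: dist_real_def mult_left_mono)
qed

text \<open>The parameter \<open>\<eta>\<close> is both the permitted distance from the band and the length of the initial
layer in which nothing is asked of that distance. For \<open>\<eta> = 0\<close> these are the exact solutions.
The initial value is prescribed only after clamping to the band, since the fast-slow solutions
start at a point that may lie outside.\<close>

definition approx_play :: "real \<Rightarrow> (real \<Rightarrow> real) \<Rightarrow> (real \<Rightarrow> real) \<Rightarrow> bool" where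
  "approx_play \<eta> x y \<longleftrightarrow>
     continuous_on {0..T} x \<and>
     (\<forall>t\<in>{0..T}. (y has_real_derivative g (x t, y t, t)) (at t within {0..T})) \<and>
     K-lipschitz_on {0..T} y \<and> y 0 = y0 \<and>
     falls_above {0..T} (\<lambda>t. Fm (y t)) x \<and>
     falls_above {0..T} (\<lambda>t. - Fp (y t)) (\<lambda>t. - x t) \<and>
     min (max (Fm y0) (x 0)) (Fp y0) = xs \<and>
     (\<forall>t\<in>{\<eta>..T}. Fm (y t) - \<eta> \<le> x t \<and> x t \<le> Fp (y t) + \<eta>)"

lemma approx_playD:
  assumes "approx_play \<eta> x y"
  shows "continuous_on {0..T} x"
    "\<And>t. t \<in> {0..T} \<Longrightarrow> (y has_real_derivative g (x t, y t, t)) (at t within {0..T})"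
    "K-lipschitz_on {0..T} y" "y 0 = y0"
    "falls_above {0..T} (\<lambda>t. Fm (y t)) x"
    "falls_above {0..T} (\<lambda>t. - Fp (y t)) (\<lambda>t. - x t)"
    "min (max (Fm y0) (x 0)) (Fp y0) = xs"
    "\<And>t. \<eta> \<le> t \<Longrightarrow> t \<le> T \<Longrightarrow> Fm (y t) - \<eta> \<le> x t \<and> x t \<le> Fp (y t) + \<eta>"
  using assms unfolding approx_play_def by auto

lemma barriers_along_path:
  assumes "K-lipschitz_on {0..T} y" "s \<in> {0..T}" "t \<in> {0..T}"
  shows "\<bar>Fm (y s) - Fm (y t)\<bar> \<le> L * K * \<bar>s - t\<bar>" "\<bar>Fp (y s) - Fp (y t)\<bar> \<le> L * K * \<bar>s - t\<bar>"
proof -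
  have "\<bar>y s - y t\<bar> \<le> K * \<bar>s - t\<bar>" by (rule lipschitz_on_abs[OF assms])
  then have *: "L * \<bar>y s - y t\<bar> \<le> L * K * \<bar>s - t\<bar>"
    using mult_left_mono[OF _ L] by (simp add: mult.assoc)
  show "\<bar>Fm (y s) - Fm (y t)\<bar> \<le> L * K * \<bar>s - t\<bar>" "\<bar>Fp (y s) - Fp (y t)\<bar> \<le> L * K * \<bar>s - t\<bar>"
    using lipschitz_on_abs[OF Fm_lip, of "y s" "y t"] lipschitz_on_abs[OF Fp_lip, of "y s" "y t"] *
    by auto
qed

text \<open>During the layer the barriers move by at most \<open>L K \<eta>\<close>; so \<open>x\<close> can neither leave the band by
more nor move inside it by more, and at its end it is near the clamped initial value.\<close>

lemma approx_play_initial_layer: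
  assumes ap: "approx_play \<eta> x y" and \<eta>: "0 < \<eta>" "\<eta> \<le> T"
  shows "\<bar>x \<eta> - xs\<bar> \<le> (L * K + 1) * \<eta>"
proof -
  note D = approx_playD[OF ap]
  have LK: "0 \<le> L * K" using L K by simp
  have near: "Fm (y r) \<le> Fm y0 + L * K * \<eta>" "Fp y0 - L * K * \<eta> \<le> Fp (y r)"
      "Fm y0 - L * K * \<eta> \<le> Fm (y r)" "Fp (y r) \<le> Fp y0 + L * K * \<eta>" if "r \<in> {0..\<eta>}" for r
  proof -
    have "L * K * \<bar>r - 0\<bar> \<le> L * K * \<eta>" using that LK by (intro mult_left_mono) auto
    then show "Fm (y r) \<le> Fm y0 + L * K * \<eta>" "Fp y0 - L * K * \<eta> \<le> Fp (y r)"
      "Fm y0 - L * K * \<eta> \<le> Fm (y r)" "Fp (y r) \<le> Fp y0 + L * K * \<eta>"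
      using barriers_along_path[OF D(3), of r 0] that \<eta> D(4) by (auto simp: abs_le_iff)
  qed
  have "x \<eta> \<le> max (x 0) (Fm y0 + L * K * \<eta>)"
    by (rule falls_above_le[OF D(5,1), of 0]) (use \<eta> near in \<open>auto intro: max.coboundedI2\<close>)
  moreover have "- x \<eta> \<le> max (- x 0) (- Fp y0 + L * K * \<eta>)"
  proof (rule falls_above_le[OF D(6), where s = 0])
    show "continuous_on {0..T} (\<lambda>t. - x t)" using D(1) by (intro continuous_intros)
    show "- Fp (y r) \<le> max (- x 0) (- Fp y0 + L * K * \<eta>)" if "r \<in> {0..\<eta>}" for r
      using near(2)[OF that] by linarith
  qed (use \<eta> in auto)
  moreover have "Fm y0 - L * K * \<eta> - \<eta> \<le> x \<eta>" "x \<eta> \<le> Fp y0 + L * K * \<eta> + \<eta>"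
    using D(8)[of \<eta>] near[of \<eta>] \<eta> by auto
  moreover have "0 \<le> L * K * \<eta>" using LK \<eta> by simp
  ultimately show ?thesis using D(7) xs \<eta> band[of y0] by (simp add: distrib_right)
qed

text \<open>The fast variable moves only when it is pushed by a barrier.\<close>

lemma approx_play_increment:
  assumes ap: "approx_play \<eta> x y" and \<eta>: "0 < \<eta>" and st: "\<eta> \<le> s" "s \<le> t" "t \<le> T"
  shows "\<bar>x t - x s\<bar> \<le> L * K * (t - s) + \<eta>"
proof -
  note D = approx_playD[OF ap]
  have LK: "0 \<le> L * K" using L K by simp
  have near: "Fm (y r) \<le> x s + L * K * (t - s) + \<eta>" "x s - L * K * (t - s) - \<eta> \<le> Fp (y r)"
    if "r \<in> {s..t}" for r
  proof -
    have "L * K * \<bar>r - s\<bar> \<le> L * K * (t - s)" using that LK by (intro mult_left_mono) auto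
    then show "Fm (y r) \<le> x s + L * K * (t - s) + \<eta>" "x s - L * K * (t - s) - \<eta> \<le> Fp (y r)"
      using barriers_along_path[OF D(3), of r s] that \<eta> st D(8)[of s] by (auto simp: abs_le_iff)
  qed
  have "0 \<le> L * K * (t - s)" using LK st by simp
  have "x t \<le> x s + L * K * (t - s) + \<eta>"
    by (rule falls_above_le[OF D(5,1), of s]) (use \<eta> st near(1) \<open>0 \<le> L * K * (t - s)\<close> in simp_all)
  moreover have "- x t \<le> - (x s - L * K * (t - s) - \<eta>)"
  proof (rule falls_above_le[OF D(6), where s = s])
    show "continuous_on {0..T} (\<lambda>t. - x t)" using D(1) by (intro continuous_intros)
    show "- Fp (y r) \<le> - (x s - L * K * (t - s) - \<eta>)" if "r \<in> {s..t}" for r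
      using near(2)[OF that] by linarith
  qed (use \<open>0 \<le> L * K * (t - s)\<close> \<eta> st in auto)
  ultimately show ?thesis by (simp add: abs_le_iff)
qed

text \<open>The exponential weight \<open>rate\<close> is large enough for the integrated weight to halve the Lipschitz
constant of the coupled system; \<open>stab_y\<close> and \<open>stab\<close> are the resulting constants for the slow
variable and for both variables.\<close>

definition rate :: real where "rate = 2 * Lg * (L + 1) + 1"
definition stab_y :: real where
  "stab_y = 2 * (2 * K + 2 * Lg * (L * K + 1) * T) * exp (rate * T)"
definition stab :: real where "stab = 2 * (L * K + 1) + (L + 1) * stab_y"

lemma rate_pos: "0 < rate"
  unfolding rate_def using Lg L by (simp add: add_nonneg_pos)

lemma stab_nonneg: "0 \<le> stab_y" "0 \<le> stab"
  unfolding stab_def stab_y_def using Lg L K T by simp_all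

lemma approx_play_fast_le:
  assumes ap: "approx_play \<eta> x1 y1" "approx_play \<eta> x2 y2" and \<eta>: "0 < \<eta>" "\<eta> \<le> T"
    and t: "\<eta> \<le> t" "t \<le> T"
    and d: "\<And>r. r \<in> {0..t} \<Longrightarrow> \<bar>y1 r - y2 r\<bar> \<le> d"
  shows "x1 t - x2 t \<le> 2 * (L * K + 1) * \<eta> + L * d"
proof -
  note D1 = approx_playD[OF ap(1)] and D2 = approx_playD[OF ap(2)]
  have d0: "0 \<le> d" using d[of 0] t \<eta> by auto
  have Ld: "L * \<bar>y1 r - y2 r\<bar> \<le> L * d" if "r \<in> {0..t}" for r
    using d[OF that] L by (rule mult_left_mono)
  have F: "\<bar>Fm (y1 r) - Fm (y2 r)\<bar> \<le> L * d" "\<bar>Fp (y1 r) - Fp (y2 r)\<bar> \<le> L * d" if "r \<in> {0..t}" for r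
    using lipschitz_on_abs[OF Fm_lip, of "y1 r" "y2 r"] lipschitz_on_abs[OF Fp_lip, of "y1 r" "y2 r"]
      Ld[OF that] by auto
  have sub: "{\<eta>..t} \<subseteq> {0..T}" using t \<eta> by auto
  have nn: "0 \<le> L * K * \<eta>" "0 \<le> L * d" using L K \<eta> d0 by auto
  show ?thesis
  proof (rule falls_above_comparison[where x = x1 and z = x2 and a = \<eta> and b = t and lo = "\<lambda>r. Fm (y1 r)" and up = "\<lambda>r. Fp (y2 r)"])
    show "falls_above {\<eta>..t} (\<lambda>r. Fm (y1 r)) x1" "falls_above {\<eta>..t} (\<lambda>r. - Fp (y2 r)) (\<lambda>r. - x2 r)"
      by (rule falls_above_subset[OF D1(5) sub] falls_above_subset[OF D2(6) sub])+
    show "continuous_on {\<eta>..t} x1" "continuous_on {\<eta>..t} x2"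
      by (rule continuous_on_subset[OF D1(1) sub] continuous_on_subset[OF D2(1) sub])+
    show "x1 \<eta> - x2 \<eta> \<le> 2 * (L * K + 1) * \<eta> + L * d"
      using approx_play_initial_layer[OF ap(1) \<eta>] approx_play_initial_layer[OF ap(2) \<eta>] nn
      by (simp add: abs_le_iff distrib_right)
    show "Fm (y1 r) \<le> x2 r + (2 * (L * K + 1) * \<eta> + L * d)"
      "x1 r \<le> Fp (y2 r) + (2 * (L * K + 1) * \<eta> + L * d)" if "r \<in> {\<eta>..t}" for r
      using F[of r] D1(8)[of r] D2(8)[of r] that t \<eta> nn by (auto simp: abs_le_iff distrib_right)
  qed (use t in auto)
qed

text \<open>Let \<open>m\<close> be the maximum of \<open>exp (- rate t) |y\<^sub>1 t - y\<^sub>2 t|\<close>. Because the weight is monotone,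
\<open>|y\<^sub>1 - y\<^sub>2| \<le> m exp (rate t)\<close> on the whole of \<open>[0, t]\<close>, and the estimate for the play bounds
\<open>|x\<^sub>1 - x\<^sub>2|\<close> at \<open>t\<close> by the same expression up to constants and \<open>O(\<eta>)\<close>. Integrating the slow
equation returns \<open>m \<le> O(\<eta>) + m / 2\<close>.\<close>

lemma approx_play_stability:
  assumes ap: "approx_play \<eta> x1 y1" "approx_play \<eta> x2 y2" and \<eta>: "0 < \<eta>" "\<eta> \<le> T"
  shows "t \<in> {0..T} \<Longrightarrow> \<bar>y1 t - y2 t\<bar> \<le> stab * \<eta>"
    and "t \<in> {\<eta>..T} \<Longrightarrow> \<bar>x1 t - x2 t\<bar> \<le> stab * \<eta>"
proof -
  note D1 = approx_playD[OF ap(1)] and D2 = approx_playD[OF ap(2)]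
  define a where "a = 2 * (L * K + 1) * \<eta>"
  define B where "B = 2 * K + 2 * Lg * (L * K + 1) * T"
  have a: "0 \<le> a" unfolding a_def using L K \<eta> by simp
  have B: "0 \<le> B" unfolding B_def using Lg L K T by simp
  have cy: "continuous_on {0..T} y1" "continuous_on {0..T} y2"
    using D1(3) D2(3) by (auto intro: lipschitz_on_continuous_on)
  have "continuous_on {0..T} (\<lambda>t. exp (- (rate * t)) * \<bar>y1 t - y2 t\<bar>)"
    using cy by (intro continuous_intros)
  from continuous_attains_sup[OF compact_Icc _ this]
  obtain p where p: "p \<in> {0..T}"
      "\<And>t. t \<in> {0..T} \<Longrightarrow> exp (- (rate * t)) * \<bar>y1 t - y2 t\<bar> \<le> exp (- (rate * p)) * \<bar>y1 p - y2 p\<bar>"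
    using T by auto
  define m where "m = exp (- (rate * p)) * \<bar>y1 p - y2 p\<bar>"
  have m0: "0 \<le> m" by (simp add: m_def)
  have le_m: "\<bar>y1 t - y2 t\<bar> \<le> m * exp (rate * t)" if "t \<in> {0..T}" for t
  proof -
    have "exp (- (rate * t)) * \<bar>y1 t - y2 t\<bar> * exp (rate * t) \<le> m * exp (rate * t)"
      unfolding m_def by (rule mult_right_mono[OF p(2)[OF that]]) simp
    then show ?thesis by (simp add: exp_minus field_simps)
  qed
  have ydiff: "\<bar>y1 r - y2 r\<bar> \<le> m * exp (rate * t)" if "r \<in> {0..t}" "t \<le> T" for r t
  proof -
    have "m * exp (rate * r) \<le> m * exp (rate * t)"
      using that rate_pos m0 by (intro mult_left_mono) auto
    then show ?thesis using le_m[of r] that by auto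
  qed
  have xdiff: "\<bar>x1 t - x2 t\<bar> \<le> a + L * (m * exp (rate * t))" if "\<eta> \<le> t" "t \<le> T" for t
  proof -
    have "x1 t - x2 t \<le> a + L * (m * exp (rate * t))"
      unfolding a_def by (rule approx_play_fast_le[OF ap \<eta> that ydiff]) (use that in auto)
    moreover have "x2 t - x1 t \<le> a + L * (m * exp (rate * t))"
      unfolding a_def
      by (rule approx_play_fast_le[OF ap(2,1) \<eta> that]) (use that ydiff in \<open>auto simp: abs_minus_commute\<close>)
    ultimately show ?thesis by (simp add: abs_le_iff)
  qed
  have early: "\<bar>y1 t - y2 t\<bar> \<le> 2 * K * \<eta>" if "t \<in> {0..\<eta>}" for t
  proof -
    have "K * \<bar>t - 0\<bar> \<le> K * \<eta>" using that K by (intro mult_left_mono) auto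
    then show ?thesis
      using lipschitz_on_abs[OF D1(3), of t 0] lipschitz_on_abs[OF D2(3), of t 0] that \<eta> D1(4) D2(4) by auto
  qed
  have \<eta>B: "2 * K * \<eta> \<le> B * \<eta>"
    unfolding B_def using Lg L K T \<eta> by (intro mult_right_mono) auto
  have late: "\<bar>y1 t - y2 t\<bar> \<le> B * \<eta> + m / 2 * exp (rate * t)" if t: "\<eta> \<le> t" "t \<le> T" for t
  proof -
    \<comment> \<open>a primitive of the Lipschitz bound for the difference of the slow velocities\<close>
    let ?w = "\<lambda>s. Lg * a * s + Lg * (L + 1) * m / rate * exp (rate * s)"
    let ?w' = "\<lambda>s. Lg * (a + (L + 1) * (m * exp (rate * s)))"
    have "\<bar>(y1 t - y2 t) - (y1 \<eta> - y2 \<eta>)\<bar> \<le> ?w t - ?w \<eta>"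
    proof (rule increment_bound_deriv[where w' = ?w' and T = T])
      show "((\<lambda>s. y1 s - y2 s) has_real_derivative g (x1 s, y1 s, s) - g (x2 s, y2 s, s)) (at s within {0..T})"
        if "s \<in> {0..T}" for s
        using D1(2)[OF that] D2(2)[OF that] by (rule DERIV_diff)
      show "(?w has_real_derivative ?w' s) (at s within {0..T})" for s
        using rate_pos by (auto intro!: derivative_eq_intros simp: field_simps)
      show "\<bar>g (x1 s, y1 s, s) - g (x2 s, y2 s, s)\<bar> \<le> ?w' s" if "\<eta> < s" "s < t" for s
      proof -
        have "\<bar>x1 s - x2 s\<bar> + \<bar>y1 s - y2 s\<bar> \<le> a + (L + 1) * (m * exp (rate * s))"
          using xdiff[of s] le_m[of s] that t \<eta> by (auto simp: distrib_right)
        then show ?thesis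
          using g_diff_le[of "x1 s" "y1 s" s "x2 s" "y2 s"] mult_left_mono[OF _ Lg] by (meson order_trans)
      qed
    qed (use t \<eta> in auto)
    moreover have "\<bar>y1 \<eta> - y2 \<eta>\<bar> \<le> 2 * K * \<eta>" using early[of \<eta>] \<eta> by auto
    moreover have "0 \<le> ?w \<eta>"
      using Lg a L m0 rate_pos \<eta> by (intro add_nonneg_nonneg mult_nonneg_nonneg divide_nonneg_pos) auto
    moreover have "Lg * a * t \<le> 2 * Lg * (L * K + 1) * T * \<eta>"
    proof -
      have "Lg * a * t \<le> Lg * a * T" using t(2) Lg a by (intro mult_left_mono) auto
      then show ?thesis by (simp add: a_def algebra_simps)
    qed
    moreover have "Lg * (L + 1) * m / rate * exp (rate * t) \<le> m / 2 * exp (rate * t)"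
    proof (rule mult_right_mono)
      have "2 * Lg * (L + 1) * m \<le> rate * m"
        unfolding rate_def using m0 by (intro mult_right_mono) auto
      then show "Lg * (L + 1) * m / rate \<le> m / 2" using rate_pos by (simp add: field_simps)
    qed simp
    ultimately show ?thesis unfolding B_def distrib_right by linarith
  qed
  have "m \<le> B * \<eta> + m / 2"
  proof (cases "p \<le> \<eta>")
    case True
    have "m \<le> 1 * \<bar>y1 p - y2 p\<bar>"
      unfolding m_def using p rate_pos by (intro mult_right_mono) auto
    then show ?thesis using early[of p] \<eta>B m0 p True by auto
  next
    case False
    have "m \<le> exp (- (rate * p)) * (B * \<eta> + m / 2 * exp (rate * p))"
    proof -
      have "\<bar>y1 p - y2 p\<bar> \<le> B * \<eta> + m / 2 * exp (rate * p)" using late[of p] False p by auto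
      then show ?thesis
        by (subst (1) m_def) (rule mult_left_mono, simp_all)
    qed
    also have "\<dots> = exp (- (rate * p)) * (B * \<eta>) + m / 2"
      by (simp add: distrib_left exp_minus)
    also have "exp (- (rate * p)) * (B * \<eta>) \<le> 1 * (B * \<eta>)"
      using p rate_pos B \<eta> by (intro mult_right_mono) auto
    finally show ?thesis by simp
  qed
  then have m: "m \<le> 2 * B * \<eta>" by simp
  have mexp: "m * exp (rate * t) \<le> stab_y * \<eta>" if "t \<in> {0..T}" for t
  proof -
    have "m * exp (rate * t) \<le> (2 * B * \<eta>) * exp (rate * T)"
      using m that rate_pos m0 by (intro mult_mono) auto
    then show ?thesis by (simp add: stab_y_def B_def algebra_simps)
  qed
  have nn: "0 \<le> stab_y * \<eta>" "0 \<le> L * (stab_y * \<eta>)" "0 \<le> L * K * \<eta>" using stab_nonneg \<eta> L K by auto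
  show "\<bar>y1 t - y2 t\<bar> \<le> stab * \<eta>" if "t \<in> {0..T}"
    using le_m[OF that] mexp[OF that] nn \<eta> unfolding stab_def by (simp add: algebra_simps)
  show "\<bar>x1 t - x2 t\<bar> \<le> stab * \<eta>" if "t \<in> {\<eta>..T}"
    using xdiff[of t] mult_left_mono[OF mexp[of t] L] that nn \<eta> unfolding stab_def a_def
    by (simp add: algebra_simps)
qed

section \<open>Limits of approximate solutions\<close>

text \<open>All properties are tested on an \<open>\<eta>\<close>-approximate solution within \<open>C \<eta>\<close> of the limit, and
then \<open>\<eta>\<close> tends to 0. At \<open>t = 0\<close>, where the fast variables need not converge to \<open>xs\<close>,
the limit is controlled through the end of the initial layer instead.\<close>

lemma approx_play_limit:
  assumes xb0: "xb 0 = xs"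
    and ex: "\<And>\<eta>. 0 < \<eta> \<Longrightarrow> \<eta> \<le> T \<Longrightarrow> \<exists>x y. approx_play \<eta> x y \<and>
      (\<forall>t\<in>{\<eta>..T}. \<bar>x t - xb t\<bar> \<le> C * \<eta>) \<and> (\<forall>t\<in>{0..T}. \<bar>y t - yb t\<bar> \<le> C * \<eta>)"
    and C: "0 \<le> C"
  shows "approx_play 0 xb yb" "(L * K)-lipschitz_on {0..T} xb"
proof -
  have LK: "0 \<le> L * K" using L K by simp
  have yb0: "yb 0 = y0"
  proof -
    have "\<bar>yb 0 - y0\<bar> \<le> 0 + C * \<eta>" if \<eta>: "0 < \<eta>" "\<eta> \<le> T" for \<eta>
    proof -
      obtain x y where "approx_play \<eta> x y" "\<forall>t\<in>{0..T}. \<bar>y t - yb t\<bar> \<le> C * \<eta>"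
        using ex[OF \<eta>] by blast
      then show ?thesis using approx_playD(4)[of \<eta> x y] T by (force simp: abs_minus_commute)
    qed
    then have "\<bar>yb 0 - y0\<bar> \<le> 0" by (rule le_if_le_add_small[OF T])
    then show ?thesis by simp
  qed
  have lip_y: "K-lipschitz_on {0..T} yb"
  proof (rule lipschitz_onI[OF _ K])
    fix s t assume st: "s \<in> {0..T}" "t \<in> {0..T}"
    have "\<bar>yb s - yb t\<bar> \<le> K * \<bar>s - t\<bar> + (2 * C) * \<eta>" if \<eta>: "0 < \<eta>" "\<eta> \<le> T" for \<eta>
    proof -
      obtain x y where xy: "approx_play \<eta> x y" "\<forall>t\<in>{0..T}. \<bar>y t - yb t\<bar> \<le> C * \<eta>"
        using ex[OF \<eta>] by blast
      have "\<bar>y s - y t\<bar> \<le> K * \<bar>s - t\<bar>"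
        by (rule lipschitz_on_abs[OF approx_playD(3)[OF xy(1)] st])
      then show ?thesis using xy(2)[rule_format, OF st(1)] xy(2)[rule_format, OF st(2)] by linarith
    qed
    then have "\<bar>yb s - yb t\<bar> \<le> K * \<bar>s - t\<bar>" by (rule le_if_le_add_small[OF T])
    then show "dist (yb s) (yb t) \<le> K * dist s t" by (simp add: dist_real_def)
  qed
  have in_band: "Fm (yb t) \<le> xb t \<and> xb t \<le> Fp (yb t)" if t: "t \<in> {0..T}" for t
  proof (cases "t = 0")
    case True
    then show ?thesis using xb0 yb0 xs by simp
  next
    case False
    then have t0: "0 < t" using t by simp
    have "Fm (yb t) \<le> xb t + (1 + C + L * C) * \<eta> \<and> xb t \<le> Fp (yb t) + (1 + C + L * C) * \<eta>"
      if \<eta>: "0 < \<eta>" "\<eta> \<le> t" for \<eta>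
    proof -
      obtain x y where xy: "approx_play \<eta> x y" "\<bar>x t - xb t\<bar> \<le> C * \<eta>" "\<bar>y t - yb t\<bar> \<le> C * \<eta>"
        using ex[of \<eta>] \<eta> t by auto
      have "L * \<bar>y t - yb t\<bar> \<le> L * C * \<eta>"
        using mult_left_mono[OF xy(3) L] by (simp add: mult.assoc)
      then have "\<bar>Fm (y t) - Fm (yb t)\<bar> \<le> L * C * \<eta>" "\<bar>Fp (y t) - Fp (yb t)\<bar> \<le> L * C * \<eta>"
        using lipschitz_on_abs[OF Fm_lip, of "y t" "yb t"] lipschitz_on_abs[OF Fp_lip, of "y t" "yb t"] by auto
      moreover have "Fm (y t) - \<eta> \<le> x t" "x t \<le> Fp (y t) + \<eta>"
        using approx_playD(8)[OF xy(1), of t] \<eta> t by auto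
      ultimately show ?thesis using xy(2) by (simp add: distrib_right abs_le_iff)
    qed
    then show ?thesis
      using le_if_le_add_small[OF t0, of "Fm (yb t)" "xb t" "1 + C + L * C"]
        le_if_le_add_small[OF t0, of "xb t" "Fp (yb t)" "1 + C + L * C"] by blast
  qed
  have lip_pos: "\<bar>xb t - xb s\<bar> \<le> L * K * (t - s)" if st: "0 \<le> s" "s \<le> t" "t \<le> T" for s t
  proof -
    consider "0 < s" | "s = 0" "0 < t" | "s = 0" "t = 0" using st by linarith
    then show ?thesis
    proof cases
      case 1
      have "\<bar>xb t - xb s\<bar> \<le> L * K * (t - s) + (1 + 2 * C) * \<eta>" if \<eta>: "0 < \<eta>" "\<eta> \<le> s" for \<eta>
      proof -
        obtain x y where xy: "approx_play \<eta> x y" "\<bar>x t - xb t\<bar> \<le> C * \<eta>" "\<bar>x s - xb s\<bar> \<le> C * \<eta>"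
          using ex[of \<eta>] \<eta> st by auto
        show ?thesis
          using approx_play_increment[OF xy(1) \<eta> st(2,3)] xy(2,3) by (simp add: distrib_right)
      qed
      then show ?thesis by (rule le_if_le_add_small[OF 1])
    next
      case 2
      have "\<bar>xb t - xb s\<bar> \<le> L * K * (t - s) + (2 + C + L * K) * \<eta>" if \<eta>: "0 < \<eta>" "\<eta> \<le> t" for \<eta>
      proof -
        obtain x y where xy: "approx_play \<eta> x y" "\<bar>x t - xb t\<bar> \<le> C * \<eta>"
          using ex[of \<eta>] \<eta> st by auto
        have "\<bar>x t - x \<eta>\<bar> \<le> L * K * (t - \<eta>) + \<eta>"
          by (rule approx_play_increment[OF xy(1)]) (use \<eta> st in auto)
        moreover have "\<bar>x \<eta> - xs\<bar> \<le> (L * K + 1) * \<eta>"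
          by (rule approx_play_initial_layer[OF xy(1)]) (use \<eta> st in auto)
        moreover have "L * K * (t - \<eta>) \<le> L * K * t" using LK \<eta> by (intro mult_left_mono) auto
        ultimately show ?thesis using xy(2) xb0 2 by (simp add: distrib_right)
      qed
      then show ?thesis by (rule le_if_le_add_small[OF 2(2)])
    qed auto
  qed
  show lip_x: "(L * K)-lipschitz_on {0..T} xb"
  proof (rule lipschitz_onI[OF _ LK])
    fix s t assume "s \<in> {0..T}" "t \<in> {0..T}"
    then show "dist (xb s) (xb t) \<le> L * K * dist s t"
      using lip_pos[of s t] lip_pos[of t s] by (cases "s \<le> t") (auto simp: dist_real_def abs_minus_commute)
  qed
  have cont: "continuous_on {0..T} xb" "continuous_on {0..T} yb"
    using lip_x lip_y by (auto intro: lipschitz_on_continuous_on)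
  \<comment> \<open>the sign \<open>\<sigma>\<close> treats the lower barrier and the reflected upper barrier at once\<close>
  have falls: "falls_above {0..T} (\<lambda>t. \<sigma> * F (yb t)) (\<lambda>t. \<sigma> * xb t)"
    if F: "L-lipschitz_on UNIV F" and \<sigma>: "\<bar>\<sigma>\<bar> = 1"
      and ap: "\<And>\<eta> x y. approx_play \<eta> x y \<Longrightarrow> falls_above {0..T} (\<lambda>t. \<sigma> * F (y t)) (\<lambda>t. \<sigma> * x t)"
    for F and \<sigma> :: real
    unfolding falls_above_def
  proof safe
    have pos: "\<sigma> * xb t \<le> \<sigma> * xb s"
      if st: "0 < s" "s \<le> t" "t \<le> T" and above: "\<forall>r\<in>{s..t}. \<sigma> * F (yb r) < \<sigma> * xb r" for s t
    proof -
      have "continuous_on {s..t} (\<lambda>r. \<sigma> * xb r - \<sigma> * F (yb r))"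
        using cont st by (intro continuous_intros continuous_on_compose2[OF lipschitz_on_continuous_on[OF F]])
          (auto intro: continuous_on_subset)
      from continuous_attains_inf[OF compact_Icc _ this] obtain p where p: "p \<in> {s..t}"
          "\<And>r. r \<in> {s..t} \<Longrightarrow> \<sigma> * xb p - \<sigma> * F (yb p) \<le> \<sigma> * xb r - \<sigma> * F (yb r)"
        using st by auto
      define gap where "gap = \<sigma> * xb p - \<sigma> * F (yb p)"
      have gap: "0 < gap" using above p(1) by (auto simp: gap_def)
      \<comment> \<open>for \<open>\<eta> \<le> \<eta>0\<close> the approximate solution is above its barrier on \<open>[s, t]\<close>, too\<close>
      define \<eta>0 where "\<eta>0 = min s (gap / (2 * (C + L * C + 1)))"
      have "0 \<le> L * C" using L C by simp
      then have den: "0 < C + L * C + 1" using C by simp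
      have \<eta>0: "0 < \<eta>0" unfolding \<eta>0_def using st gap den by simp
      have "\<sigma> * xb t \<le> \<sigma> * xb s + (2 * C) * \<eta>" if \<eta>: "0 < \<eta>" "\<eta> \<le> \<eta>0" for \<eta>
      proof -
        have \<eta>s: "\<eta> \<le> s" using \<eta> by (simp add: \<eta>0_def)
        obtain x y where xy: "approx_play \<eta> x y" "\<And>r. r \<in> {\<eta>..T} \<Longrightarrow> \<bar>x r - xb r\<bar> \<le> C * \<eta>"
            "\<And>r. r \<in> {0..T} \<Longrightarrow> \<bar>y r - yb r\<bar> \<le> C * \<eta>"
          using ex[of \<eta>] \<eta> st \<eta>s by auto
        have sg: "\<bar>\<sigma> * a - \<sigma> * b\<bar> = \<bar>a - b\<bar>" for a b
          using \<sigma> by (simp add: abs_mult flip: right_diff_distrib)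
        have "\<eta> \<le> gap / (2 * (C + L * C + 1))" using \<eta> by (simp add: \<eta>0_def)
        then have small: "(C + L * C + 1) * \<eta> \<le> gap / 2"
          using den by (simp add: field_simps)
        have "\<sigma> * x t \<le> \<sigma> * x s"
        proof (rule falls_aboveD[OF ap[OF xy(1)] st(2)])
          show "{s..t} \<subseteq> {0..T}" using st by auto
          fix r assume r: "r \<in> {s..t}"
          have "L * \<bar>y r - yb r\<bar> \<le> L * C * \<eta>"
            using mult_left_mono[OF xy(3)[of r] L] r st by (simp add: mult.assoc)
          then have "\<bar>F (y r) - F (yb r)\<bar> \<le> L * C * \<eta>"
            using lipschitz_on_abs[OF F, of "y r" "yb r"] by auto
          moreover have "\<bar>x r - xb r\<bar> \<le> C * \<eta>" using xy(2) r st \<eta>s by auto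
          moreover have "gap \<le> \<sigma> * xb r - \<sigma> * F (yb r)" using p(2)[OF r] by (simp add: gap_def)
          ultimately show "\<sigma> * F (y r) < \<sigma> * x r"
            using small gap \<eta>(1) sg[of "x r" "xb r"] sg[of "F (y r)" "F (yb r)"]
            by (simp add: distrib_right abs_le_iff) linarith
        qed
        then show ?thesis
          using xy(2)[of s] xy(2)[of t] st \<eta>s sg[of "x s" "xb s"] sg[of "x t" "xb t"]
          by (auto simp: abs_le_iff)
      qed
      then show ?thesis by (rule le_if_le_add_small[OF \<eta>0])
    qed
    fix s t :: real
    assume st: "s \<le> t" "{s..t} \<subseteq> {0..T}" and above: "\<forall>r\<in>{s..t}. \<sigma> * F (yb r) < \<sigma> * xb r"
    then have st': "0 \<le> s" "t \<le> T" by auto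
    show "\<sigma> * xb t \<le> \<sigma> * xb s"
    proof (cases "s = t")
      case False
      show ?thesis
      proof (rule le_left_end_by_continuity[of s t])
        show "continuous_on {s..t} (\<lambda>r. \<sigma> * xb r)"
          using cont st by (auto intro!: continuous_intros intro: continuous_on_subset)
        show "\<sigma> * xb t \<le> \<sigma> * xb r" if "s < r" "r \<le> t" for r
          by (rule pos) (use that st' above in auto)
      qed (use False st in auto)
    qed simp
  qed
  have deriv: "(yb has_real_derivative g (xb t, yb t, t)) (at t within {0..T})" if t: "t \<in> {0..T}" for t
  proof -
    define G where "G = (\<lambda>s. g (xb s, yb s, s))"
    have contG: "continuous_on {0..T} G"
      unfolding G_def using cont
      by (intro continuous_on_compose2[OF lipschitz_on_continuous_on[OF g_lip]] continuous_intros) auto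
    define Y where "Y = (\<lambda>t. y0 + integral {0..t} G)"
    have Y: "(Y has_real_derivative G t) (at t within {0..T})" if "t \<in> {0..T}" for t
      unfolding Y_def using integral_has_real_derivative[OF contG that] by (auto intro!: derivative_eq_intros)
    obtain B where B: "\<And>t. t \<in> {0..T} \<Longrightarrow> \<bar>G t\<bar> \<le> B" "0 \<le> B"
    proof -
      have "bounded (G ` {0..T})"
        using compact_continuous_image[OF contG compact_Icc] by (rule compact_imp_bounded)
      then obtain B where "0 < B" "\<forall>v\<in>G ` {0..T}. norm v \<le> B" unfolding bounded_pos by blast
      then show ?thesis using that[of B] by auto
    qed
    \<comment> \<open>the slow equation is compared with that of an approximate solution after the layer\<close>
    have eq: "yb t = Y t" if t: "t \<in> {0..T}" for t
    proof (cases "t = 0")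
      case True
      then show ?thesis using yb0 by (simp add: Y_def)
    next
      case False
      then have t0: "0 < t" using t by simp
      have "\<bar>yb t - Y t\<bar> \<le> 0 + (K + B + 2 * Lg * C * T + C) * \<eta>" if \<eta>: "0 < \<eta>" "\<eta> \<le> t" for \<eta>
      proof -
        have \<eta>T: "\<eta> \<le> T" using \<eta> t by simp
        obtain x y where xy: "approx_play \<eta> x y" "\<And>r. r \<in> {\<eta>..T} \<Longrightarrow> \<bar>x r - xb r\<bar> \<le> C * \<eta>"
            "\<And>r. r \<in> {0..T} \<Longrightarrow> \<bar>y r - yb r\<bar> \<le> C * \<eta>"
          using ex[of \<eta>] \<eta> t by auto
        note D = approx_playD[OF xy(1)]
        have "\<bar>(y t - Y t) - (y \<eta> - Y \<eta>)\<bar> \<le> Lg * (2 * C * \<eta>) * t - Lg * (2 * C * \<eta>) * \<eta>"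
        proof (rule increment_bound_deriv[where w' = "\<lambda>_. Lg * (2 * C * \<eta>)" and T = T])
          show "((\<lambda>s. y s - Y s) has_real_derivative g (x s, y s, s) - G s) (at s within {0..T})"
            if "s \<in> {0..T}" for s
            using D(2)[OF that] Y[OF that] by (rule DERIV_diff)
          show "((*) (Lg * (2 * C * \<eta>)) has_real_derivative Lg * (2 * C * \<eta>)) (at s within {0..T})" for s
            by (auto intro!: derivative_eq_intros)
          show "\<bar>g (x s, y s, s) - G s\<bar> \<le> Lg * (2 * C * \<eta>)" if "\<eta> < s" "s < t" for s
          proof -
            have "\<bar>x s - xb s\<bar> + \<bar>y s - yb s\<bar> \<le> 2 * C * \<eta>"
              using xy(2)[of s] xy(3)[of s] that t \<eta> by auto
            then show ?thesis
              unfolding G_def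
              using g_diff_le[of "x s" "y s" s "xb s" "yb s"] mult_left_mono[OF _ Lg] by (meson order_trans)
          qed
        qed (use t \<eta> in auto)
        moreover have "\<bar>y \<eta> - y 0\<bar> \<le> K * \<eta>"
          using lipschitz_on_abs[OF D(3), of \<eta> 0] \<eta> \<eta>T by auto
        moreover have "\<bar>Y \<eta> - Y 0\<bar> \<le> B * \<eta> - B * 0"
          by (rule increment_bound_deriv[where w' = "\<lambda>_. B" and T = T, OF Y])
             (use B \<eta> \<eta>T in \<open>auto intro!: derivative_eq_intros\<close>)
        moreover have "Y 0 = y0" by (simp add: Y_def)
        moreover have "Lg * (2 * C * \<eta>) * t \<le> 2 * Lg * C * T * \<eta>"
          using mult_left_mono[of t T "2 * Lg * C * \<eta>"] Lg C t \<eta> by (simp add: algebra_simps)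
        moreover have "0 \<le> Lg * (2 * C * \<eta>) * \<eta>" using Lg C \<eta> by simp
        ultimately show ?thesis using xy(3)[OF t] D(4) unfolding distrib_right by linarith
      qed
      then have "\<bar>yb t - Y t\<bar> \<le> 0" by (rule le_if_le_add_small[OF t0])
      then show ?thesis by simp
    qed
    show ?thesis
      using has_field_derivative_transform_within[OF Y[OF t], of 1 yb] t eq by (simp add: G_def)
  qed
  have "min (max (Fm y0) (xb 0)) (Fp y0) = xs" using xb0 xs by simp
  moreover have "falls_above {0..T} (\<lambda>t. Fm (yb t)) xb"
    using falls[OF Fm_lip, of 1] approx_playD(5) by simp
  moreover have "falls_above {0..T} (\<lambda>t. - Fp (yb t)) (\<lambda>t. - xb t)"
    using falls[OF Fp_lip, of "-1"] approx_playD(6) by simp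
  ultimately show "approx_play 0 xb yb"
    unfolding approx_play_def using cont deriv lip_y yb0 in_band by auto
qed

lemma approx_play_mono:
  assumes "approx_play \<eta> x y" "\<eta> \<le> \<eta>'"
  shows "approx_play \<eta>' x y"
proof -
  have "Fm (y t) - \<eta>' \<le> x t \<and> x t \<le> Fp (y t) + \<eta>'" if "t \<in> {\<eta>'..T}" for t
    using approx_playD(8)[OF assms(1), of t] assms(2) that by auto
  then show ?thesis using assms(1) unfolding approx_play_def by blast
qed

text \<open>By stability, a sequence of \<open>T/(n+1)\<close>-approximate solutions is Cauchy at every positive time, and
its limit attracts all approximate solutions at the rate \<open>stab\<close>.\<close>

theorem approx_play_converges:
  assumes ev: "\<And>\<eta>. 0 < \<eta> \<Longrightarrow> \<eta> \<le> T \<Longrightarrow> \<forall>\<^sub>F e in F. approx_play \<eta> (xe e) (ye e)"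
    and F: "F \<noteq> bot"
  shows "\<exists>xb yb. approx_play 0 xb yb \<and> (L * K)-lipschitz_on {0..T} xb \<and>
    (\<forall>\<eta> x y. 0 < \<eta> \<longrightarrow> \<eta> \<le> T \<longrightarrow> approx_play \<eta> x y \<longrightarrow>
       (\<forall>t\<in>{\<eta>..T}. \<bar>x t - xb t\<bar> \<le> stab * \<eta>) \<and> (\<forall>t\<in>{0..T}. \<bar>y t - yb t\<bar> \<le> stab * \<eta>))"
proof -
  have "\<exists>x y. approx_play (T / Suc n) x y" for n
  proof -
    have "0 < T / Suc n" "T / Suc n \<le> T" using T by (auto simp: field_simps)
    then show ?thesis using eventually_happens'[OF F ev] by blast
  qed
  then obtain X Y where XY: "\<And>n. approx_play (T / Suc n) (X n) (Y n)" by metis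
  have small: "\<forall>\<^sub>F n in sequentially. T / Suc n \<le> \<eta>" if "0 < \<eta>" for \<eta>
  proof -
    have "(\<lambda>n. T / Suc n) \<longlonglongrightarrow> 0" using LIMSEQ_Suc[OF lim_const_over_n[of T]] by simp
    from order_tendstoD(2)[OF this that] show ?thesis by eventually_elim simp
  qed
  have cauchy: "Cauchy u" if "0 < \<eta>0"
      and u: "\<And>\<eta> m n. 0 < \<eta> \<Longrightarrow> \<eta> \<le> \<eta>0 \<Longrightarrow> T / Suc m \<le> \<eta> \<Longrightarrow> T / Suc n \<le> \<eta> \<Longrightarrow> \<bar>u m - u n\<bar> \<le> stab * \<eta>"
    for u :: "nat \<Rightarrow> real" and \<eta>0
  proof (rule CauchyI')
    fix e :: real assume e: "0 < e"
    define \<eta> where "\<eta> = min \<eta>0 (e / (2 * (stab + 1)))"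
    have s1: "0 < stab + 1" using stab_nonneg by simp
    have \<eta>: "0 < \<eta>" "\<eta> \<le> \<eta>0" unfolding \<eta>_def using that(1) e s1 by auto
    have "\<eta> \<le> e / (2 * (stab + 1))" by (simp add: \<eta>_def)
    then have "(stab + 1) * \<eta> \<le> e / 2" using s1 by (simp add: field_simps)
    then have lt: "stab * \<eta> < e" using e \<eta> by (simp add: distrib_right)
    obtain N where "\<And>n. N \<le> n \<Longrightarrow> T / Suc n \<le> \<eta>"
      using small[OF \<eta>(1)] unfolding eventually_sequentially by blast
    then have "\<bar>u m - u n\<bar> < e" if "N \<le> m" "N \<le> n" for m n
      using u[OF \<eta>] that lt by (meson le_less_trans)
    then show "\<exists>M. \<forall>m\<ge>M. \<forall>n>m. dist (u m) (u n) < e"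
      by (auto simp: dist_real_def intro!: exI[of _ N])
  qed
  define xb where "xb t = (if t = 0 then xs else lim (\<lambda>n. X n t))" for t
  define yb where "yb t = lim (\<lambda>n. Y n t)" for t
  have lim_x: "(\<lambda>n. X n t) \<longlonglongrightarrow> xb t" if t: "0 < t" "t \<le> T" for t
  proof -
    have "Cauchy (\<lambda>n. X n t)"
      by (rule cauchy[OF t(1)])
         (rule approx_play_stability(2)[OF approx_play_mono[OF XY] approx_play_mono[OF XY]], use t in auto)
    then show ?thesis using t by (simp add: xb_def Cauchy_convergent_iff convergent_LIMSEQ_iff)
  qed
  have lim_y: "(\<lambda>n. Y n t) \<longlonglongrightarrow> yb t" if t: "t \<in> {0..T}" for t
  proof -
    have "Cauchy (\<lambda>n. Y n t)"
      by (rule cauchy[OF T])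
         (rule approx_play_stability(1)[OF approx_play_mono[OF XY] approx_play_mono[OF XY]], use t in auto)
    then show ?thesis by (simp add: yb_def Cauchy_convergent_iff convergent_LIMSEQ_iff)
  qed
  have close: "(\<forall>t\<in>{\<eta>..T}. \<bar>x t - xb t\<bar> \<le> stab * \<eta>) \<and> (\<forall>t\<in>{0..T}. \<bar>y t - yb t\<bar> \<le> stab * \<eta>)"
    if \<eta>: "0 < \<eta>" "\<eta> \<le> T" and ap: "approx_play \<eta> x y" for \<eta> x y
  proof (intro conjI ballI)
    fix t assume t: "t \<in> {\<eta>..T}"
    have "(\<lambda>n. \<bar>x t - X n t\<bar>) \<longlonglongrightarrow> \<bar>x t - xb t\<bar>"
      using lim_x[of t] t \<eta> by (intro tendsto_intros) auto
    moreover have "\<forall>\<^sub>F n in sequentially. \<bar>x t - X n t\<bar> \<le> stab * \<eta>"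
      using small[OF \<eta>(1)]
      by eventually_elim (rule approx_play_stability(2)[OF ap approx_play_mono[OF XY] \<eta> t])
    ultimately show "\<bar>x t - xb t\<bar> \<le> stab * \<eta>"
      by (rule tendsto_upperbound) simp
  next
    fix t assume t: "t \<in> {0..T}"
    have "(\<lambda>n. \<bar>y t - Y n t\<bar>) \<longlonglongrightarrow> \<bar>y t - yb t\<bar>"
      using lim_y[OF t] by (intro tendsto_intros)
    moreover have "\<forall>\<^sub>F n in sequentially. \<bar>y t - Y n t\<bar> \<le> stab * \<eta>"
      using small[OF \<eta>(1)]
      by eventually_elim (rule approx_play_stability(1)[OF ap approx_play_mono[OF XY] \<eta> t])
    ultimately show "\<bar>y t - yb t\<bar> \<le> stab * \<eta>"
      by (rule tendsto_upperbound) simp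
  qed
  have "\<exists>x y. approx_play \<eta> x y \<and> (\<forall>t\<in>{\<eta>..T}. \<bar>x t - xb t\<bar> \<le> stab * \<eta>) \<and>
      (\<forall>t\<in>{0..T}. \<bar>y t - yb t\<bar> \<le> stab * \<eta>)" if \<eta>: "0 < \<eta>" "\<eta> \<le> T" for \<eta>
    using eventually_happens'[OF F ev[OF \<eta>]] close[OF \<eta>] by blast
  then have "approx_play 0 xb yb" "(L * K)-lipschitz_on {0..T} xb"
    using approx_play_limit[of xb stab yb] stab_nonneg by (auto simp: xb_def)
  then show ?thesis using close by blast
qed

end

section \<open>Bounded densities of Lipschitz functions\<close>

text \<open>An identity \<open>M1 + M2 = M3\<close> on half-open intervals extends to Borel sets by Dynkin's argument.
It is phrased as an identity because inequalities are not stable under complements.\<close>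

lemma emeasure_add_from_intervals:
  fixes M1 M2 M3 :: "real measure"
  assumes sets: "sets M1 = sets borel" "sets M2 = sets borel" "sets M3 = sets borel"
    and Ioc: "\<And>s t. a \<le> s \<Longrightarrow> s \<le> t \<Longrightarrow> t \<le> b \<Longrightarrow>
      emeasure M1 {s<..t} + emeasure M2 {s<..t} = emeasure M3 {s<..t}"
    and fin: "emeasure M3 {a<..b} < \<infinity>"
    and B: "B \<in> sets borel"
  shows "emeasure M1 (B \<inter> {a<..b}) + emeasure M2 (B \<inter> {a<..b}) = emeasure M3 (B \<inter> {a<..b})"
proof -
  let ?J = "{a<..b}" and ?G = "range (\<lambda>(a, b). {a<..b::real})"
  have sigma: "sigma_sets UNIV ?G = sets borel"
    by (subst borel_sigma_sets_Ioc) simp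
  have meas: "A \<inter> ?J \<in> sets M1" "A \<inter> ?J \<in> sets M2" "A \<inter> ?J \<in> sets M3" if "A \<in> sets borel" for A
    using that sets by auto
  have "B \<in> sigma_sets UNIV ?G" using B sigma by simp
  have "Int_stable ?G"
    by (auto simp: Int_stable_def intro!: image_eqI[where x = "(max _ _, min _ _)"])
  from this subset_UNIV[of ?G, folded Pow_UNIV] \<open>B \<in> sigma_sets UNIV ?G\<close> show ?thesis
  proof (induction rule: sigma_sets_induct_disjoint)
    case (basic A)
    then obtain c d where A: "A = {c<..d}" by auto
    have "A \<inter> ?J = {max a c<..min b d}" unfolding A by auto
    then show ?case
      using Ioc[of "max a c" "min b d"] by (cases "max a c \<le> min b d") auto
  next
    case (compl A)
    have A: "A \<in> sets borel" using compl(1) sigma by simp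
    have J: "?J = (A \<inter> ?J) \<union> ((UNIV - A) \<inter> ?J)" by auto
    have split: "emeasure M ?J = emeasure M (A \<inter> ?J) + emeasure M ((UNIV - A) \<inter> ?J)"
      if "sets M = sets borel" for M
      by (subst J, rule plus_emeasure[symmetric]) (use A that in auto)
    have whole: "emeasure M1 ?J + emeasure M2 ?J = emeasure M3 ?J"
      using Ioc[of a b] by (cases "a \<le> b") auto
    have "emeasure M3 (A \<inter> ?J) \<le> emeasure M3 ?J"
      using sets by (intro emeasure_mono) auto
    then have fin_A: "emeasure M3 (A \<inter> ?J) \<noteq> top" using fin by (auto simp: top_unique)
    have "emeasure M3 (A \<inter> ?J) + (emeasure M1 ((UNIV - A) \<inter> ?J) + emeasure M2 ((UNIV - A) \<inter> ?J)) =
        (emeasure M1 (A \<inter> ?J) + emeasure M1 ((UNIV - A) \<inter> ?J)) +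
        (emeasure M2 (A \<inter> ?J) + emeasure M2 ((UNIV - A) \<inter> ?J))"
      unfolding compl(2)[symmetric] by (simp add: ac_simps)
    also have "\<dots> = emeasure M3 (A \<inter> ?J) + emeasure M3 ((UNIV - A) \<inter> ?J)"
      using whole by (simp only: split[OF sets(1)] split[OF sets(2)] split[OF sets(3)])
    finally show ?case using fin_A by (simp add: ennreal_add_left_cancel)
  next
    case (union A)
    have disj: "disjoint_family (\<lambda>i. A i \<inter> ?J)"
      using union(1) by (auto simp: disjoint_family_on_def)
    have A: "A i \<in> sets borel" for i using union(2) sigma by auto
    have sum: "emeasure M ((\<Union>i. A i) \<inter> ?J) = (\<Sum>i. emeasure M (A i \<inter> ?J))"
      if "sets M = sets borel" for M
    proof -
      have "(\<Sum>i. emeasure M (A i \<inter> ?J)) = emeasure M (\<Union>i. A i \<inter> ?J)"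
        by (rule suminf_emeasure) (use A that disj in auto)
      then show ?thesis by (simp add: Int_UN_distrib2)
    qed
    show ?case
      unfolding sum[OF sets(1)] sum[OF sets(2)] sum[OF sets(3)] union(3)[symmetric]
      by (rule suminf_add) auto
  qed simp
qed

text \<open>The inequality holds because the Stieltjes measure of \<open>\<kappa> t - F t\<close>, frozen outside \<open>[a, b]\<close>,
is the missing summand.\<close>

lemma interval_measure_le_lborel:
  fixes F :: "real \<Rightarrow> real"
  assumes mono: "\<And>s t. s \<le> t \<Longrightarrow> F s \<le> F t" and cont: "continuous_on UNIV F"
    and ab: "a \<le> b" and \<kappa>: "0 \<le> \<kappa>" and B: "B \<in> sets borel"
    and slope: "\<And>s t. a \<le> s \<Longrightarrow> s \<le> t \<Longrightarrow> t \<le> b \<Longrightarrow> F t - F s \<le> \<kappa> * (t - s)"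
  shows "emeasure (interval_measure F) (B \<inter> {a<..b}) \<le> ennreal \<kappa> * emeasure lborel (B \<inter> {a<..b})"
proof -
  define c where "c t = max a (min t b)" for t :: real
  define R where "R t = \<kappa> * c t - F (c t)" for t
  have c: "a \<le> c s" "c s \<le> c t" "c t \<le> b" if "s \<le> t" for s t
    using that ab by (auto simp: c_def)
  have cid: "c t = t" if "a \<le> t" "t \<le> b" for t using that by (simp add: c_def)
  have R: "R s \<le> R t" if "s \<le> t" for s t
    using slope[OF c[OF that]] by (simp add: R_def algebra_simps)
  have contc: "continuous_on UNIV c" unfolding c_def by (intro continuous_intros)
  have contR: "continuous_on UNIV R"
    unfolding R_def by (intro continuous_intros continuous_on_compose2[OF cont] contc) auto
  have rc: "continuous (at_right t) F" "continuous (at_right t) R" for t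
    using cont contR by (auto simp: continuous_on_eq_continuous_within intro: continuous_within_subset)
  have "emeasure (interval_measure F) (B \<inter> {a<..b}) + emeasure (interval_measure R) (B \<inter> {a<..b})
      = emeasure (scale_measure (ennreal \<kappa>) lborel) (B \<inter> {a<..b})"
  proof (rule emeasure_add_from_intervals[OF _ _ _ _ _ B])
    show "emeasure (interval_measure F) {s<..t} + emeasure (interval_measure R) {s<..t}
        = emeasure (scale_measure (ennreal \<kappa>) lborel) {s<..t}"
      if "a \<le> s" "s \<le> t" "t \<le> b" for s t
    proof -
      have "ennreal (F t - F s) + ennreal (R t - R s) = ennreal ((F t - F s) + (R t - R s))"
        using mono R that(2) by (intro ennreal_plus[symmetric]) auto
      also have "(F t - F s) + (R t - R s) = \<kappa> * (t - s)"
        using that by (simp add: R_def cid algebra_simps)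
      finally show ?thesis
        using that \<kappa> by (simp add: emeasure_interval_measure_Ioc[OF _ mono rc(1)]
          emeasure_interval_measure_Ioc[OF _ R rc(2)] ennreal_mult)
    qed
    show "emeasure (scale_measure (ennreal \<kappa>) lborel) {a<..b} < \<infinity>"
      using ab by (simp add: ennreal_mult_less_top)
  qed auto
  then show ?thesis unfolding emeasure_scale_measure by (metis le_iff_add)
qed

lemma lborel_le_interval_measure:
  fixes F :: "real \<Rightarrow> real"
  assumes mono: "\<And>s t. s \<le> t \<Longrightarrow> F s \<le> F t" and cont: "continuous_on UNIV F"
    and ab: "a \<le> b" and \<kappa>: "0 \<le> \<kappa>" and B: "B \<in> sets borel"
    and slope: "\<And>s t. a \<le> s \<Longrightarrow> s \<le> t \<Longrightarrow> t \<le> b \<Longrightarrow> \<kappa> * (t - s) \<le> F t - F s"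
  shows "ennreal \<kappa> * emeasure lborel (B \<inter> {a<..b}) \<le> emeasure (interval_measure F) (B \<inter> {a<..b})"
proof -
  define c where "c t = max a (min t b)" for t :: real
  define R where "R t = F (c t) - \<kappa> * c t" for t
  have c: "a \<le> c s" "c s \<le> c t" "c t \<le> b" if "s \<le> t" for s t
    using that ab by (auto simp: c_def)
  have cid: "c t = t" if "a \<le> t" "t \<le> b" for t using that by (simp add: c_def)
  have R: "R s \<le> R t" if "s \<le> t" for s t
    using slope[OF c[OF that]] by (simp add: R_def algebra_simps)
  have contc: "continuous_on UNIV c" unfolding c_def by (intro continuous_intros)
  have contR: "continuous_on UNIV R"
    unfolding R_def by (intro continuous_intros continuous_on_compose2[OF cont] contc) auto
  have rc: "continuous (at_right t) F" "continuous (at_right t) R" for t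
    using cont contR by (auto simp: continuous_on_eq_continuous_within intro: continuous_within_subset)
  have "emeasure (scale_measure (ennreal \<kappa>) lborel) (B \<inter> {a<..b}) + emeasure (interval_measure R) (B \<inter> {a<..b})
      = emeasure (interval_measure F) (B \<inter> {a<..b})"
  proof (rule emeasure_add_from_intervals[OF _ _ _ _ _ B])
    show "emeasure (scale_measure (ennreal \<kappa>) lborel) {s<..t} + emeasure (interval_measure R) {s<..t}
        = emeasure (interval_measure F) {s<..t}"
      if "a \<le> s" "s \<le> t" "t \<le> b" for s t
    proof -
      have "ennreal (\<kappa> * (t - s)) + ennreal (R t - R s) = ennreal (\<kappa> * (t - s) + (R t - R s))"
        using R \<kappa> that(2) by (intro ennreal_plus[symmetric]) auto
      also have "\<kappa> * (t - s) + (R t - R s) = F t - F s"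
        using that by (simp add: R_def cid algebra_simps)
      finally show ?thesis
        using that \<kappa> by (simp add: emeasure_interval_measure_Ioc[OF _ mono rc(1)]
          emeasure_interval_measure_Ioc[OF _ R rc(2)] ennreal_mult)
    qed
    show "emeasure (interval_measure F) {a<..b} < \<infinity>"
      using ab mono by (simp add: emeasure_interval_measure_Ioc[OF _ mono rc(1)])
  qed auto
  then show ?thesis unfolding emeasure_scale_measure by (metis le_iff_add)
qed

text \<open>On the set where \<open>f > \<kappa>\<close> the integral of \<open>f - \<kappa>\<close> would be positive unless the set is null.\<close>

lemma AE_le_from_measure_le:
  assumes f: "f \<in> borel_measurable M" and J: "J \<in> sets M" "emeasure M J < \<infinity>" and \<kappa>: "0 \<le> \<kappa>"
    and le: "\<And>B. B \<in> sets M \<Longrightarrow> B \<subseteq> J \<Longrightarrow> emeasure (density M f) B \<le> ennreal \<kappa> * emeasure M B"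
  shows "AE r in M. r \<in> J \<longrightarrow> f r \<le> ennreal \<kappa>"
proof -
  define B where "B = {r \<in> space M. r \<in> J \<and> ennreal \<kappa> < f r}"
  have B: "B \<in> sets M" "B \<subseteq> J" unfolding B_def using f J by auto
  have "emeasure M B \<le> emeasure M J" using B J by (intro emeasure_mono)
  then have fin: "(\<integral>\<^sup>+ r. ennreal \<kappa> * indicator B r \<partial>M) \<noteq> \<infinity>"
    using B J by (auto simp: nn_integral_cmult_indicator ennreal_mult_eq_top_iff top_unique)
  have "(\<integral>\<^sup>+ r. f r * indicator B r - ennreal \<kappa> * indicator B r \<partial>M) =
      (\<integral>\<^sup>+ r. f r * indicator B r \<partial>M) - (\<integral>\<^sup>+ r. ennreal \<kappa> * indicator B r \<partial>M)"
    by (rule nn_integral_diff) (use f B fin in \<open>auto simp: B_def split: split_indicator\<close>)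
  also have "\<dots> = 0"
  proof (rule diff_eq_0_ennreal)
    show "(\<integral>\<^sup>+ r. f r * indicator B r \<partial>M) \<le> (\<integral>\<^sup>+ r. ennreal \<kappa> * indicator B r \<partial>M)"
      using le[OF B] f B by (simp add: emeasure_density nn_integral_cmult_indicator)
    then show "(\<integral>\<^sup>+ r. f r * indicator B r \<partial>M) < top"
      using fin by (auto simp: less_top top_unique)
  qed
  finally have "AE r in M. f r * indicator B r - ennreal \<kappa> * indicator B r = 0"
    using f B by (subst (asm) nn_integral_0_iff_AE) auto
  then show ?thesis
  proof (rule AE_mp, intro AE_I2 impI)
    fix r assume r: "r \<in> space M" "f r * indicator B r - ennreal \<kappa> * indicator B r = 0" "r \<in> J"
    show "f r \<le> ennreal \<kappa>"
    proof (rule ccontr)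
      assume "\<not> ?thesis"
      then have "ennreal \<kappa> < f r" "r \<in> B" using r by (auto simp: B_def)
      then show False using r(2) by (auto simp: diff_eq_0_iff_ennreal)
    qed
  qed
qed

lemma AE_ge_from_measure_ge:
  assumes f: "f \<in> borel_measurable M" and J: "J \<in> sets M" "emeasure M J < \<infinity>" and \<kappa>: "0 \<le> \<kappa>"
    and le: "\<And>B. B \<in> sets M \<Longrightarrow> B \<subseteq> J \<Longrightarrow> ennreal \<kappa> * emeasure M B \<le> emeasure (density M f) B"
  shows "AE r in M. r \<in> J \<longrightarrow> ennreal \<kappa> \<le> f r"
proof -
  define B where "B = {r \<in> space M. r \<in> J \<and> f r < ennreal \<kappa>}"
  have B: "B \<in> sets M" "B \<subseteq> J" unfolding B_def using f J by auto
  have "emeasure M B \<le> emeasure M J" using B J by (intro emeasure_mono)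
  then have "emeasure M B < \<infinity>" using J(2) by (rule le_less_trans)
  then have "(\<integral>\<^sup>+ r. ennreal \<kappa> * indicator B r \<partial>M) < \<infinity>"
    using B by (simp add: nn_integral_cmult_indicator ennreal_mult_less_top)
  moreover have "(\<integral>\<^sup>+ r. f r * indicator B r \<partial>M) \<le> (\<integral>\<^sup>+ r. ennreal \<kappa> * indicator B r \<partial>M)"
    by (rule nn_integral_mono) (auto simp: B_def split: split_indicator)
  ultimately have fin: "(\<integral>\<^sup>+ r. f r * indicator B r \<partial>M) \<noteq> \<infinity>" by (auto simp: top_unique)
  have "(\<integral>\<^sup>+ r. ennreal \<kappa> * indicator B r - f r * indicator B r \<partial>M) =
      (\<integral>\<^sup>+ r. ennreal \<kappa> * indicator B r \<partial>M) - (\<integral>\<^sup>+ r. f r * indicator B r \<partial>M)"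
    by (rule nn_integral_diff) (use f B fin in \<open>auto simp: B_def split: split_indicator\<close>)
  also have "\<dots> = 0"
  proof (rule diff_eq_0_ennreal)
    show "(\<integral>\<^sup>+ r. ennreal \<kappa> * indicator B r \<partial>M) \<le> (\<integral>\<^sup>+ r. f r * indicator B r \<partial>M)"
      using le[OF B] f B by (simp add: emeasure_density nn_integral_cmult_indicator)
    show "(\<integral>\<^sup>+ r. ennreal \<kappa> * indicator B r \<partial>M) < top"
      using \<open>emeasure M B < \<infinity>\<close> B by (simp add: nn_integral_cmult_indicator ennreal_mult_less_top)
  qed
  finally have "AE r in M. ennreal \<kappa> * indicator B r - f r * indicator B r = 0"
    using f B by (subst (asm) nn_integral_0_iff_AE) auto
  then show ?thesis
  proof (rule AE_mp, intro AE_I2 impI)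
    fix r assume r: "r \<in> space M" "ennreal \<kappa> * indicator B r - f r * indicator B r = 0" "r \<in> J"
    show "ennreal \<kappa> \<le> f r"
    proof (rule ccontr)
      assume "\<not> ?thesis"
      then have "f r < ennreal \<kappa>" "r \<in> B" using r by (auto simp: B_def)
      then show False using r(2) by (auto simp: diff_eq_0_iff_ennreal)
    qed
  qed
qed

text \<open>The Stieltjes measure of the nondecreasing function \<open>x + \<Lambda> t\<close> is at most \<open>2 \<Lambda>\<close> times
Lebesgue measure, hence has a density by Radon-Nikodym; subtracting \<open>\<Lambda>\<close> gives \<open>v\<close>. Where \<open>x\<close> is
monotone on an interval, the slope of \<open>x + \<Lambda> t\<close> lies on one side of \<open>\<Lambda>\<close> there, and the
comparison with Lebesgue measure gives the sign of \<open>v\<close> almost everywhere.\<close>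

theorem lipschitz_density:
  fixes x :: "real \<Rightarrow> real"
  assumes lip: "\<Lambda>-lipschitz_on {0..T} x" and T: "0 < T"
  obtains v where "v \<in> borel_measurable borel" "\<And>t. \<bar>v t\<bar> \<le> \<Lambda>"
    "\<And>t. t \<in> {0..T} \<Longrightarrow> x t = x 0 + (LINT r:{0<..t}|lborel. v r)"
    "\<And>a b. 0 \<le> a \<Longrightarrow> a \<le> b \<Longrightarrow> b \<le> T \<Longrightarrow> (\<And>s t. a \<le> s \<Longrightarrow> s \<le> t \<Longrightarrow> t \<le> b \<Longrightarrow> x t \<le> x s) \<Longrightarrow>
      AE r in lborel. r \<in> {a<..b} \<longrightarrow> v r \<le> 0"
    "\<And>a b. 0 \<le> a \<Longrightarrow> a \<le> b \<Longrightarrow> b \<le> T \<Longrightarrow> (\<And>s t. a \<le> s \<Longrightarrow> s \<le> t \<Longrightarrow> t \<le> b \<Longrightarrow> x s \<le> x t) \<Longrightarrow>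
      AE r in lborel. r \<in> {a<..b} \<longrightarrow> 0 \<le> v r"
proof -
  have \<Lambda>: "0 \<le> \<Lambda>" using lip by (rule lipschitz_on_nonneg)
  \<comment> \<open>outside \<open>[0, T]\<close> the function \<open>x\<close> is continued by constants\<close>
  define c where "c t = max 0 (min t T)" for t :: real
  define H where "H t = x (c t) + \<Lambda> * t" for t
  have cin: "c t \<in> {0..T}" for t using T by (auto simp: c_def)
  have cid: "c t = t" if "0 \<le> t" "t \<le> T" for t using that by (simp add: c_def)
  have steps: "\<bar>x (c t) - x (c s)\<bar> \<le> \<Lambda> * (t - s)" if "s \<le> t" for s t
  proof -
    have "\<bar>x (c t) - x (c s)\<bar> \<le> \<Lambda> * \<bar>c t - c s\<bar>"
      using lipschitz_onD[OF lip cin cin, of t s] by (simp add: dist_real_def)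
    also have "\<dots> \<le> \<Lambda> * (t - s)" using that \<Lambda> by (intro mult_left_mono) (auto simp: c_def)
    finally show ?thesis .
  qed
  have H: "H s \<le> H t" "H t - H s \<le> 2 * \<Lambda> * (t - s)" if "s \<le> t" for s t
    using steps[OF that] by (auto simp: H_def abs_le_iff algebra_simps)
  have contH: "continuous_on UNIV H"
    unfolding H_def
    by (intro continuous_intros continuous_on_compose2[OF lipschitz_on_continuous_on[OF lip]])
      (use cin in \<open>auto simp: c_def intro!: continuous_intros\<close>)
  have rc: "continuous (at_right t) H" for t
    using contH by (auto simp: continuous_on_eq_continuous_within intro: continuous_within_subset)
  let ?\<mu> = "interval_measure H"
  have "absolutely_continuous lborel ?\<mu>"
    unfolding absolutely_continuous_def
  proof
    fix N :: "real set" assume N: "N \<in> null_sets lborel"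
    then have NB: "N \<in> sets borel" by auto
    have "N \<inter> {- real n<..real n} \<in> null_sets ?\<mu>" for n
    proof -
      have "emeasure lborel (N \<inter> {- real n<..real n}) = 0"
        using null_set_Int2[OF N, of "{- real n<..real n}"] by auto
      then have "emeasure ?\<mu> (N \<inter> {- real n<..real n}) \<le> 0"
        using interval_measure_le_lborel[OF H(1) contH, of "- real n" "real n" "2 * \<Lambda>" N] H(2) NB \<Lambda> by simp
      then show ?thesis using NB by (auto simp: null_sets_def)
    qed
    then have "(\<Union>n. N \<inter> {- real n<..real n}) \<in> null_sets ?\<mu>" by (rule null_sets_UN)
    also have "(\<Union>n. N \<inter> {- real n<..real n}) = N"
    proof safe
      fix r assume "r \<in> N"
      obtain n where "\<bar>r\<bar> < real n" using reals_Archimedean2 by blast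
      then show "r \<in> (\<Union>n. N \<inter> {- real n<..real n})" using \<open>r \<in> N\<close> by (auto intro!: exI[of _ n])
    qed
    finally show "N \<in> null_sets ?\<mu>" .
  qed
  then obtain f where f: "f \<in> borel_measurable lborel" "density lborel f = ?\<mu>"
    using sigma_finite_measure.Radon_Nikodym[OF sigma_finite_lborel, of ?\<mu>] by auto
  have upper: "AE r in lborel. r \<in> {a<..b} \<longrightarrow> f r \<le> ennreal \<kappa>"
    if "a \<le> b" "0 \<le> \<kappa>" "\<And>s t. a \<le> s \<Longrightarrow> s \<le> t \<Longrightarrow> t \<le> b \<Longrightarrow> H t - H s \<le> \<kappa> * (t - s)" for a b \<kappa>
  proof (rule AE_le_from_measure_le[OF f(1) _ _ that(2)])
    fix B :: "real set" assume "B \<in> sets lborel" "B \<subseteq> {a<..b}"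
    then show "emeasure (density lborel f) B \<le> ennreal \<kappa> * emeasure lborel B"
      using interval_measure_le_lborel[OF H(1) contH that(1,2), of B] that(3) by (simp add: f(2) Int_absorb2)
  qed (use that(1) in auto)
  have lower: "AE r in lborel. r \<in> {a<..b} \<longrightarrow> ennreal \<kappa> \<le> f r"
    if "a \<le> b" "0 \<le> \<kappa>" "\<And>s t. a \<le> s \<Longrightarrow> s \<le> t \<Longrightarrow> t \<le> b \<Longrightarrow> \<kappa> * (t - s) \<le> H t - H s" for a b \<kappa>
  proof (rule AE_ge_from_measure_ge[OF f(1) _ _ that(2)])
    fix B :: "real set" assume "B \<in> sets lborel" "B \<subseteq> {a<..b}"
    then show "ennreal \<kappa> * emeasure lborel B \<le> emeasure (density lborel f) B"
      using lborel_le_interval_measure[OF H(1) contH that(1,2), of B] that(3) by (simp add: f(2) Int_absorb2)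
  qed (use that(1) in auto)
  \<comment> \<open>the truncation changes \<open>v\<close> on a null set of \<open>(0, T]\<close> only and makes the bound hold everywhere\<close>
  define v where "v r = max (- \<Lambda>) (min \<Lambda> (enn2real (f r) - \<Lambda>))" for r
  have v: "v \<in> borel_measurable borel" unfolding v_def using f(1) by simp
  have v_bound: "\<bar>v t\<bar> \<le> \<Lambda>" for t
    unfolding v_def using \<Lambda> enn2real_nonneg[of "f t"] by (auto simp: abs_le_iff min_def max_def)
  have v0: "0 \<le> v t + \<Lambda>" for t using v_bound[of t] by (simp add: abs_le_iff)
  have "AE r in lborel. r \<in> {0<..T} \<longrightarrow> f r \<le> ennreal (2 * \<Lambda>)"
    by (rule upper) (use T \<Lambda> H(2) in auto)
  then have fv: "AE r in lborel. r \<in> {0<..T} \<longrightarrow> f r = ennreal (v r + \<Lambda>)"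
  proof (eventually_elim, intro impI)
    fix r assume "r \<in> {0<..T} \<longrightarrow> f r \<le> ennreal (2 * \<Lambda>)" "r \<in> {0<..T}"
    then have "f r \<le> ennreal (2 * \<Lambda>)" by auto
    then have "f r \<noteq> top" "enn2real (f r) \<le> 2 * \<Lambda>"
      using \<Lambda> by (auto simp: top_unique intro: enn2real_leI)
    moreover have "v r + \<Lambda> = enn2real (f r)"
      using calculation enn2real_nonneg[of "f r"] unfolding v_def by linarith
    ultimately show "f r = ennreal (v r + \<Lambda>)" by (simp add: less_top)
  qed
  show ?thesis
  proof (rule that[OF v v_bound])
    fix t assume t: "t \<in> {0..T}"
    have int: "set_integrable lborel {0<..t} v"
      unfolding set_integrable_def
      by (rule integrableI_bounded_set[where A = "{0<..t}" and B = \<Lambda>])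
        (use v v_bound t in \<open>auto simp: indicator_def\<close>)
    have int1: "set_integrable lborel {0<..t} (\<lambda>_. \<Lambda>)"
      using t by (auto simp: set_integrable_def)
    have "ennreal (H t - H 0) = emeasure ?\<mu> {0<..t}"
      using t by (subst emeasure_interval_measure_Ioc[OF _ H(1) rc]) auto
    also have "\<dots> = (\<integral>\<^sup>+ r. f r * indicator {0<..t} r \<partial>lborel)"
      unfolding f(2)[symmetric] using f(1) by (simp add: emeasure_density)
    also have "\<dots> = (\<integral>\<^sup>+ r. ennreal (indicator {0<..t} r *\<^sub>R (v r + \<Lambda>)) \<partial>lborel)"
    proof (rule nn_integral_cong_AE)
      show "AE r in lborel. f r * indicator {0<..t} r = ennreal (indicator {0<..t} r *\<^sub>R (v r + \<Lambda>))"
        using fv by eventually_elim (use t in \<open>auto simp: indicator_def\<close>)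
    qed
    also have "\<dots> = ennreal (LINT r:{0<..t}|lborel. v r + \<Lambda>)"
      unfolding set_lebesgue_integral_def
    proof (rule nn_integral_eq_integral)
      show "integrable lborel (\<lambda>r. indicator {0<..t} r *\<^sub>R (v r + \<Lambda>))"
        using set_integral_add(1)[OF int int1] by (simp add: set_integrable_def)
      show "AE r in lborel. 0 \<le> indicator {0<..t} r *\<^sub>R (v r + \<Lambda>)"
        using v0 by (auto simp: indicator_def)
    qed
    finally have "ennreal (H t - H 0) = ennreal (LINT r:{0<..t}|lborel. v r + \<Lambda>)" .
    moreover have "0 \<le> H t - H 0" using H(1)[of 0 t] t by simp
    moreover have "0 \<le> (LINT r:{0<..t}|lborel. v r + \<Lambda>)"
      unfolding set_lebesgue_integral_def
      by (rule Bochner_Integration.integral_nonneg) (use v0 in \<open>auto simp: indicator_def\<close>)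
    ultimately have "H t - H 0 = (LINT r:{0<..t}|lborel. v r + \<Lambda>)" by simp
    also have "\<dots> = (LINT r:{0<..t}|lborel. v r) + \<Lambda> * t"
      using set_integral_add(2)[OF int int1] t by (simp add: set_lebesgue_integral_def)
    finally show "x t = x 0 + (LINT r:{0<..t}|lborel. v r)"
      using t T by (simp add: H_def cid)
  next
    fix a b assume ab: "0 \<le> a" "a \<le> b" "b \<le> T" and mono: "\<And>s t. a \<le> s \<Longrightarrow> s \<le> t \<Longrightarrow> t \<le> b \<Longrightarrow> x t \<le> x s"
    have "AE r in lborel. r \<in> {a<..b} \<longrightarrow> f r \<le> ennreal \<Lambda>"
      by (rule upper[OF ab(2) \<Lambda>]) (use ab mono in \<open>auto simp: H_def cid algebra_simps\<close>)
    then show "AE r in lborel. r \<in> {a<..b} \<longrightarrow> v r \<le> 0"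
    proof (eventually_elim, intro impI)
      fix r assume "r \<in> {a<..b} \<longrightarrow> f r \<le> ennreal \<Lambda>" "r \<in> {a<..b}"
      then have "enn2real (f r) \<le> \<Lambda>" using \<Lambda> by (auto intro: enn2real_leI)
      then show "v r \<le> 0" using \<Lambda> by (simp add: v_def)
    qed
  next
    fix a b assume ab: "0 \<le> a" "a \<le> b" "b \<le> T" and mono: "\<And>s t. a \<le> s \<Longrightarrow> s \<le> t \<Longrightarrow> t \<le> b \<Longrightarrow> x s \<le> x t"
    have "AE r in lborel. r \<in> {a<..b} \<longrightarrow> ennreal \<Lambda> \<le> f r"
      by (rule lower[OF ab(2) \<Lambda>]) (use ab mono in \<open>auto simp: H_def cid algebra_simps\<close>)
    with fv show "AE r in lborel. r \<in> {a<..b} \<longrightarrow> 0 \<le> v r"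
    proof (eventually_elim, intro impI)
      fix r assume "r \<in> {0<..T} \<longrightarrow> f r = ennreal (v r + \<Lambda>)"
        "r \<in> {a<..b} \<longrightarrow> ennreal \<Lambda> \<le> f r" "r \<in> {a<..b}"
      then have "ennreal \<Lambda> \<le> ennreal (v r + \<Lambda>)" using ab by auto
      then have "\<Lambda> \<le> v r + \<Lambda>"
        using \<Lambda> v_bound[of r] by (subst (asm) ennreal_le_iff) (auto simp: abs_le_iff)
      then show "0 \<le> v r" by simp
    qed
  qed
qed

text \<open>Around every point with \<open>h < x\<close> there is an interval with rational end points on which \<open>x\<close> is
nonincreasing; countably many intervals only produce a null set of exceptions.\<close>

lemma falls_above_density_nonpos:
  assumes fall: "falls_above {0..T} h x"
    and cont: "continuous_on {0..T} x" "continuous_on {0..T} h"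
    and density: "\<And>a b. 0 \<le> a \<Longrightarrow> a \<le> b \<Longrightarrow> b \<le> T \<Longrightarrow>
      (\<And>s t. a \<le> s \<Longrightarrow> s \<le> t \<Longrightarrow> t \<le> b \<Longrightarrow> x t \<le> x s) \<Longrightarrow> AE r in lborel. r \<in> {a<..b} \<longrightarrow> v r \<le> (0::real)"
  shows "AE r in lborel. r \<in> {0<..<T} \<longrightarrow> h r < x r \<longrightarrow> v r \<le> 0"
proof -
  define good where "good = (\<lambda>p. 0 \<le> fst p \<and> fst p \<le> snd p \<and> snd p \<le> T \<and> (\<forall>r\<in>{fst p..snd p}. h r < x r))"
  have "\<forall>p\<in>\<rat> \<times> \<rat>. AE r in lborel. good p \<longrightarrow> r \<in> {fst p<..snd p} \<longrightarrow> v r \<le> 0"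
  proof
    fix p :: "real \<times> real"
    show "AE r in lborel. good p \<longrightarrow> r \<in> {fst p<..snd p} \<longrightarrow> v r \<le> 0"
    proof (cases "good p")
      case True
      then have "AE r in lborel. r \<in> {fst p<..snd p} \<longrightarrow> v r \<le> 0"
        unfolding good_def by (intro density falls_aboveD[OF fall]) auto
      then show ?thesis by simp
    qed simp
  qed
  then have "AE r in lborel. \<forall>p\<in>\<rat> \<times> \<rat>. good p \<longrightarrow> r \<in> {fst p<..snd p} \<longrightarrow> v r \<le> 0"
    by (subst AE_ball_countable) (auto simp: countable_rat)
  then show ?thesis
  proof (eventually_elim, intro impI)
    fix r assume *: "\<forall>p\<in>\<rat> \<times> \<rat>. good p \<longrightarrow> r \<in> {fst p<..snd p} \<longrightarrow> v r \<le> 0"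
      and r: "r \<in> {0<..<T}" "h r < x r"
    have "continuous_on {0<..<T} (\<lambda>t. x t - h t)"
      using cont by (auto intro!: continuous_intros intro: continuous_on_subset)
    then have "open ({0<..<T} \<inter> (\<lambda>t. x t - h t) -` {0<..})"
      by (rule continuous_open_preimage[OF _ open_greaterThanLessThan open_greaterThan])
    moreover have "r \<in> {0<..<T} \<inter> (\<lambda>t. x t - h t) -` {0<..}" using r by simp
    ultimately obtain d where d: "0 < d" "ball r d \<subseteq> {0<..<T} \<inter> (\<lambda>t. x t - h t) -` {0<..}"
      by (meson open_contains_ball)
    obtain a b where ab: "a \<in> \<rat>" "r - d < a" "a < r" "b \<in> \<rat>" "r < b" "b < r + d"
      using Rats_dense_in_real[of "r - d" r] Rats_dense_in_real[of r "r + d"] d(1) by auto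
    have "t \<in> ball r d" if "t \<in> {a..b}" for t using that ab by (auto simp: dist_real_def abs_less_iff)
    then have inside: "0 < x t - h t" "t \<in> {0<..<T}" if "t \<in> {a..b}" for t using d(2) that by fastforce+
    have "good (a, b)"
      unfolding good_def using inside[of a] inside[of b] inside(1) ab(3,5) by simp
    then show "v r \<le> 0" using * ab by fastforce
  qed
qed

section \<open>Weak derivatives on an interval\<close>

lemma integral_lebesgue_on_eq_lborel:
  fixes f :: "real \<Rightarrow> real"
  assumes S: "S \<in> sets borel" and f: "(\<lambda>t. indicator S t * f t) \<in> borel_measurable borel"
  shows "(LINT t|lebesgue_on S. f t) = (LINT t|lborel. indicator S t * f t)"
proof -
  have "(LINT t|lebesgue_on S. f t) = (LINT t|lebesgue. indicator S t * f t)"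
    using S by (subst integral_restrict_space) auto
  also have "\<dots> = (LINT t|lborel. indicator S t * f t)"
    by (rule integral_completion) (use f in simp)
  finally show ?thesis .
qed

lemma AE_lebesgue_onI:
  assumes "AE t in lborel. t \<in> S \<longrightarrow> P t" "S \<in> sets borel"
  shows "AE t in lebesgue_on S. P t"
  using AE_completion[OF assms(1)] assms(2) by (subst AE_restrict_space_iff) auto

lemma indicator_mult_borel_measurable:
  fixes f :: "real \<Rightarrow> real"
  assumes "S \<in> sets borel" "continuous_on S f"
  shows "(\<lambda>t. indicator S t * f t) \<in> borel_measurable borel"
  using borel_measurable_continuous_on_indicator[OF assms] by simp

lemma integrable_bounded_on_interval:
  fixes f :: "real \<Rightarrow> real"
  assumes "f \<in> borel_measurable (lebesgue_on {0<..<T})" "\<And>t. t \<in> {0<..<T} \<Longrightarrow> \<bar>f t\<bar> \<le> C"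
  shows "integrable (lebesgue_on {0<..<T}) f"
proof -
  interpret finite_measure "lebesgue_on {0<..<T}"
    by (rule finite_measure_lebesgue_on) auto
  show ?thesis
    by (rule integrable_const_bound[of _ C]) (use assms in \<open>auto intro: AE_I2\<close>)
qed

lemma continuous_on_Icc_measurable:
  fixes f :: "real \<Rightarrow> real"
  assumes "continuous_on {0..T} f"
  shows "f \<in> borel_measurable (lebesgue_on {0<..<T})"
  by (rule continuous_imp_measurable_on_sets_lebesgue)
     (use assms in \<open>auto intro: continuous_on_subset\<close>)

lemma continuous_on_Icc_bounded:
  fixes f :: "real \<Rightarrow> real"
  assumes "continuous_on {a..b} f"
  obtains C where "0 \<le> C" "\<And>t. t \<in> {a..b} \<Longrightarrow> \<bar>f t\<bar> \<le> C"
proof -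
  have "bounded (f ` {a..b})"
    using compact_continuous_image[OF assms compact_Icc] by (rule compact_imp_bounded)
  then obtain C where "0 < C" "\<forall>v\<in>f ` {a..b}. norm v \<le> C" unfolding bounded_pos by blast
  then show ?thesis using that[of C] by auto
qed

lemma integrable_continuous_on_Icc:
  fixes f :: "real \<Rightarrow> real"
  assumes "continuous_on {0..T} f"
  shows "integrable (lebesgue_on {0<..<T}) f"
proof -
  obtain C where "\<And>t. t \<in> {0..T} \<Longrightarrow> \<bar>f t\<bar> \<le> C"
    using continuous_on_Icc_bounded[OF assms] by blast
  then show ?thesis
    by (intro integrable_bounded_on_interval[where C = C] continuous_on_Icc_measurable assms) auto
qed

lemma integral_deriv_interval:
  assumes "\<And>t. (\<phi> has_real_derivative \<phi>' t) (at t)" "continuous_on UNIV \<phi>'" "a \<le> b"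
  shows "(LINT t|lborel. indicator {a..<b} t * \<phi>' t) = \<phi> b - \<phi> a"
    and "(LINT t|lborel. indicator {a<..<b} t * \<phi>' t) = \<phi> b - \<phi> a"
    and "(LINT t|lebesgue_on {a<..<b}. \<phi>' t) = \<phi> b - \<phi> a"
proof -
  have b: "\<phi>' \<in> borel_measurable borel" using assms(2) by (rule borel_measurable_continuous_onI)
  have FTC: "(LINT t|lborel. \<phi>' t * indicator {a..b} t) = \<phi> b - \<phi> a"
    using assms by (intro integral_FTC_Icc_real) (auto simp: continuous_on_eq_continuous_at)
  have "(LINT t|lborel. indicator {a..<b} t * \<phi>' t) = (LINT t|lborel. \<phi>' t * indicator {a..b} t)"
  proof (rule integral_cong_AE)
    show "AE t in lborel. indicator {a..<b} t * \<phi>' t = \<phi>' t * indicator {a..b} t"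
      using AE_lborel_singleton[of b] by eventually_elim (auto simp: indicator_def)
  qed (use b in measurable)
  then show "(LINT t|lborel. indicator {a..<b} t * \<phi>' t) = \<phi> b - \<phi> a" using FTC by simp
  have "(LINT t|lborel. indicator {a<..<b} t * \<phi>' t) = (LINT t|lborel. \<phi>' t * indicator {a..b} t)"
  proof (rule integral_cong_AE)
    show "AE t in lborel. indicator {a<..<b} t * \<phi>' t = \<phi>' t * indicator {a..b} t"
      using AE_lborel_singleton[of b] AE_lborel_singleton[of a] by eventually_elim (auto simp: indicator_def)
  qed (use b in measurable)
  then show *: "(LINT t|lborel. indicator {a<..<b} t * \<phi>' t) = \<phi> b - \<phi> a" using FTC by simp
  show "(LINT t|lebesgue_on {a<..<b}. \<phi>' t) = \<phi> b - \<phi> a"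
    by (subst integral_lebesgue_on_eq_lborel) (use b * in auto)
qed

lemma test_funD:
  assumes "test_fun {0<..<T} \<phi> \<phi>'"
  shows "\<And>t. (\<phi> has_real_derivative \<phi>' t) (at t)" "continuous_on UNIV \<phi>'"
    "\<phi> 0 = 0" "\<phi> T = 0" "continuous_on UNIV \<phi>"
proof -
  show d: "\<And>t. (\<phi> has_real_derivative \<phi>' t) (at t)" and "continuous_on UNIV \<phi>'"
    using assms unfolding test_fun_def by auto
  obtain K where "K \<subseteq> {0<..<T}" "\<And>t. t \<notin> K \<Longrightarrow> \<phi> t = 0"
    using assms unfolding test_fun_def by blast
  then show "\<phi> 0 = 0" "\<phi> T = 0" by force+
  show "continuous_on UNIV \<phi>"
    using d by (auto simp: continuous_on_eq_continuous_at intro: DERIV_isCont)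
qed

text \<open>Integration by parts for a primitive of a bounded function, as Fubini's theorem over the
triangle \<open>0 < r \<le> t < T\<close> for the integrand \<open>\<phi>' t * v r\<close>.\<close>

theorem weak_deriv_if_primitive:
  assumes T: "0 < T"
    and v: "v \<in> borel_measurable borel" "\<And>t. \<bar>v t\<bar> \<le> C"
    and u: "continuous_on {0..T} u"
    and prim: "\<And>t. t \<in> {0..T} \<Longrightarrow> u t = u 0 + (LINT r:{0<..t}|lborel. v r)"
  shows "weak_deriv {0<..<T} u v"
  unfolding weak_deriv_def
proof (intro allI impI)
  fix \<phi> \<phi>' assume "test_fun {0<..<T} \<phi> \<phi>'"
  note \<phi> = test_funD[OF this]
  have [measurable]: "v \<in> borel_measurable borel" by fact
  have [measurable]: "\<phi>' \<in> borel_measurable borel" "\<phi> \<in> borel_measurable borel"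
    using \<phi> by (auto intro: borel_measurable_continuous_onI)
  obtain D where D: "0 \<le> D" "\<And>t. t \<in> {0..T} \<Longrightarrow> \<bar>\<phi>' t\<bar> \<le> D"
    using continuous_on_Icc_bounded[OF continuous_on_subset[OF \<phi>(2)]] by blast
  have C: "0 \<le> C" using v(2)[of 0] by linarith
  define k where "k = (\<lambda>t r. if 0 < r \<and> r \<le> t \<and> t < T then \<phi>' t * v r else 0)"
  have int_k: "integrable (lborel \<Otimes>\<^sub>M lborel) (\<lambda>(t, r). k t r)"
  proof (rule integrableI_bounded_set[where A = "{0<..<T} \<times> {0<..<T}" and B = "D * C"])
    show "(\<lambda>(t, r). k t r) \<in> borel_measurable (lborel \<Otimes>\<^sub>M lborel)"
      unfolding k_def by measurable
    show "emeasure (lborel \<Otimes>\<^sub>M lborel) ({0<..<T} \<times> {0<..<T}) < \<infinity>"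
      using T by (subst lborel.emeasure_pair_measure_Times) (auto simp: ennreal_mult_less_top)
    show "AE p in lborel \<Otimes>\<^sub>M lborel. p \<in> {0<..<T} \<times> {0<..<T} \<longrightarrow> norm (case p of (t, r) \<Rightarrow> k t r) \<le> D * C"
      using D C v(2) by (intro AE_I2) (auto simp: k_def abs_mult intro!: mult_mono)
  qed (auto simp: k_def split: if_splits intro!: AE_I2)
  have inner_r: "(LINT r|lborel. k t r) = indicator {0<..<T} t * (\<phi>' t * (u t - u 0))" for t
  proof (cases "t \<in> {0<..<T}")
    case True
    then have "(LINT r|lborel. k t r) = (LINT r|lborel. \<phi>' t * (indicator {0<..t} r * v r))"
      by (intro Bochner_Integration.integral_cong) (auto simp: k_def indicator_def)
    also have "\<dots> = \<phi>' t * (u t - u 0)"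
      using prim[of t] True by (simp add: set_lebesgue_integral_def)
    finally show ?thesis using True by simp
  next
    case False
    then have "k t r = 0" for r by (auto simp: k_def)
    then show ?thesis using False by simp
  qed
  have inner_t: "(LINT t|lborel. k t r) = - (indicator {0<..<T} r * (v r * \<phi> r))" for r
  proof (cases "r \<in> {0<..<T}")
    case True
    then have "(LINT t|lborel. k t r) = (LINT t|lborel. v r * (indicator {r..<T} t * \<phi>' t))"
      by (intro Bochner_Integration.integral_cong) (auto simp: k_def indicator_def)
    also have "\<dots> = v r * (\<phi> T - \<phi> r)"
      using integral_deriv_interval(1)[OF \<phi>(1,2), of r T] True by simp
    finally show ?thesis using True \<phi>(4) by simp
  next
    case False
    then have "k t r = 0" for t by (auto simp: k_def)
    then show ?thesis using False by simp
  qed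
  have cu: "continuous_on {0<..<T} u" using u by (rule continuous_on_subset) auto
  have c\<phi>': "continuous_on {0<..<T} \<phi>'" using \<phi>(2) by (rule continuous_on_subset) auto
  have int_\<phi>': "integrable lborel (\<lambda>t. indicator {0<..<T} t * \<phi>' t)"
    by (rule integrableI_bounded_set[where A = "{0<..<T}" and B = D])
       (use D T in \<open>auto simp: indicator_def intro!: AE_I2\<close>)
  have "integrable lborel (\<lambda>t. LINT r|lborel. k t r)"
    using lborel_pair.integrable_fst'[OF int_k] by simp
  then have int_u: "integrable lborel (\<lambda>t. indicator {0<..<T} t * (\<phi>' t * (u t - u 0)))"
    unfolding inner_r .
  have "(LINT t|lebesgue_on {0<..<T}. u t * \<phi>' t) = (LINT t|lborel. indicator {0<..<T} t * (u t * \<phi>' t))"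
    by (rule integral_lebesgue_on_eq_lborel[OF _ indicator_mult_borel_measurable])
       (use cu c\<phi>' in \<open>auto intro!: continuous_intros\<close>)
  also have "\<dots> = (LINT t|lborel. u 0 * (indicator {0<..<T} t * \<phi>' t) +
      indicator {0<..<T} t * (\<phi>' t * (u t - u 0)))"
    by (intro Bochner_Integration.integral_cong) (auto simp: algebra_simps)
  also have "\<dots> = u 0 * (\<phi> T - \<phi> 0) + (LINT t|lborel. LINT r|lborel. k t r)"
    using int_\<phi>' int_u T unfolding inner_r
    by (subst Bochner_Integration.integral_add) (auto simp: integral_deriv_interval(2)[OF \<phi>(1,2)])
  also have "(LINT t|lborel. LINT r|lborel. k t r) = (LINT r|lborel. LINT t|lborel. k t r)"
    by (rule lborel_pair.Fubini_integral[OF int_k, symmetric])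
  also have "\<dots> = - (LINT r|lborel. indicator {0<..<T} r * (v r * \<phi> r))"
    unfolding inner_t by simp
  also have "(LINT r|lborel. indicator {0<..<T} r * (v r * \<phi> r)) = (LINT r|lebesgue_on {0<..<T}. v r * \<phi> r)"
    by (rule integral_lebesgue_on_eq_lborel[symmetric]) auto
  finally show "(LINT t|lebesgue_on {0<..<T}. u t * \<phi>' t) = - (LINT t|lebesgue_on {0<..<T}. v t * \<phi> t)"
    using \<phi>(3,4) by simp
qed

text \<open>The square of the positive part is the simplest continuously differentiable function that
vanishes on a half-line; test functions are built from its translates.\<close>

lemma deriv_square_positive_part:
  "((\<lambda>z. (max 0 z)\<^sup>2) has_real_derivative 2 * max 0 z) (at (z::real))"
proof -
  consider "z < 0" | "z = 0" | "0 < z" by linarith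
  then show ?thesis
  proof cases
    case 1
    have "((\<lambda>z. 0) has_real_derivative 2 * max 0 z) (at z)" using 1 by simp
    then show ?thesis
      by (rule has_field_derivative_transform_within_open[of _ _ _ "{..<0}"]) (use 1 in auto)
  next
    case 3
    have "((\<lambda>z. z\<^sup>2) has_real_derivative 2 * max 0 z) (at z)"
      using 3 by (auto intro!: derivative_eq_intros)
    then show ?thesis
      by (rule has_field_derivative_transform_within_open[of _ _ _ "{0<..}"]) (use 3 in auto)
  next
    case 2
    have "((\<lambda>h::real. (max 0 h)\<^sup>2 / h) \<longlongrightarrow> 0) (at 0)"
    proof (rule Lim_null_comparison)
      show "\<forall>\<^sub>F h in at (0::real). norm ((max 0 h)\<^sup>2 / h) \<le> \<bar>h\<bar>"
        by (intro always_eventually) (auto simp: max_def power2_eq_square)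
      show "((\<lambda>h::real. \<bar>h\<bar>) \<longlongrightarrow> 0) (at 0)" by (rule tendsto_rabs_zero) simp
    qed
    then show ?thesis using 2 by (simp add: DERIV_def)
  qed
qed

text \<open>A second difference of squared positive parts, normalized so that the function rises from 0 at
\<open>c\<close> to 1 at \<open>c + h\<close>; its derivative is the tent function over \<open>[c, c + h]\<close> with integral 1.\<close>

definition smooth_step :: "real \<Rightarrow> real \<Rightarrow> real \<Rightarrow> real" where
  "smooth_step c h r = 2 / h\<^sup>2 * ((max 0 (r - c))\<^sup>2 - 2 * (max 0 (r - (c + h / 2)))\<^sup>2 + (max 0 (r - (c + h)))\<^sup>2)"

definition smooth_step' :: "real \<Rightarrow> real \<Rightarrow> real \<Rightarrow> real" where
  "smooth_step' c h r = 4 / h\<^sup>2 * (max 0 (r - c) - 2 * max 0 (r - (c + h / 2)) + max 0 (r - (c + h)))"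

lemma smooth_step_deriv: "(smooth_step c h has_real_derivative smooth_step' c h r) (at r)"
  unfolding smooth_step_def[abs_def] smooth_step'_def
  by (rule derivative_eq_intros DERIV_chain2[OF deriv_square_positive_part] refl)+ (simp add: algebra_simps)

lemma smooth_step'_continuous: "continuous_on A (smooth_step' c h)"
  unfolding smooth_step'_def[abs_def] by (intro continuous_intros)

lemma smooth_step_eq: "0 < h \<Longrightarrow> r \<le> c \<Longrightarrow> smooth_step c h r = 0" "0 < h \<Longrightarrow> c + h \<le> r \<Longrightarrow> smooth_step c h r = 1"
  by (auto simp: smooth_step_def max_def power2_eq_square field_simps)

lemma smooth_step'_props:
  assumes "0 < h"
  shows "0 \<le> smooth_step' c h r" "r \<le> c \<or> c + h \<le> r \<Longrightarrow> smooth_step' c h r = 0"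
  using assms by (auto simp: smooth_step'_def max_def field_simps)

lemma smooth_step_bounds:
  assumes h: "0 < h"
  shows "0 \<le> smooth_step c h r" "smooth_step c h r \<le> 1"
proof -
  have mono: "smooth_step c h a \<le> smooth_step c h b" if "a \<le> b" for a b
    by (rule DERIV_nonneg_imp_nondecreasing[OF that])
       (use smooth_step_deriv smooth_step'_props(1)[OF h] in blast)
  show "0 \<le> smooth_step c h r"
    using mono[of "min c r" r] smooth_step_eq(1)[OF h, of "min c r" c] by simp
  show "smooth_step c h r \<le> 1"
    using mono[of r "max (c + h) r"] smooth_step_eq(2)[OF h, of c "max (c + h) r"] by simp
qed

text \<open>Test with a plateau function that rises on \<open>[s, s + h]\<close> and falls on \<open>[t - h, t]\<close>. The right-hand
side of the weak derivative identity has a sign, so the tent average of \<open>u\<close> near \<open>s\<close> is at least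
that near \<open>t\<close>; for small \<open>h\<close> this contradicts \<open>u s < u t\<close>.\<close>

lemma weak_deriv_nonpos_interior:
  assumes u: "continuous_on {0..T} u" and w: "weak_deriv {0<..<T} u v"
    and st: "0 < s" "s < t" "t < T"
    and neg: "AE r in lebesgue_on {0<..<T}. r \<in> {s<..<t} \<longrightarrow> v r \<le> 0"
  shows "u t \<le> u s"
proof (rule ccontr)
  assume rise: "\<not> u t \<le> u s"
  define e where "e = (u t - u s) / 4"
  \<comment> \<open>subtracting the midpoint costs nothing, because \<open>\<phi>'\<close> has integral 0, and fixes the signs\<close>
  define m where "m = (u s + u t) / 2"
  have e: "0 < e" using rise by (simp add: e_def)
  have me: "m - e = u s + e" "m + e = u t - e" by (simp_all add: m_def e_def field_simps)
  obtain \<delta>1 where \<delta>1: "0 < \<delta>1" "\<And>r. r \<in> {0..T} \<Longrightarrow> \<bar>r - s\<bar> < \<delta>1 \<Longrightarrow> \<bar>u r - u s\<bar> < e"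
    using u st e unfolding continuous_on_iff dist_real_def by (metis atLeastAtMost_iff less_imp_le order_trans)
  obtain \<delta>2 where \<delta>2: "0 < \<delta>2" "\<And>r. r \<in> {0..T} \<Longrightarrow> \<bar>r - t\<bar> < \<delta>2 \<Longrightarrow> \<bar>u r - u t\<bar> < e"
    using u st e unfolding continuous_on_iff dist_real_def by (metis atLeastAtMost_iff less_imp_le order_trans)
  define h where "h = min (min (\<delta>1 / 2) (\<delta>2 / 2)) ((t - s) / 2)"
  have h: "0 < h" "h < \<delta>1" "h < \<delta>2" "h \<le> (t - s) / 2"
    using \<delta>1 \<delta>2 st by (auto simp: h_def min_def)
  have near_s: "u r \<le> m - e" if "s \<le> r" "r \<le> s + h" for r
  proof -
    have "\<bar>u r - u s\<bar> < e" using that h st by (intro \<delta>1(2)) auto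
    then show ?thesis unfolding me by linarith
  qed
  have near_t: "m + e \<le> u r" if "t - h \<le> r" "r \<le> t" for r
  proof -
    have "\<bar>u r - u t\<bar> < e" using that h st by (intro \<delta>2(2)) auto
    then show ?thesis unfolding me by linarith
  qed
  let ?A = "smooth_step s h" and ?A' = "smooth_step' s h"
  let ?B = "smooth_step (t - h) h" and ?B' = "smooth_step' (t - h) h"
  define \<phi> where "\<phi> r = ?A r - ?B r" for r
  define \<phi>' where "\<phi>' r = ?A' r - ?B' r" for r
  have \<phi>_out: "\<phi> r = 0" if "r \<notin> {s..t}" for r
    using that h smooth_step_eq[OF h(1), of r s] smooth_step_eq[OF h(1), of r "t - h"]
      smooth_step_eq(2)[OF h(1), of s r] smooth_step_eq(2)[OF h(1), of "t - h" r]
    by (cases "r < s") (auto simp: \<phi>_def)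
  have \<phi>_nonneg: "0 \<le> \<phi> r" for r
  proof (cases "r \<le> t - h")
    case True
    then show ?thesis using smooth_step_eq(1)[OF h(1) True] smooth_step_bounds[OF h(1), of s r] by (simp add: \<phi>_def)
  next
    case False
    then have "?A r = 1" using h by (intro smooth_step_eq(2)) auto
    then show ?thesis using smooth_step_bounds[OF h(1), of "t - h" r] by (simp add: \<phi>_def)
  qed
  have d: "(\<phi> has_real_derivative \<phi>' r) (at r)" for r
    unfolding \<phi>_def[abs_def] \<phi>'_def by (intro DERIV_diff smooth_step_deriv)
  have c: "continuous_on A \<phi>'" for A
    unfolding \<phi>'_def[abs_def] by (intro continuous_intros smooth_step'_continuous)
  have "test_fun {0<..<T} \<phi> \<phi>'"
    unfolding test_fun_def using d c \<phi>_out st by (auto intro!: exI[of _ "{s..t}"])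
  then have eq: "(LINT r|lebesgue_on {0<..<T}. u r * \<phi>' r) = - (LINT r|lebesgue_on {0<..<T}. v r * \<phi> r)"
    using w unfolding weak_deriv_def by blast
  have "0 \<le> (LINT r|lebesgue_on {0<..<T}. - (v r * \<phi> r))"
  proof (rule integral_nonneg_AE)
    have "AE r in lebesgue_on {0<..<T}. r \<noteq> s \<and> r \<noteq> t"
      by (rule AE_lebesgue_onI) (use AE_lborel_singleton[of s] AE_lborel_singleton[of t] in \<open>eventually_elim, auto\<close>)
    with neg show "AE r in lebesgue_on {0<..<T}. 0 \<le> - (v r * \<phi> r)"
    proof eventually_elim
      case (elim r)
      show ?case
      proof (cases "r \<in> {s<..<t}")
        case True
        then show ?thesis using elim \<phi>_nonneg[of r] by (auto intro: mult_nonpos_nonneg)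
      next
        case False
        then show ?thesis using elim \<phi>_out[of r] by auto
      qed
    qed
  qed
  then have u\<phi>': "0 \<le> (LINT r|lebesgue_on {0<..<T}. u r * \<phi>' r)" using eq by simp
  have int: "integrable (lebesgue_on {0<..<T}) (\<lambda>r. u r * \<phi>' r)" "integrable (lebesgue_on {0<..<T}) \<phi>'"
      "integrable (lebesgue_on {0<..<T}) ?A'"
    by (intro integrable_continuous_on_Icc continuous_intros u c smooth_step'_continuous)+
  have "0 = \<phi> T - \<phi> 0" using \<phi>_out[of 0] \<phi>_out[of T] st by simp
  also have "\<dots> = (LINT r|lebesgue_on {0<..<T}. \<phi>' r)"
    using integral_deriv_interval(3)[OF d c, of 0 T] st by simp
  finally have "(LINT r|lebesgue_on {0<..<T}. m * \<phi>' r - u r * \<phi>' r) \<le> 0"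
    using u\<phi>' int by simp
  moreover have "e = e * (?A T - ?A 0)"
    using smooth_step_eq[OF h(1), of 0 s] smooth_step_eq(2)[OF h(1), of s T] h st by simp
  then have "e = (LINT r|lebesgue_on {0<..<T}. e * ?A' r)"
    using integral_deriv_interval(3)[OF smooth_step_deriv smooth_step'_continuous, of 0 T s h] st by simp
  moreover have "(LINT r|lebesgue_on {0<..<T}. e * ?A' r) \<le> (LINT r|lebesgue_on {0<..<T}. m * \<phi>' r - u r * \<phi>' r)"
  proof (rule integral_mono)
    fix r
    have "e * ?A' r \<le> (m - u r) * ?A' r"
    proof (cases "s \<le> r \<and> r \<le> s + h")
      case True
      then show ?thesis using near_s[of r] smooth_step'_props(1)[OF h(1)] by (intro mult_right_mono) auto
    qed (use smooth_step'_props(2)[OF h(1), of r s] in auto)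
    moreover have "(m - u r) * ?B' r \<le> 0"
    proof (cases "t - h \<le> r \<and> r \<le> t")
      case True
      then show ?thesis using near_t[of r] smooth_step'_props(1)[OF h(1)] e
        by (intro mult_nonpos_nonneg) auto
    qed (use smooth_step'_props(2)[OF h(1), of r "t - h"] in auto)
    ultimately show "e * ?A' r \<le> m * \<phi>' r - u r * \<phi>' r"
      by (simp add: \<phi>'_def algebra_simps)
  qed (use int in auto)
  ultimately show False using e by linarith
qed

theorem weak_deriv_nonpos_imp_decreasing:
  assumes u: "continuous_on {0..T} u" and w: "weak_deriv {0<..<T} u v"
    and st: "0 \<le> s" "s \<le> t" "t \<le> T"
    and neg: "AE r in lebesgue_on {0<..<T}. r \<in> {s<..<t} \<longrightarrow> v r \<le> 0"
  shows "u t \<le> u s"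
proof (cases "s < t")
  case True
  have inner: "u t' \<le> u s'" if "s < s'" "s' < t'" "t' < t" for s' t'
  proof (rule weak_deriv_nonpos_interior[OF u w])
    show "AE r in lebesgue_on {0<..<T}. r \<in> {s'<..<t'} \<longrightarrow> v r \<le> 0"
      using neg by eventually_elim (use that in auto)
  qed (use that st in auto)
  have "u t \<le> u s'" if "s < s'" "s' < t" for s'
  proof -
    have "(u \<longlongrightarrow> u t) (at_left t)"
      using continuous_on_subset[OF u, of "{s..t}"] True st by (intro continuous_on_Icc_at_leftD[of s]) auto
    moreover have "\<forall>\<^sub>F t' in at_left t. u t' \<le> u s'"
      using that inner by (auto simp: eventually_at_left intro!: exI[of _ s'])
    ultimately show ?thesis by (rule tendsto_upperbound) simp
  qed
  then have "u t \<le> u s'" if "s < s'" "s' \<le> t" for s' using that by (cases "s' = t") auto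
  then show ?thesis
    by (rule le_left_end_by_continuity[rotated 2]) (use u True st in \<open>auto intro: continuous_on_subset\<close>)
qed (use st in auto)

lemma weak_deriv_uminus:
  assumes "weak_deriv I u v" shows "weak_deriv I (\<lambda>t. - u t) (\<lambda>t. - v t)"
  using assms unfolding weak_deriv_def by simp

lemma weak_deriv_cong_AE:
  assumes w: "weak_deriv I u v" and ae: "AE t in lebesgue_on I. v t = v' t"
    and meas: "v \<in> borel_measurable (lebesgue_on I)" "v' \<in> borel_measurable (lebesgue_on I)"
    and I: "open I"
  shows "weak_deriv I u v'"
  unfolding weak_deriv_def
proof (intro allI impI)
  fix \<phi> \<phi>' assume t: "test_fun I \<phi> \<phi>'"
  then have "continuous_on UNIV \<phi>"
    by (auto simp: test_fun_def continuous_on_eq_continuous_at intro: DERIV_isCont)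
  then have "\<phi> \<in> borel_measurable (lebesgue_on I)"
    using I by (intro continuous_imp_measurable_on_sets_lebesgue) (auto intro: continuous_on_subset)
  then have "(LINT t|lebesgue_on I. v t * \<phi> t) = (LINT t|lebesgue_on I. v' t * \<phi> t)"
    by (intro integral_cong_AE) (use meas ae in auto)
  then show "(LINT t|lebesgue_on I. u t * \<phi>' t) = - (LINT t|lebesgue_on I. v' t * \<phi> t)"
    using w t unfolding weak_deriv_def by simp
qed

lemma weak_deriv_unique_up_to_const:
  assumes u: "continuous_on {0..T} u" "weak_deriv {0<..<T} u v"
    and w: "continuous_on {0..T} w" "weak_deriv {0<..<T} w v" and t: "t \<in> {0..T}"
  shows "u t - w t = u 0 - w 0"
proof -
  have "weak_deriv {0<..<T} (\<lambda>t. u t - w t) (\<lambda>_. 0)"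
    unfolding weak_deriv_def
  proof (intro allI impI)
    fix \<phi> \<phi>' assume t: "test_fun {0<..<T} \<phi> \<phi>'"
    have int: "integrable (lebesgue_on {0<..<T}) (\<lambda>t. u t * \<phi>' t)" "integrable (lebesgue_on {0<..<T}) (\<lambda>t. w t * \<phi>' t)"
      by (intro integrable_continuous_on_Icc continuous_intros u w continuous_on_subset[OF test_funD(2)[OF t]] subset_UNIV)+
    have "(LINT t|lebesgue_on {0<..<T}. u t * \<phi>' t) = (LINT t|lebesgue_on {0<..<T}. w t * \<phi>' t)"
      using u(2)[unfolded weak_deriv_def, rule_format, OF t] w(2)[unfolded weak_deriv_def, rule_format, OF t]
      by simp
    then show "(LINT t|lebesgue_on {0<..<T}. (u t - w t) * \<phi>' t) = - (LINT t|lebesgue_on {0<..<T}. 0 * \<phi> t)"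
      using int by (simp add: left_diff_distrib)
  qed
  moreover from weak_deriv_uminus[OF this] have "weak_deriv {0<..<T} (\<lambda>t. - (u t - w t)) (\<lambda>_. 0)" by simp
  moreover have "continuous_on {0..T} (\<lambda>t. u t - w t)" "continuous_on {0..T} (\<lambda>t. - (u t - w t))"
    using u w by (auto intro!: continuous_intros)
  ultimately have "u t - w t \<le> u 0 - w 0" "- (u t - w t) \<le> - (u 0 - w 0)"
    using t weak_deriv_nonpos_imp_decreasing[of T "\<lambda>t. u t - w t" "\<lambda>_. 0" 0 t]
      weak_deriv_nonpos_imp_decreasing[of T "\<lambda>t. - (u t - w t)" "\<lambda>_. 0" 0 t] by auto
  then show ?thesis by linarith
qed

section \<open>Sobolev functions and convergence in the mean\<close>

lemma Lp_fun_bounded: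
  fixes T :: real
  assumes p: "0 < p" and u: "u \<in> borel_measurable (lebesgue_on {0<..<T})"
    and C: "\<And>t. t \<in> {0<..<T} \<Longrightarrow> \<bar>u t\<bar> \<le> C"
  shows "Lp_fun p (lebesgue_on {0<..<T}) u"
  unfolding Lp_fun_def
proof
  show "integrable (lebesgue_on {0<..<T}) (\<lambda>t. \<bar>u t\<bar> powr p)"
  proof (rule integrable_bounded_on_interval)
    show "(\<lambda>t. \<bar>u t\<bar> powr p) \<in> borel_measurable (lebesgue_on {0<..<T})" using u by measurable
    show "\<bar>\<bar>u t\<bar> powr p\<bar> \<le> C powr p" if "t \<in> {0<..<T}" for t
      using C[OF that] p by (auto intro: powr_mono2)
  qed
qed (rule u)

lemma Lp_fun_continuous:
  fixes T :: real
  assumes "0 < p" "continuous_on {0..T} u"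
  shows "Lp_fun p (lebesgue_on {0<..<T}) u"
proof -
  obtain C where "\<And>t. t \<in> {0..T} \<Longrightarrow> \<bar>u t\<bar> \<le> C"
    using continuous_on_Icc_bounded[OF assms(2)] by blast
  then show ?thesis
    by (intro Lp_fun_bounded[where C = C] assms continuous_on_Icc_measurable) auto
qed

text \<open>Dominated convergence along sequences \<open>e\<^sub>n \<rightarrow> 0\<close>.\<close>

lemma tendsto_Lp_if_bounded_pointwise:
  fixes T :: real
  assumes q: "0 < q"
    and u: "\<And>e. 0 < e \<Longrightarrow> continuous_on {0..T} (u e)"
      "\<And>e t. 0 < e \<Longrightarrow> t \<in> {0..T} \<Longrightarrow> \<bar>u e t\<bar> \<le> C"
    and v: "continuous_on {0..T} v"
    and lim: "\<And>t. t \<in> {0<..<T} \<Longrightarrow> ((\<lambda>e. u e t) \<longlongrightarrow> v t) (at_right 0)"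
  shows "tendsto_Lp q (lebesgue_on {0<..<T}) u v (at_right (0::real))"
  unfolding tendsto_Lp_def
proof (intro conjI)
  let ?M = "lebesgue_on {0<..<T}"
  show "\<forall>\<^sub>F e in at_right 0. Lp_fun q ?M (u e)"
    using eventually_at_right_less[of 0] by eventually_elim (intro Lp_fun_continuous q u)
  show "Lp_fun q ?M v" by (intro Lp_fun_continuous q v)
  obtain D where D: "0 \<le> D" "\<And>t. t \<in> {0..T} \<Longrightarrow> \<bar>v t\<bar> \<le> D"
    using continuous_on_Icc_bounded[OF v] by blast
  have "((\<lambda>e. LINT t|?M. \<bar>u e t - v t\<bar> powr q) \<longlongrightarrow> 0) (at_right 0)"
  proof (rule tendsto_at_right_sequentially[of 0 1])
    fix S :: "nat \<Rightarrow> real"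
    assume S: "\<And>n. 0 < S n" "S \<longlonglongrightarrow> 0"
    have meas: "(\<lambda>t. u (S n) t - v t) \<in> borel_measurable ?M" for n
      by (intro continuous_on_Icc_measurable continuous_intros u v S)
    have "(\<lambda>n. LINT t|?M. \<bar>u (S n) t - v t\<bar> powr q) \<longlonglongrightarrow> (LINT t|?M. 0)"
    proof (rule integral_dominated_convergence[where w = "\<lambda>_. (C + D) powr q"])
      show "integrable ?M (\<lambda>_. (C + D) powr q)"
        by (intro integrable_continuous_on_Icc continuous_intros)
      show "AE t in ?M. (\<lambda>n. \<bar>u (S n) t - v t\<bar> powr q) \<longlonglongrightarrow> 0"
      proof (rule AE_I2)
        fix t assume t: "t \<in> space ?M"
        have "filterlim S (at_right 0) sequentially"
          by (rule tendsto_imp_filterlim_at_right[OF S(2)]) (simp add: S(1))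
        then have "(\<lambda>n. u (S n) t) \<longlonglongrightarrow> v t"
          using lim[of t] t by (auto intro: filterlim_compose)
        then have "(\<lambda>n. \<bar>u (S n) t - v t\<bar>) \<longlonglongrightarrow> 0"
          by (intro tendsto_rabs_zero) (simp add: LIM_zero)
        then show "(\<lambda>n. \<bar>u (S n) t - v t\<bar> powr q) \<longlonglongrightarrow> 0"
          using q by (intro tendsto_zero_powrI[where b = q]) auto
      qed
      show "AE t in ?M. norm (\<bar>u (S n) t - v t\<bar> powr q) \<le> (C + D) powr q" for n
      proof (rule AE_I2)
        fix t assume t: "t \<in> space ?M"
        then have "\<bar>u (S n) t - v t\<bar> \<le> C + D"
          using u(2)[OF S(1), of t n] D(2)[of t] by auto
        then show "norm (\<bar>u (S n) t - v t\<bar> powr q) \<le> (C + D) powr q"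
          using q by (auto intro: powr_mono2)
      qed
    qed (use meas in measurable)
    then show "(\<lambda>n. LINT t|?M. \<bar>u (S n) t - v t\<bar> powr q) \<longlonglongrightarrow> 0" by simp
  qed simp
  then show "((\<lambda>e. Lp_norm q ?M (\<lambda>t. u e t - v t)) \<longlongrightarrow> 0) (at_right 0)"
    unfolding Lp_norm_def using q
    by (intro tendsto_zero_powrI[where b = "1 / q"] always_eventually allI Bochner_Integration.integral_nonneg) auto
qed

lemma weak_deriv_if_deriv:
  assumes T: "0 < T"
    and d: "\<And>t. t \<in> {0..T} \<Longrightarrow> (u has_real_derivative u' t) (at t within {0..T})"
    and c: "continuous_on {0..T} u'"
  shows "weak_deriv {0<..<T} u u'"
proof -
  define v where "v t = indicator {0..T} t * u' t" for t
  have v: "v \<in> borel_measurable borel"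
    unfolding v_def[abs_def] by (rule indicator_mult_borel_measurable) (use c in auto)
  obtain C where C: "0 \<le> C" "\<And>t. t \<in> {0..T} \<Longrightarrow> \<bar>u' t\<bar> \<le> C"
    using continuous_on_Icc_bounded[OF c] by blast
  have "weak_deriv {0<..<T} u v"
  proof (rule weak_deriv_if_primitive[OF T v])
    show "\<bar>v t\<bar> \<le> C" for t using C by (auto simp: v_def indicator_def)
    show "continuous_on {0..T} u" using d by (rule DERIV_continuous_on)
    fix t assume t: "t \<in> {0..T}"
    have "(LINT r|lborel. indicator {0..t} r *\<^sub>R u' r) = u t - u 0"
    proof (rule integral_FTC_Icc)
      show "(u has_vector_derivative u' r) (at r within {0..t})" if "0 \<le> r" "r \<le> t" for r
        using d[of r] that t has_vector_derivative_within_subset[of u "u' r" r "{0..T}" "{0..t}"]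
        by (auto simp: has_real_derivative_iff_has_vector_derivative)
    qed (use t c in \<open>auto intro: continuous_on_subset\<close>)
    moreover have "(LINT r:{0<..t}|lborel. v r) = (LINT r|lborel. indicator {0..t} r *\<^sub>R u' r)"
      unfolding set_lebesgue_integral_def
    proof (rule integral_cong_AE)
      show "AE r in lborel. indicator {0<..t} r *\<^sub>R v r = indicator {0..t} r *\<^sub>R u' r"
        using AE_lborel_singleton[of 0] by eventually_elim (use t in \<open>auto simp: v_def indicator_def\<close>)
      show "(\<lambda>r. indicator {0..t} r *\<^sub>R u' r) \<in> borel_measurable lborel"
        using indicator_mult_borel_measurable[of "{0..t}" u'] continuous_on_subset[OF c, of "{0..t}"] t by auto
    qed (use v in measurable)
    ultimately show "u t = u 0 + (LINT r:{0<..t}|lborel. v r)" by simp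
  qed
  then show ?thesis
  proof (rule weak_deriv_cong_AE)
    show "AE t in lebesgue_on {0<..<T}. v t = u' t"
      by (rule AE_I2) (auto simp: v_def)
    show "v \<in> borel_measurable (lebesgue_on {0<..<T})"
      using v by (intro measurable_restrict_space1 measurable_completion) simp
    show "u' \<in> borel_measurable (lebesgue_on {0<..<T})" by (rule continuous_on_Icc_measurable[OF c])
  qed auto
qed

lemma W1p_deriv_if_deriv:
  assumes "0 < T" "0 < p"
    and d: "\<And>t. t \<in> {0..T} \<Longrightarrow> (u has_real_derivative u' t) (at t within {0..T})"
    and c: "continuous_on {0..T} u'"
  shows "W1p_deriv p {0<..<T} u u'"
  unfolding W1p_deriv_def
  using DERIV_continuous_on[OF d] c weak_deriv_if_deriv[OF assms(1) d c] Lp_fun_continuous[OF assms(2)]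
  by blast

section \<open>Solutions of the limit system\<close>

context play_system begin

lemma continuous_on_slow_field:
  assumes "continuous_on {0..T} x" "continuous_on {0..T} y"
  shows "continuous_on {0..T} (\<lambda>t. g (x t, y t, t))"
  using assms by (intro continuous_on_compose2[OF lipschitz_on_continuous_on[OF g_lip]] continuous_intros) auto

text \<open>In the inclusion, \<open>\<xi> = F\<^sub>-(y)\<close> shows that \<open>dx \<le> 0\<close> where \<open>x > F\<^sub>-(y)\<close>, and \<open>\<xi> = F\<^sub>+(y)\<close>
shows that \<open>dx \<ge> 0\<close> where \<open>x < F\<^sub>+(y)\<close>. The slow equation holds classically since its
right-hand side is continuous.\<close>

lemma limit_solution_imp_approx_play:
  assumes sol: "limit_solution g T Fm Fp x0 y0 x y" and start: "xs = min (max (Fm y0) x0) (Fp y0)"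
    and lip: "(\<And>t. t \<in> {0..T} \<Longrightarrow> (y has_real_derivative g (x t, y t, t)) (at t within {0..T})) \<Longrightarrow>
      y 0 = y0 \<Longrightarrow> K-lipschitz_on {0..T} y"
  shows "approx_play 0 x y"
proof -
  let ?I = "lebesgue_on {0<..<T}"
  let ?G = "\<lambda>t. g (x t, y t, t)"
  have cont: "continuous_on {0..T} x" "continuous_on {0..T} y" and y0: "y 0 = y0"
    and init: "x 0 = min (max (Fm y0) x0) (Fp y0)"
    and in_band: "\<And>t. t \<in> {0..T} \<Longrightarrow> x t \<in> {Fm (y t)..Fp (y t)}"
    using sol unfolding limit_solution_def by auto
  obtain dy where dy: "W1p_deriv 1 {0<..<T} y dy" "AE t in ?I. dy t = ?G t"
    using sol unfolding limit_solution_def by blast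
  obtain dx where dx: "W1p_deriv 1 {0<..<T} x dx"
      "AE t in ?I. \<forall>\<xi>\<in>{Fm (y t)..Fp (y t)}. dx t * (x t - \<xi>) \<le> 0"
    using sol unfolding limit_solution_def by blast
  have wx: "weak_deriv {0<..<T} x dx" using dx(1) by (simp add: W1p_deriv_def)
  have cG: "continuous_on {0..T} ?G" by (rule continuous_on_slow_field[OF cont])
  have "weak_deriv {0<..<T} y dy" "dy \<in> borel_measurable ?I"
    using dy(1) by (auto simp: W1p_deriv_def Lp_fun_def)
  then have "weak_deriv {0<..<T} y ?G"
    using dy(2) continuous_on_Icc_measurable[OF cG] weak_deriv_cong_AE[of "{0<..<T}" y dy ?G] by simp
  define Y where "Y t = y0 + integral {0..t} ?G" for t
  have Y: "(Y has_real_derivative ?G t) (at t within {0..T})" if "t \<in> {0..T}" for t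
    unfolding Y_def using integral_has_real_derivative[OF cG that] by (auto intro!: derivative_eq_intros)
  have eq: "y t = Y t" if "t \<in> {0..T}" for t
    using weak_deriv_unique_up_to_const[OF cont(2) \<open>weak_deriv {0<..<T} y ?G\<close>
        DERIV_continuous_on[OF Y] weak_deriv_if_deriv[OF T Y cG] that] y0
    by (simp add: Y_def)
  have dy': "(y has_real_derivative ?G t) (at t within {0..T})" if "t \<in> {0..T}" for t
    using has_field_derivative_transform_within[OF Y[OF that], of 1 y] that eq by simp
  have falls: "falls_above {0..T} (\<lambda>t. Fm (y t)) x"
    unfolding falls_above_def
  proof safe
    fix s t :: real
    assume st: "s \<le> t" "{s..t} \<subseteq> {0..T}" and above: "\<forall>r\<in>{s..t}. Fm (y r) < x r"
    show "x t \<le> x s"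
    proof (rule weak_deriv_nonpos_imp_decreasing[OF cont(1) wx])
      show "AE r in ?I. r \<in> {s<..<t} \<longrightarrow> dx r \<le> 0"
        using dx(2)
      proof (eventually_elim, intro impI)
        fix r assume *: "\<forall>\<xi>\<in>{Fm (y r)..Fp (y r)}. dx r * (x r - \<xi>) \<le> 0" and r: "r \<in> {s<..<t}"
        have "0 < x r - Fm (y r)" using above r by simp
        moreover have "dx r * (x r - Fm (y r)) \<le> 0" using * band[of "y r"] by auto
        ultimately show "dx r \<le> 0" by (simp add: mult_le_0_iff)
      qed
    qed (use st in auto)
  qed
  have rises: "falls_above {0..T} (\<lambda>t. - Fp (y t)) (\<lambda>t. - x t)"
    unfolding falls_above_def
  proof safe
    fix s t :: real
    assume st: "s \<le> t" "{s..t} \<subseteq> {0..T}" and below: "\<forall>r\<in>{s..t}. - Fp (y r) < - x r"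
    show "- x t \<le> - x s"
    proof (rule weak_deriv_nonpos_imp_decreasing[OF _ weak_deriv_uminus[OF wx]])
      show "continuous_on {0..T} (\<lambda>t. - x t)" using cont by (intro continuous_intros)
      show "AE r in ?I. r \<in> {s<..<t} \<longrightarrow> - dx r \<le> 0"
        using dx(2)
      proof (eventually_elim, intro impI)
        fix r assume *: "\<forall>\<xi>\<in>{Fm (y r)..Fp (y r)}. dx r * (x r - \<xi>) \<le> 0" and r: "r \<in> {s<..<t}"
        have "x r - Fp (y r) < 0" using below r by simp
        moreover have "dx r * (x r - Fp (y r)) \<le> 0" using * band[of "y r"] by auto
        ultimately show "- dx r \<le> 0" by (simp add: mult_le_0_iff)
      qed
    qed (use st in auto)
  qed
  have "min (max (Fm y0) (x 0)) (Fp y0) = xs" using init start band[of y0] by simp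
  then show ?thesis
    unfolding approx_play_def using cont dy' lip y0 falls rises in_band by auto
qed

text \<open>Since \<open>F\<^sub>- < F\<^sub>+\<close>, every point is above the lower or below the upper barrier, and the signs of \<open>v\<close>
in these two cases are equivalent to the inclusion: \<open>v = 0\<close> inside the band, \<open>v \<ge> 0\<close> on its
lower and \<open>v \<le> 0\<close> on its upper end.\<close>

lemma exact_play_weak_deriv:
  assumes ap: "approx_play 0 x y" and lip: "\<Lambda>-lipschitz_on {0..T} x"
  obtains v where "v \<in> borel_measurable (lebesgue_on {0<..<T})" "\<And>t. \<bar>v t\<bar> \<le> \<Lambda>"
    "weak_deriv {0<..<T} x v"
    "AE t in lebesgue_on {0<..<T}. \<forall>\<xi>\<in>{Fm (y t)..Fp (y t)}. v t * (x t - \<xi>) \<le> 0"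
proof -
  note D = approx_playD[OF ap]
  have cy: "continuous_on {0..T} y" using D(3) by (rule lipschitz_on_continuous_on)
  obtain v where v: "v \<in> borel_measurable borel" "\<And>t. \<bar>v t\<bar> \<le> \<Lambda>"
      "\<And>t. t \<in> {0..T} \<Longrightarrow> x t = x 0 + (LINT r:{0<..t}|lborel. v r)"
      "\<And>a b. 0 \<le> a \<Longrightarrow> a \<le> b \<Longrightarrow> b \<le> T \<Longrightarrow> (\<And>s t. a \<le> s \<Longrightarrow> s \<le> t \<Longrightarrow> t \<le> b \<Longrightarrow> x t \<le> x s) \<Longrightarrow>
        AE r in lborel. r \<in> {a<..b} \<longrightarrow> v r \<le> 0"
      "\<And>a b. 0 \<le> a \<Longrightarrow> a \<le> b \<Longrightarrow> b \<le> T \<Longrightarrow> (\<And>s t. a \<le> s \<Longrightarrow> s \<le> t \<Longrightarrow> t \<le> b \<Longrightarrow> x s \<le> x t) \<Longrightarrow>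
        AE r in lborel. r \<in> {a<..b} \<longrightarrow> 0 \<le> v r"
    using lipschitz_density[OF lip T] by blast
  have cF: "continuous_on {0..T} (\<lambda>t. Fm (y t))" "continuous_on {0..T} (\<lambda>t. - Fp (y t))"
      "continuous_on {0..T} (\<lambda>t. - x t)"
    using cy D(1) by (auto intro!: continuous_intros
        continuous_on_compose2[OF lipschitz_on_continuous_on[OF Fm_lip]]
        continuous_on_compose2[OF lipschitz_on_continuous_on[OF Fp_lip]])
  have "AE r in lborel. r \<in> {0<..<T} \<longrightarrow> Fm (y r) < x r \<longrightarrow> v r \<le> 0"
    using v(4) by (rule falls_above_density_nonpos[OF D(5,1) cF(1)])
  moreover have "AE r in lborel. r \<in> {0<..<T} \<longrightarrow> - Fp (y r) < - x r \<longrightarrow> - v r \<le> 0"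
    by (rule falls_above_density_nonpos[OF D(6) cF(3,2)]) (use v(5) in simp)
  ultimately have "AE r in lborel. r \<in> {0<..<T} \<longrightarrow> (\<forall>\<xi>\<in>{Fm (y r)..Fp (y r)}. v r * (x r - \<xi>) \<le> 0)"
  proof (eventually_elim, intro impI ballI)
    fix r \<xi>
    assume *: "r \<in> {0<..<T} \<longrightarrow> Fm (y r) < x r \<longrightarrow> v r \<le> 0"
      "r \<in> {0<..<T} \<longrightarrow> - Fp (y r) < - x r \<longrightarrow> - v r \<le> 0"
      and r: "r \<in> {0<..<T}" and \<xi>: "\<xi> \<in> {Fm (y r)..Fp (y r)}"
    consider "x r \<le> Fm (y r)" | "Fm (y r) < x r" "x r < Fp (y r)" | "Fp (y r) \<le> x r" "Fm (y r) < x r"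
      by linarith
    then show "v r * (x r - \<xi>) \<le> 0"
    proof cases
      case 1
      then have "0 \<le> v r" "x r - \<xi> \<le> 0" using * r \<xi> band[of "y r"] by auto
      then show ?thesis by (rule mult_nonneg_nonpos)
    next
      case 2
      then have "v r = 0" using * r by auto
      then show ?thesis by simp
    next
      case 3
      then have "v r \<le> 0" "0 \<le> x r - \<xi>" using * r \<xi> by auto
      then show ?thesis by (rule mult_nonpos_nonneg)
    qed
  qed
  then have "AE t in lebesgue_on {0<..<T}. \<forall>\<xi>\<in>{Fm (y t)..Fp (y t)}. v t * (x t - \<xi>) \<le> 0"
    by (rule AE_lebesgue_onI) auto
  moreover have "weak_deriv {0<..<T} x v"
    by (rule weak_deriv_if_primitive[OF T v(1,2) D(1) v(3)])
  moreover have "v \<in> borel_measurable (lebesgue_on {0<..<T})"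
    using v(1) by (intro measurable_restrict_space1 measurable_completion) simp
  ultimately show ?thesis using that v(2) by blast
qed

lemma exact_play_solves:
  assumes ap: "approx_play 0 x y" and lip: "\<Lambda>-lipschitz_on {0..T} x" and x0: "x 0 = xs"
    and start: "xs = min (max (Fm y0) x0) (Fp y0)"
  shows "limit_solution g T Fm Fp x0 y0 x y"
    and "1 \<le> p \<Longrightarrow> gen_play_output p T Fm Fp x0 y x"
    and "W1inf_fun {0<..<T} x"
    and "y C1_differentiable_on {0<..<T}" and "continuous_on {0..T} y"
proof -
  note D = approx_playD[OF ap]
  show cy: "continuous_on {0..T} y" using D(3) by (rule lipschitz_on_continuous_on)
  have cG: "continuous_on {0..T} (\<lambda>t. g (x t, y t, t))" by (rule continuous_on_slow_field[OF D(1) cy])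
  obtain v where v: "v \<in> borel_measurable (lebesgue_on {0<..<T})" "\<And>t. \<bar>v t\<bar> \<le> \<Lambda>"
    "weak_deriv {0<..<T} x v"
    "AE t in lebesgue_on {0<..<T}. \<forall>\<xi>\<in>{Fm (y t)..Fp (y t)}. v t * (x t - \<xi>) \<le> 0"
    using exact_play_weak_deriv[OF ap lip] by blast
  have Wx: "W1p_deriv p {0<..<T} x v" if "1 \<le> p" for p
    unfolding W1p_deriv_def using that v(1-3) D(1)
    by (auto intro: Lp_fun_continuous Lp_fun_bounded[where C = \<Lambda>])
  have Wy: "W1p_deriv p {0<..<T} y (\<lambda>t. g (x t, y t, t))" if "1 \<le> p" for p
    using that by (intro W1p_deriv_if_deriv T D(2) cG) auto
  have in_band: "\<forall>t\<in>{0..T}. x t \<in> {Fm (y t)..Fp (y t)}" using D(8) by auto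
  show "limit_solution g T Fm Fp x0 y0 x y"
    unfolding limit_solution_def
    using D(1,4) cy Wx[of 1] Wy[of 1] v(4) x0 start in_band by auto
  show "gen_play_output p T Fm Fp x0 y x" if "1 \<le> p"
    unfolding gen_play_output_def
    using D(1,4) cy Wx[OF that] Wy[OF that] v(4) x0 start in_band by auto
  obtain C where "\<And>t. t \<in> {0..T} \<Longrightarrow> \<bar>x t\<bar> \<le> C" using continuous_on_Icc_bounded[OF D(1)] by blast
  then have "AE t in lebesgue_on {0<..<T}. \<bar>x t\<bar> \<le> C" by (intro AE_I2) auto
  then have "Linf_fun (lebesgue_on {0<..<T}) x"
    unfolding Linf_fun_def using continuous_on_Icc_measurable[OF D(1)] by blast
  moreover have "Linf_fun (lebesgue_on {0<..<T}) v"
    unfolding Linf_fun_def using v(1,2) by blast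
  ultimately show "W1inf_fun {0<..<T} x"
    unfolding W1inf_fun_def using v(3) by blast
  show "y C1_differentiable_on {0<..<T}"
    unfolding C1_differentiable_on_def
  proof (intro exI conjI ballI)
    show "(y has_vector_derivative g (x t, y t, t)) (at t)" if "t \<in> {0<..<T}" for t
      using D(2)[of t] that at_within_Icc_at[of 0 t T]
      by (simp add: has_real_derivative_iff_has_vector_derivative)
    show "continuous_on {0<..<T} (\<lambda>t. g (x t, y t, t))"
      using cG by (rule continuous_on_subset) auto
  qed
qed

end

section \<open>Fast-slow solutions are approximate solutions\<close>

text \<open>A variable that decreases with speed at least \<open>\<kappa>\<close> above the moving level \<open>h + \<eta>/2\<close> is below
\<open>h + \<eta>\<close> from time \<open>\<eta>\<close> on. Either it has never been below the level \<open>h + \<eta>/2\<close>, and then it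
has descended by more than the diameter \<open>2 X\<close> of its range; or it has, and then the level,
whose speed is at most \<open>\<Lambda> \<le> \<kappa>\<close>, cannot have dropped faster than the variable.\<close>

lemma attracted_below:
  fixes x h :: "real \<Rightarrow> real"
  assumes x: "\<And>t. t \<in> {0..T} \<Longrightarrow> (x has_real_derivative x' t) (at t within {0..T})"
    and h: "\<Lambda>-lipschitz_on {0..T} h"
    and fast: "\<And>t. t \<in> {0..T} \<Longrightarrow> h t + \<eta> / 2 \<le> x t \<Longrightarrow> x' t \<le> - \<kappa>"
    and bnd: "\<And>t. t \<in> {0..T} \<Longrightarrow> \<bar>x t\<bar> \<le> X"
    and \<kappa>: "\<Lambda> \<le> \<kappa>" "2 * X < \<kappa> * \<eta>"
    and \<eta>: "0 < \<eta>" "t \<in> {\<eta>..T}"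
  shows "x t \<le> h t + \<eta>"
proof (rule ccontr)
  assume neg: "\<not> ?thesis"
  have t: "0 \<le> t" "t \<le> T" using \<eta> by auto
  have descent: "x t - x s \<le> - \<kappa> * (t - s)"
    if s: "0 \<le> s" "s \<le> t" and above: "\<And>r. s < r \<Longrightarrow> r \<le> t \<Longrightarrow> h r + \<eta> / 2 < x r" for s
  proof -
    have "x t - x s \<le> - \<kappa> * t - - \<kappa> * s"
    proof (rule increment_mono_deriv[OF x])
      show "((*) (- \<kappa>) has_real_derivative - \<kappa>) (at r within {0..T})" for r
        by (auto intro!: derivative_eq_intros)
      show "x' r \<le> - \<kappa>" if "s < r" "r < t" for r
        using above[of r] that s t by (intro fast) auto
    qed (use s t in auto)
    then show ?thesis by (simp add: algebra_simps)
  qed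
  have \<kappa>0: "0 \<le> \<kappa>" using \<kappa>(1) lipschitz_on_nonneg[OF h] by linarith
  show False
  proof (cases "\<exists>s\<in>{0..t}. x s - h s - \<eta> / 2 \<le> 0")
    case True
    then obtain s where s: "0 \<le> s" "s \<le> t" "x s - h s - \<eta> / 2 \<le> 0" by auto
    have "continuous_on {0..T} (\<lambda>r. x r - h r - \<eta> / 2)"
      using DERIV_continuous_on[OF x] lipschitz_on_continuous_on[OF h]
      by (intro continuous_on_diff continuous_on_const) auto
    then have "continuous_on {s..t} (\<lambda>r. x r - h r - \<eta> / 2)"
      by (rule continuous_on_subset) (use s t in auto)
    then obtain u where u: "s \<le> u" "u < t" "x u - h u - \<eta> / 2 \<le> 0"
        "\<And>r. u < r \<Longrightarrow> r \<le> t \<Longrightarrow> 0 < x r - h r - \<eta> / 2"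
      using last_nonpositive_point[of s t "\<lambda>r. x r - h r - \<eta> / 2"] s neg \<eta>(1) by auto
    have "x t - x u \<le> - \<kappa> * (t - u)"
      by (rule descent) (use u s in force)+
    moreover have "h u - h t \<le> \<Lambda> * (t - u)"
      using lipschitz_onD[OF h, of u t] u s t by (auto simp: dist_real_def abs_le_iff)
    moreover have "\<Lambda> * (t - u) \<le> \<kappa> * (t - u)"
      using \<kappa>(1) u(2) by (intro mult_right_mono) auto
    ultimately show False using u(3) neg \<eta>(1) by (simp add: algebra_simps)
  next
    case False
    then have "x t - x 0 \<le> - \<kappa> * (t - 0)"
      using t by (intro descent) (auto simp: not_le algebra_simps)
    moreover have "\<kappa> * \<eta> \<le> \<kappa> * t" using \<eta> \<kappa>0 by (intro mult_left_mono) auto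
    moreover have "\<bar>x t\<bar> \<le> X" "\<bar>x 0\<bar> \<le> X" using bnd t by auto
    ultimately show False using \<kappa>(2) by (auto simp: abs_le_iff)
  qed
qed

text \<open>The function \<open>(c\<^sup>2 + y\<^sup>2) exp (- 3 m t)\<close> is nonincreasing; the squares avoid differentiating
\<open>|y|\<close>, and \<open>c\<^sup>2\<close> absorbs the inhomogeneity through \<open>2 c |y| \<le> c\<^sup>2 + y\<^sup>2\<close>.\<close>

lemma slow_growth_bound:
  assumes y: "\<And>t. t \<in> {0..T} \<Longrightarrow> (y has_real_derivative y' t) (at t within {0..T})"
    and growth: "\<And>t. t \<in> {0..T} \<Longrightarrow> \<bar>y' t\<bar> \<le> m * (c + \<bar>y t\<bar>)" and m: "0 \<le> m" and t: "t \<in> {0..T}"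
  shows "\<bar>y t\<bar> \<le> sqrt ((c\<^sup>2 + (y 0)\<^sup>2) * exp (3 * m * T))"
proof -
  let ?E = "\<lambda>t. (c\<^sup>2 + (y t)\<^sup>2) * exp (- (3 * m * t))"
  let ?E' = "\<lambda>t. (2 * y t * y' t - 3 * m * (c\<^sup>2 + (y t)\<^sup>2)) * exp (- (3 * m * t))"
  have "?E t - ?E 0 \<le> 0 - 0"
  proof (rule increment_mono_deriv[where u = ?E and a = 0 and b = t and u' = ?E' and w' = "\<lambda>_. 0" and w = "\<lambda>_. 0" and T = T])
    show "(?E has_real_derivative ?E' s) (at s within {0..T})" if "s \<in> {0..T}" for s
      using y[OF that] by (auto intro!: derivative_eq_intros simp: algebra_simps)
    show "?E' s \<le> 0" if "0 < s" "s < t" for s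
    proof -
      have "2 * y s * y' s \<le> 2 * \<bar>y s\<bar> * \<bar>y' s\<bar>"
        by (metis abs_ge_self abs_mult abs_numeral mult.assoc)
      also have "\<dots> \<le> 2 * \<bar>y s\<bar> * (m * (c + \<bar>y s\<bar>))"
        using growth[of s] that t by (intro mult_left_mono) auto
      also have "\<dots> = m * (2 * c * \<bar>y s\<bar> + 2 * (y s)\<^sup>2)"
        by (simp add: algebra_simps power2_eq_square)
      also have "\<dots> \<le> m * (3 * (c\<^sup>2 + (y s)\<^sup>2))"
      proof (rule mult_left_mono[OF _ m])
        have "0 \<le> (c - \<bar>y s\<bar>)\<^sup>2" by simp
        then have amgm: "2 * c * \<bar>y s\<bar> \<le> c\<^sup>2 + (y s)\<^sup>2" by (simp add: power2_diff)
        have gen: "a + 2 * d \<le> 3 * (b + d)" if "a \<le> b + d" "0 \<le> b" for a b d :: real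
          using that by (simp add: distrib_left)
        show "2 * c * \<bar>y s\<bar> + 2 * (y s)\<^sup>2 \<le> 3 * (c\<^sup>2 + (y s)\<^sup>2)"
          by (rule gen[OF amgm]) simp
      qed
      also have "\<dots> = 3 * m * (c\<^sup>2 + (y s)\<^sup>2)" by (simp only: ac_simps)
      finally show ?thesis by (intro mult_nonpos_nonneg) simp_all
    qed
  qed (use t in auto)
  then have "?E t \<le> c\<^sup>2 + (y 0)\<^sup>2" by simp
  then have "?E t * exp (3 * m * t) \<le> (c\<^sup>2 + (y 0)\<^sup>2) * exp (3 * m * t)" by (intro mult_right_mono) auto
  then have "c\<^sup>2 + (y t)\<^sup>2 \<le> (c\<^sup>2 + (y 0)\<^sup>2) * exp (3 * m * t)"
    by (simp add: mult.assoc flip: exp_add)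
  also have "\<dots> \<le> (c\<^sup>2 + (y 0)\<^sup>2) * exp (3 * m * T)"
    using t m by (intro mult_left_mono) (auto intro: mult_left_mono)
  finally have "(y t)\<^sup>2 \<le> (c\<^sup>2 + (y 0)\<^sup>2) * exp (3 * m * T)" by (smt (verit) zero_le_power2)
  then show ?thesis using real_le_rsqrt real_sqrt_le_mono by (metis real_sqrt_abs)
qed

lemma compact_negative_bound:
  fixes f :: "'a::topological_space \<Rightarrow> real"
  assumes "compact S" "continuous_on S f" "\<And>p. p \<in> S \<Longrightarrow> f p < 0"
  obtains c where "0 < c" "\<And>p. p \<in> S \<Longrightarrow> f p \<le> - c"
proof (cases "S = {}")
  case False
  then obtain p where p: "p \<in> S" "\<And>r. r \<in> S \<Longrightarrow> f r \<le> f p"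
    using continuous_attains_sup[OF assms(1) False assms(2)] by blast
  show ?thesis by (rule that[of "- f p"]) (use p assms(3) in auto)
qed (use that[of 1] in auto)

lemma fast_field_gap:
  fixes f :: "real \<times> real \<Rightarrow> real" and F :: "real \<Rightarrow> real"
  assumes f: "continuous_on UNIV f" and F: "continuous_on UNIV F"
    and neg: "\<And>x y. F y < x \<Longrightarrow> f (x, y) < 0" and \<eta>: "0 < \<eta>"
  obtains c where "0 < c" "\<And>x y. \<bar>x\<bar> \<le> X \<Longrightarrow> \<bar>y\<bar> \<le> R \<Longrightarrow> F y + \<eta> \<le> x \<Longrightarrow> f (x, y) \<le> - c"
proof -
  define S where "S = ({-X..X} \<times> {-R..R}) \<inter> {p. F (snd p) + \<eta> \<le> fst p}"
  have "closed {p::real \<times> real. F (snd p) + \<eta> \<le> fst p}"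
    by (intro closed_Collect_le continuous_intros continuous_on_compose2[OF F]) auto
  then have "compact S"
    unfolding S_def by (intro compact_Int_closed compact_Times compact_Icc)
  then obtain c where c: "0 < c" "\<And>p. p \<in> S \<Longrightarrow> f p \<le> - c"
  proof (rule compact_negative_bound)
    show "continuous_on S f" using f by (rule continuous_on_subset) simp
    show "f p < 0" if "p \<in> S" for p
      using that neg[of "snd p" "fst p"] \<eta> by (auto simp: S_def)
  qed blast
  show ?thesis
  proof (rule that[OF c(1)])
    fix x y assume "\<bar>x\<bar> \<le> X" "\<bar>y\<bar> \<le> R" "F y + \<eta> \<le> x"
    then have "(x, y) \<in> S" by (auto simp: S_def abs_le_iff)
    then show "f (x, y) \<le> - c" by (rule c(2))
  qed
qed

text \<open>The monotonicity of the fast variable beyond the barriers is the sign of \<open>f\<close> and holds for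
every \<open>\<epsilon>\<close>. For the band, \<open>|f| \<ge> c\<close> at distance at least \<open>\<eta>/2\<close> from it, within the compact
range of the solutions, so the attraction speed \<open>\<kappa> = c / \<epsilon>\<close> beats the speed \<open>L K\<close> of the
barriers when \<open>\<epsilon>\<close> is small.\<close>

lemma (in play_system) fast_slow_imp_approx_play:
  fixes f :: "real \<times> real \<Rightarrow> real"
  assumes f: "continuous_on UNIV f"
    and signs: "\<And>x y. Fp y < x \<Longrightarrow> f (x, y) < 0"
      "\<And>x y. x \<in> {Fm y..Fp y} \<Longrightarrow> f (x, y) = 0"
      "\<And>x y. x < Fm y \<Longrightarrow> 0 < f (x, y)"
    and start: "xs = min (max (Fm y0) x0) (Fp y0)"
    and sol: "\<And>\<epsilon>. 0 < \<epsilon> \<Longrightarrow> fast_slow_solution f g T x0 y0 \<epsilon> (xe \<epsilon>) (ye \<epsilon>)"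
    and lip: "\<And>\<epsilon>. 0 < \<epsilon> \<Longrightarrow> K-lipschitz_on {0..T} (ye \<epsilon>)"
    and X: "\<And>\<epsilon> t. 0 < \<epsilon> \<Longrightarrow> t \<in> {0..T} \<Longrightarrow> \<bar>xe \<epsilon> t\<bar> \<le> X"
    and R: "\<And>\<epsilon> t. 0 < \<epsilon> \<Longrightarrow> t \<in> {0..T} \<Longrightarrow> \<bar>ye \<epsilon> t\<bar> \<le> R"
    and \<eta>: "0 < \<eta>"
  shows "\<forall>\<^sub>F \<epsilon> in at_right 0. approx_play \<eta> (xe \<epsilon>) (ye \<epsilon>)"
proof -
  have cF: "continuous_on UNIV Fp" "continuous_on UNIV Fm"
    using Fp_lip Fm_lip by (auto intro: lipschitz_on_continuous_on)
  have \<eta>2: "0 < \<eta> / 2" using \<eta> by simp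
  obtain c1 where c1: "0 < c1" "\<And>x y. \<bar>x\<bar> \<le> X \<Longrightarrow> \<bar>y\<bar> \<le> R \<Longrightarrow> Fp y + \<eta> / 2 \<le> x \<Longrightarrow> f (x, y) \<le> - c1"
    using fast_field_gap[OF f cF(1) signs(1) \<eta>2] by blast
  have "continuous_on UNIV (\<lambda>p. - f (- fst p, snd p))" "continuous_on UNIV (\<lambda>y. - Fm y)"
    using cF by (auto intro!: continuous_intros continuous_on_compose2[OF f])
  from fast_field_gap[OF this _ \<eta>2, of X R]
  obtain c2 where c2: "0 < c2"
      "\<And>x y. \<bar>x\<bar> \<le> X \<Longrightarrow> \<bar>y\<bar> \<le> R \<Longrightarrow> - Fm y + \<eta> / 2 \<le> x \<Longrightarrow> - f (- x, y) \<le> - c2"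
    using signs(3) by (metis (no_types, lifting) fst_conv snd_conv minus_less_iff neg_less_0_iff_less)
  define c where "c = min c1 c2"
  have c: "0 < c" "c \<le> c1" "c \<le> c2" using c1 c2 by (auto simp: c_def)
  \<comment> \<open>for \<open>\<epsilon> < \<epsilon>0\<close> the speed \<open>\<kappa> = c / \<epsilon>\<close> exceeds \<open>L K\<close> and \<open>\<kappa> \<eta>\<close> exceeds \<open>2 X\<close>\<close>
  define \<epsilon>0 where "\<epsilon>0 = min (c / (L * K + 1)) (c * \<eta> / (2 * \<bar>X\<bar> + 1))"
  have LK: "0 \<le> L * K" using L K by simp
  have \<epsilon>0: "0 < \<epsilon>0" unfolding \<epsilon>0_def using c \<eta> LK by (simp add: add_nonneg_pos)
  have "approx_play \<eta> (xe \<epsilon>) (ye \<epsilon>)" if \<epsilon>: "0 < \<epsilon>" "\<epsilon> < \<epsilon>0" for \<epsilon>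
  proof -
    let ?x = "xe \<epsilon>" and ?y = "ye \<epsilon>"
    have dx: "\<And>t. t \<in> {0..T} \<Longrightarrow> (?x has_real_derivative f (?x t, ?y t) / \<epsilon>) (at t within {0..T})"
      and dy: "\<And>t. t \<in> {0..T} \<Longrightarrow> (?y has_real_derivative g (?x t, ?y t, t)) (at t within {0..T})"
      and init: "?x 0 = x0" "?y 0 = y0"
      using sol[OF \<epsilon>(1)] unfolding fast_slow_solution_def by auto
    have dmx: "((\<lambda>t. - ?x t) has_real_derivative - (f (?x t, ?y t) / \<epsilon>)) (at t within {0..T})"
      if "t \<in> {0..T}" for t using DERIV_minus[OF dx[OF that]] .
    have "\<epsilon> < c / (L * K + 1)" "\<epsilon> < c * \<eta> / (2 * \<bar>X\<bar> + 1)" using \<epsilon> by (auto simp: \<epsilon>0_def)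
    then have \<kappa>: "L * K \<le> c / \<epsilon>" "2 * X < c / \<epsilon> * \<eta>"
    proof -
      have "\<epsilon> * (L * K + 1) < c" using \<open>\<epsilon> < c / (L * K + 1)\<close> LK by (simp add: field_simps)
      then have "L * K * \<epsilon> \<le> c" using \<epsilon>(1) by (simp add: algebra_simps)
      then show "L * K \<le> c / \<epsilon>" using \<epsilon>(1) by (simp add: field_simps)
      have "\<epsilon> * (2 * \<bar>X\<bar> + 1) < c * \<eta>" using \<open>\<epsilon> < c * \<eta> / (2 * \<bar>X\<bar> + 1)\<close> by (simp add: field_simps)
      moreover have "2 * X * \<epsilon> \<le> \<epsilon> * (2 * \<bar>X\<bar> + 1)" using \<epsilon>(1) by (simp add: mult.commute)
      ultimately show "2 * X < c / \<epsilon> * \<eta>" using \<epsilon>(1) by (simp add: field_simps)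
    qed
    have hp: "(L * K)-lipschitz_on {0..T} (\<lambda>t. Fp (?y t))" "(L * K)-lipschitz_on {0..T} (\<lambda>t. - Fm (?y t))"
    proof -
      show "(L * K)-lipschitz_on {0..T} (\<lambda>t. Fp (?y t))"
        by (rule lipschitz_onI[OF _ LK])
           (use barriers_along_path(2)[OF lip[OF \<epsilon>(1)]] in \<open>simp add: dist_real_def\<close>)
      show "(L * K)-lipschitz_on {0..T} (\<lambda>t. - Fm (?y t))"
        by (rule lipschitz_onI[OF _ LK])
           (use barriers_along_path(1)[OF lip[OF \<epsilon>(1)]] in \<open>simp add: dist_real_def abs_minus_commute\<close>)
    qed
    have upper: "?x t \<le> Fp (?y t) + \<eta>" if "t \<in> {\<eta>..T}" for t
    proof (rule attracted_below[OF dx hp(1) _ X[OF \<epsilon>(1)] \<kappa> \<eta> that])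
      fix s assume s: "s \<in> {0..T}" "Fp (?y s) + \<eta> / 2 \<le> ?x s"
      have "f (?x s, ?y s) \<le> - c" using c1(2)[OF X[OF \<epsilon>(1) s(1)] R[OF \<epsilon>(1) s(1)] s(2)] c(2) by linarith
      then show "f (?x s, ?y s) / \<epsilon> \<le> - (c / \<epsilon>)" using \<epsilon>(1) by (simp add: field_simps)
    qed
    have lower: "- ?x t \<le> - Fm (?y t) + \<eta>" if "t \<in> {\<eta>..T}" for t
    proof (rule attracted_below[OF dmx hp(2) _ _ \<kappa> \<eta> that])
      fix s assume s: "s \<in> {0..T}" "- Fm (?y s) + \<eta> / 2 \<le> - ?x s"
      have "- f (?x s, ?y s) \<le> - c" using c2(2)[OF _ R[OF \<epsilon>(1) s(1)] s(2)] X[OF \<epsilon>(1) s(1)] c(3) by simp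
      then show "- (f (?x s, ?y s) / \<epsilon>) \<le> - (c / \<epsilon>)" using \<epsilon>(1) by (simp add: field_simps)
    qed (use X[OF \<epsilon>(1)] in auto)
    have "falls_above {0..T} (\<lambda>t. Fm (?y t)) ?x"
    proof (rule falls_above_if_deriv_nonpos[OF dx])
      fix t assume "Fm (?y t) < ?x t"
      then have "f (?x t, ?y t) \<le> 0"
        using signs(1)[of "?y t" "?x t"] signs(2)[of "?x t" "?y t"] by (cases "?x t \<le> Fp (?y t)") auto
      then show "f (?x t, ?y t) / \<epsilon> \<le> 0" using \<epsilon>(1) by (simp add: divide_nonpos_pos)
    qed
    moreover have "falls_above {0..T} (\<lambda>t. - Fp (?y t)) (\<lambda>t. - ?x t)"
    proof (rule falls_above_if_deriv_nonpos[OF dmx])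
      fix t assume "- Fp (?y t) < - ?x t"
      then have "0 \<le> f (?x t, ?y t)"
        using signs(3)[of "?x t" "?y t"] signs(2)[of "?x t" "?y t"] by (cases "Fm (?y t) \<le> ?x t") auto
      then show "- (f (?x t, ?y t) / \<epsilon>) \<le> 0" using \<epsilon>(1) by simp
    qed
    moreover have "continuous_on {0..T} ?x" using dx by (rule DERIV_continuous_on)
    moreover have "\<forall>t\<in>{\<eta>..T}. Fm (?y t) - \<eta> \<le> ?x t \<and> ?x t \<le> Fp (?y t) + \<eta>"
      using upper lower by fastforce
    ultimately show ?thesis
      unfolding approx_play_def using dy lip[OF \<epsilon>(1)] init start by simp
  qed
  then show ?thesis using \<epsilon>0 by (auto simp: eventually_at_right intro!: exI[of _ \<epsilon>0])
qed

text \<open>The fast variable falls above every constant that exceeds the upper barrier, and dually.\<close>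

lemma fast_variable_bound:
  assumes \<epsilon>: "0 < \<epsilon>" and sol: "fast_slow_solution f g T x0 y0 \<epsilon> x y"
    and neg: "\<And>x y. Fp y < x \<Longrightarrow> f (x, y) < 0"
    and pos: "\<And>x y. x < Fm y \<Longrightarrow> 0 < f (x, y)"
    and FR: "\<And>t. t \<in> {0..T} \<Longrightarrow> \<bar>Fm (y t)\<bar> \<le> X" "\<And>t. t \<in> {0..T} \<Longrightarrow> \<bar>Fp (y t)\<bar> \<le> X"
    and x0: "\<bar>x0\<bar> \<le> X" and t: "t \<in> {0..T}"
  shows "\<bar>x t\<bar> \<le> X"
proof -
  have dx: "\<And>t. t \<in> {0..T} \<Longrightarrow> (x has_real_derivative f (x t, y t) / \<epsilon>) (at t within {0..T})"
    and init: "x 0 = x0" using sol unfolding fast_slow_solution_def by auto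
  have dmx: "((\<lambda>t. - x t) has_real_derivative - (f (x t, y t) / \<epsilon>)) (at t within {0..T})"
    if "t \<in> {0..T}" for t using DERIV_minus[OF dx[OF that]] .
  have "falls_above {0..T} (\<lambda>_. X) x"
  proof (rule falls_above_if_deriv_nonpos[OF dx])
    fix t assume t: "t \<in> {0..T}" "X < x t"
    then have "f (x t, y t) < 0" using FR(2)[OF t(1)] by (intro neg) auto
    then show "f (x t, y t) / \<epsilon> \<le> 0" using \<epsilon> by (simp add: divide_nonpos_pos)
  qed
  then have "x t \<le> X"
    by (rule falls_above_le[where s = 0]) (use DERIV_continuous_on[OF dx] t init x0 in auto)
  have "falls_above {0..T} (\<lambda>_. X) (\<lambda>t. - x t)"
  proof (rule falls_above_if_deriv_nonpos[OF dmx])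
    fix t assume t: "t \<in> {0..T}" "X < - x t"
    then have "0 < f (x t, y t)" using FR(1)[OF t(1)] by (intro pos) auto
    then show "- (f (x t, y t) / \<epsilon>) \<le> 0" using \<epsilon> by simp
  qed
  then have "- x t \<le> X"
    by (rule falls_above_le[where s = 0]) (use DERIV_continuous_on[OF dmx] t init x0 in auto)
  with \<open>x t \<le> X\<close> show ?thesis by (simp add: abs_le_iff)
qed

section \<open>Convergence to the generalized play\<close>

theorem theorem3p1:
  fixes T x0 y0 q Lf Lg Lp Lm :: real
    and f :: "real \<times> real \<Rightarrow> real"
    and g :: "real \<times> real \<times> real \<Rightarrow> real"
    and Fm Fp M G :: "real \<Rightarrow> real"
    and xe ye :: "real \<Rightarrow> real \<Rightarrow> real"
  assumes T: "T > 0"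
    and A1: "Lf-lipschitz_on UNIV f" "Lg-lipschitz_on UNIV g"
    and A2: "\<And>y. Fm y < Fp y"
      "\<And>x y. x > Fp y \<Longrightarrow> f (x, y) < 0"
      "\<And>x y. x \<in> {Fm y..Fp y} \<Longrightarrow> f (x, y) = 0"
      "\<And>x y. x < Fm y \<Longrightarrow> f (x, y) > 0"
    and A3: "Lp-lipschitz_on UNIV Fp" "Lm-lipschitz_on UNIV Fm" "mono Fp" "mono Fm"
    and A4: "continuous_on UNIV M" "\<And>t. M t > 0" "bounded (range G)"
      "\<And>x y t. \<bar>g (x, y, t)\<bar> \<le> M t * (1 + G x + \<bar>y\<bar>)"
    and sol: "\<And>\<epsilon>. \<epsilon> > 0 \<Longrightarrow> fast_slow_solution f g T x0 y0 \<epsilon> (xe \<epsilon>) (ye \<epsilon>)"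
    and q: "1 < q"
  shows "\<exists>xb yb.
    limit_solution g T Fm Fp x0 y0 xb yb \<and>
    (\<forall>x y. limit_solution g T Fm Fp x0 y0 x y \<longrightarrow> (\<forall>t\<in>{0..T}. x t = xb t \<and> y t = yb t)) \<and>
    W1inf_fun {0<..<T} xb \<and>
    yb C1_differentiable_on {0<..<T} \<and> continuous_on {0..T} yb \<and>
    tendsto_Lp q (lebesgue_on {0<..<T}) xe xb (at_right 0) \<and>
    tendsto_W1p q {0<..<T} ye yb (at_right 0) \<and>
    (\<forall>p\<ge>1. gen_play_output p T Fm Fp x0 yb xb)"
proof -
  define L where "L = max Lp Lm"
  have FL: "L-lipschitz_on UNIV Fp" "L-lipschitz_on UNIV Fm"
    using A3(1,2) by (auto simp: L_def intro: lipschitz_on_le)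
  obtain CG where CG: "0 < CG" "\<And>x. \<bar>G x\<bar> \<le> CG"
    using A4(3) unfolding bounded_pos by auto
  obtain m where m: "0 \<le> m" "\<And>t. t \<in> {0..T} \<Longrightarrow> \<bar>M t\<bar> \<le> m"
    using continuous_on_Icc_bounded[OF continuous_on_subset[OF A4(1)]] by blast
  define c where "c = 1 + CG"
  have growth: "\<bar>g (x, y, t)\<bar> \<le> m * (c + \<bar>y\<bar>)" if "t \<in> {0..T}" for x y t
  proof -
    have "M t * (1 + G x + \<bar>y\<bar>) \<le> M t * (c + \<bar>y\<bar>)"
      using A4(2)[of t] CG(2)[of x] by (intro mult_left_mono) (auto simp: c_def abs_le_iff)
    also have "\<dots> \<le> m * (c + \<bar>y\<bar>)"
      using m(2)[OF that] CG(1) by (intro mult_right_mono) (auto simp: c_def)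
    finally show ?thesis using A4(4)[of x y t] by linarith
  qed
  \<comment> \<open>the bound of the slow variable does not involve the fast one, because \<open>G\<close> is bounded\<close>
  define R where "R = sqrt ((c\<^sup>2 + y0\<^sup>2) * exp (3 * m * T))"
  define K where "K = m * (c + R)"
  have c0: "0 \<le> c" using CG by (simp add: c_def)
  have R0: "0 \<le> R" by (simp add: R_def)
  have K0: "0 \<le> K" using m c0 R0 by (simp add: K_def)
  have slow: "\<bar>y t\<bar> \<le> R" "K-lipschitz_on {0..T} y"
    if dy: "\<And>t. t \<in> {0..T} \<Longrightarrow> (y has_real_derivative g (x t, y t, t)) (at t within {0..T})"
      and y0: "y 0 = y0" and t: "t \<in> {0..T}" for x y t
  proof -
    have yR: "\<bar>y t\<bar> \<le> R" if "t \<in> {0..T}" for t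
      using slow_growth_bound[OF dy growth m(1) that] y0 by (simp add: R_def)
    show "\<bar>y t\<bar> \<le> R" using yR t .
    have g_le: "\<bar>g (x t, y t, t)\<bar> \<le> K" if "t \<in> {0..T}" for t
    proof -
      have "m * (c + \<bar>y t\<bar>) \<le> K" unfolding K_def using yR[OF that] m(1) by (intro mult_left_mono) auto
      then show ?thesis using growth[OF that, of "x t" "y t"] by linarith
    qed
    have inc: "\<bar>y b - y a\<bar> \<le> K * b - K * a" if "0 \<le> a" "a \<le> b" "b \<le> T" for a b
      by (rule increment_bound_deriv[where w' = "\<lambda>_. K" and T = T, OF dy])
         (use that g_le in \<open>auto intro!: derivative_eq_intros\<close>)
    show "K-lipschitz_on {0..T} y"
    proof (rule lipschitz_onI[OF _ K0])
      fix a b assume "a \<in> {0..T}" "b \<in> {0..T}"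
      then show "dist (y a) (y b) \<le> K * dist a b"
        using inc[of a b] inc[of b a]
        by (cases "a \<le> b") (auto simp: dist_real_def abs_minus_commute right_diff_distrib)
    qed
  qed
  define xs where "xs = min (max (Fm y0) x0) (Fp y0)"
  interpret play_system T y0 xs Lg L K g Fm Fp
    by unfold_locales (use T A1(2) FL A2(1) K0 less_imp_le[OF A2(1), of y0] in \<open>auto simp: xs_def\<close>)
  have sol': "\<And>t. t \<in> {0..T} \<Longrightarrow> (ye \<epsilon> has_real_derivative g (xe \<epsilon> t, ye \<epsilon> t, t)) (at t within {0..T})"
      "\<And>t. t \<in> {0..T} \<Longrightarrow> (xe \<epsilon> has_real_derivative f (xe \<epsilon> t, ye \<epsilon> t) / \<epsilon>) (at t within {0..T})"
      "ye \<epsilon> 0 = y0" if "0 < \<epsilon>" for \<epsilon>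
    using sol[OF that] unfolding fast_slow_solution_def by auto
  have yR: "\<bar>ye \<epsilon> t\<bar> \<le> R" and ylip: "K-lipschitz_on {0..T} (ye \<epsilon>)" if "0 < \<epsilon>" "t \<in> {0..T}" for \<epsilon> t
    using slow[OF sol'(1,3)[OF that(1)] that(2)] by auto
  have ylip: "K-lipschitz_on {0..T} (ye \<epsilon>)" if "0 < \<epsilon>" for \<epsilon>
    using ylip[OF that, of 0] T by simp
  define X where "X = \<bar>x0\<bar> + \<bar>Fm 0\<bar> + \<bar>Fp 0\<bar> + L * R"
  have FX: "\<bar>Fm b\<bar> \<le> X" "\<bar>Fp b\<bar> \<le> X" if "\<bar>b\<bar> \<le> R" for b
  proof -
    have "L * \<bar>b - 0\<bar> \<le> L * R" using that L by (intro mult_left_mono) auto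
    then show "\<bar>Fm b\<bar> \<le> X" "\<bar>Fp b\<bar> \<le> X"
      using lipschitz_on_abs[OF FL(1), of b 0] lipschitz_on_abs[OF FL(2), of b 0] by (auto simp: X_def)
  qed
  have xX: "\<bar>xe \<epsilon> t\<bar> \<le> X" if "0 < \<epsilon>" "t \<in> {0..T}" for \<epsilon> t
    by (rule fast_variable_bound[OF that(1) sol[OF that(1)] A2(2,4) _ _ _ that(2)])
       (use FX yR[OF that(1)] L R0 in \<open>auto simp: X_def\<close>)
  have ev: "\<forall>\<^sub>F \<epsilon> in at_right 0. approx_play \<eta> (xe \<epsilon>) (ye \<epsilon>)" if "0 < \<eta>" for \<eta>
    by (rule fast_slow_imp_approx_play[OF lipschitz_on_continuous_on[OF A1(1)] A2(2-4) xs_def sol ylip xX yR that])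
  obtain xb yb where ap: "approx_play 0 xb yb" and lip_x: "(L * K)-lipschitz_on {0..T} xb"
    and close: "\<And>\<eta> x y. 0 < \<eta> \<Longrightarrow> \<eta> \<le> T \<Longrightarrow> approx_play \<eta> x y \<Longrightarrow>
       (\<forall>t\<in>{\<eta>..T}. \<bar>x t - xb t\<bar> \<le> stab * \<eta>) \<and> (\<forall>t\<in>{0..T}. \<bar>y t - yb t\<bar> \<le> stab * \<eta>)"
    using approx_play_converges[where F = "at_right 0" and xe = xe and ye = ye] ev by auto
  note D = approx_playD[OF ap]
  have xb0: "xb 0 = xs" using D(7) D(8)[of 0] D(4) T by simp
  have solution: "limit_solution g T Fm Fp x0 y0 xb yb" "\<forall>p\<ge>1. gen_play_output p T Fm Fp x0 yb xb"
      "W1inf_fun {0<..<T} xb" "yb C1_differentiable_on {0<..<T}" "continuous_on {0..T} yb"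
    using exact_play_solves[OF ap lip_x xb0 xs_def] by auto
  have unique: "x t = xb t \<and> y t = yb t"
    if s: "limit_solution g T Fm Fp x0 y0 x y" and t: "t \<in> {0..T}" for x y t
  proof -
    have ap': "approx_play 0 x y"
      by (rule limit_solution_imp_approx_play[OF s xs_def slow(2)[where t = 0]]) (use T in auto)
    have eq: "\<bar>x r - xb r\<bar> \<le> 0" "\<bar>y r - yb r\<bar> \<le> 0" if r: "0 < r" "r \<le> T" for r
    proof -
      have "\<bar>x r - xb r\<bar> \<le> 0 + stab * \<eta> \<and> \<bar>y r - yb r\<bar> \<le> 0 + stab * \<eta>" if "0 < \<eta>" "\<eta> \<le> r" for \<eta>
        using close[of \<eta> x y] approx_play_mono[OF ap', of \<eta>] that r by auto
      then show "\<bar>x r - xb r\<bar> \<le> 0" "\<bar>y r - yb r\<bar> \<le> 0"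
        using le_if_le_add_small[OF r(1)] by blast+
    qed
    moreover have "x 0 = xb 0" "y 0 = yb 0"
      using s xb0 D(4) unfolding limit_solution_def by (auto simp: xs_def)
    ultimately show ?thesis using t by (cases "t = 0") auto
  qed
  have near: "\<forall>\<^sub>F \<epsilon> in at_right 0. \<bar>xe \<epsilon> t - xb t\<bar> < e \<and> \<bar>ye \<epsilon> t - yb t\<bar> < e"
    if e: "0 < e" and t: "t \<in> {0<..<T}" for e t
  proof -
    define \<eta> where "\<eta> = min t (e / (2 * (stab + 1)))"
    have s1: "0 < stab + 1" using stab_nonneg by simp
    have \<eta>: "0 < \<eta>" "\<eta> \<le> t" unfolding \<eta>_def using t e s1 by auto
    have "\<eta> \<le> e / (2 * (stab + 1))" by (simp add: \<eta>_def)
    then have "(stab + 1) * \<eta> \<le> e / 2" using s1 by (simp add: field_simps)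
    then have lt: "stab * \<eta> < e" using e \<eta> by (simp add: distrib_right)
    show ?thesis
      using ev[OF \<eta>(1)]
    proof eventually_elim
      case (elim \<epsilon>)
      then have "\<bar>xe \<epsilon> t - xb t\<bar> \<le> stab * \<eta>" "\<bar>ye \<epsilon> t - yb t\<bar> \<le> stab * \<eta>"
        using close[OF \<eta>(1) _ elim] \<eta> t by auto
      then show ?case using lt by linarith
    qed
  qed
  have lim: "((\<lambda>\<epsilon>. xe \<epsilon> t) \<longlongrightarrow> xb t) (at_right 0)" "((\<lambda>\<epsilon>. ye \<epsilon> t) \<longlongrightarrow> yb t) (at_right 0)"
    if t: "t \<in> {0<..<T}" for t
    using near[OF _ t] unfolding tendsto_iff dist_real_def eventually_conj_iff by auto
  have cx: "continuous_on {0..T} (xe \<epsilon>)" and cy: "continuous_on {0..T} (ye \<epsilon>)" if "0 < \<epsilon>" for \<epsilon>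
    by (rule DERIV_continuous_on[OF sol'(2)[OF that]] DERIV_continuous_on[OF sol'(1)[OF that]], assumption)+
  have q0: "0 < q" using q by simp
  have conv_x: "tendsto_Lp q (lebesgue_on {0<..<T}) xe xb (at_right 0)"
    by (rule tendsto_Lp_if_bounded_pointwise[OF q0 cx xX D(1) lim(1)])
  have conv_y: "tendsto_Lp q (lebesgue_on {0<..<T}) ye yb (at_right 0)"
    by (rule tendsto_Lp_if_bounded_pointwise[OF q0 cy yR solution(5) lim(2)])
  have conv_dy: "tendsto_Lp q (lebesgue_on {0<..<T}) (\<lambda>\<epsilon> t. g (xe \<epsilon> t, ye \<epsilon> t, t))
      (\<lambda>t. g (xb t, yb t, t)) (at_right 0)"
  proof (rule tendsto_Lp_if_bounded_pointwise[OF q0 continuous_on_slow_field[OF cx cy]])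
    show "continuous_on {0..T} (\<lambda>t. g (xb t, yb t, t))" by (rule continuous_on_slow_field[OF D(1) solution(5)])
    show "\<bar>g (xe \<epsilon> t, ye \<epsilon> t, t)\<bar> \<le> K" if "0 < \<epsilon>" "t \<in> {0..T}" for \<epsilon> t
    proof -
      have "m * (c + \<bar>ye \<epsilon> t\<bar>) \<le> K" unfolding K_def using yR[OF that] m(1) by (intro mult_left_mono) auto
      then show ?thesis using growth[OF that(2), of "xe \<epsilon> t" "ye \<epsilon> t"] by linarith
    qed
    show "((\<lambda>\<epsilon>. g (xe \<epsilon> t, ye \<epsilon> t, t)) \<longlongrightarrow> g (xb t, yb t, t)) (at_right 0)" if "t \<in> {0<..<T}" for t
      by (rule continuous_on_tendsto_compose[OF lipschitz_on_continuous_on[OF g_lip]])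
         (use lim[OF that] in \<open>auto intro!: tendsto_intros\<close>)
  qed
  have "\<forall>\<^sub>F \<epsilon> in at_right 0. W1p_deriv q {0<..<T} (ye \<epsilon>) (\<lambda>t. g (xe \<epsilon> t, ye \<epsilon> t, t))"
    using eventually_at_right_less[of 0]
    by eventually_elim (intro W1p_deriv_if_deriv T q0 sol' continuous_on_slow_field cx cy)
  moreover have "W1p_deriv q {0<..<T} yb (\<lambda>t. g (xb t, yb t, t))"
    by (intro W1p_deriv_if_deriv T q0 D(2) continuous_on_slow_field D(1) solution(5))
  ultimately have "tendsto_W1p q {0<..<T} ye yb (at_right 0)"
    unfolding tendsto_W1p_def using conv_y conv_dy
    by (intro exI[of _ "\<lambda>\<epsilon> t. g (xe \<epsilon> t, ye \<epsilon> t, t)"] exI[of _ "\<lambda>t. g (xb t, yb t, t)"]) auto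
  then show ?thesis using solution unique conv_x by blast
qed

end
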